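(* Let $k,t$ be positive integers and let $\widehat{B}$ be a signed bipartite graph of unbalanced girth $2k$. Then $\widehat{B}$ bounds $\mathcal{SBPT}_{t,2k}$ if and only if there exists a partial $\widehat{B}$-distance graph $(\widehat{B},w)$ together with a non-empty set $\mathcal{W}$ of $(t+1)$-cliques of $(\widehat{B},w)$ which is $(t,2k)$-closed.
   Context: A signed graph $(G,\sigma)$ is a graph with $\sigma:E(G)\to\{+,-\}$; it is signed bipartite if $G$ is bipartite. Switching at $v$ negates the signs of the non-loop edges at $v$. The sign of a cycle/path is the product of its edge signs; the unbalanced girth is the length of a shortest negative cycle. A homomorphism $(G,\sigma)\to(H,\pi)$ is a graph homomorphism $f$ with $\sigma(C)=\pi(f(C))$ for every cycle $C$ (equivalently: switch, then map preserving adjacency and signs). $\widehat{B}$ bounds a class if every member admits a homomorphism to $\widehat{B}$. A $t$-tree is obtained from $K_{t+1}$ by repeatedly adding a vertex joined to all vertices of an existing $K_t$; a partial $t$-tree is a subgraph of a $t$-tree. $\mathcal{SBPT}_{t,2k}$ is the class of signed bipartite graphs whose underlying graph is a partial $t$-tree and whose unbalanced girth is at least $2k$. The algebraic distance $ad(x,y)$ is $d(x,y)\sigma(P)$ for a shortest $x$–$y$ path $P$ (positive one chosen if both signs occur). A signed edge-weighted graph is a graph with nonzero integer edge weights; switching at $v$ negates weights at $v$; it is bipartite if some vertex partition $\{X,Y\}$ makes cross edges odd-weighted and inner edges even-weighted. The signed $\widehat{B}$-distance complete graph is the complete graph on $V(\widehat{B})$ with weight $ad_{\widehat{B}}(x,y)$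 on $xy$; a partial $\widehat{B}$-distance graph is any spanning weighted subgraph of it. For weights with $1\le|w(e)|\le k$, $\overline{\overline{(H,w)}}_{-2k}$ replaces each edge $e=xy$ by two internally disjoint $x$–$y$ paths, one of length $|w(e)|$ with the sign of $w(e)$ and one of length $2k-|w(e)|$ with the opposite sign; $(H,w)$ is $2k$-wide if this signed graph has unbalanced girth $2k$. An isomorphism of signed edge-weighted graphs is a switching followed by a weight-preserving bijection mapping edges onto edges. $\mathcal{L}(t+1,2k)$ is the set of all (unlabeled) bipartite $2k$-wide signed edge-weighted complete graphs on $t+1$ vertices. A set $\mathcal{W}$ of $(t+1)$-cliques (complete subgraphs on $t+1$ vertices, inherited weights) of a signed edge-weighted graph is $(t,2k)$-closed if for every $K\in\mathcal{W}$, every vertex $v$ of $K$, every $X\in\mathcal{L}(t+1,2k)$, every vertex $x$ of $X$ and every isomorphism $\xi$ from $K-v$ to $X-x$, there is $K'\in\mathcal{W}$ containing all vertices of $K-v$ such that $\xi$ extends to an isomorphism of $K'$ and $X$.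
   Formalization: Signed graphs are finite and simple (so k=1 is vacuous), the partial distance graph must have weights with 1≤|w|≤k, and weights k and -k are identified in isomorphisms of signed edge-weighted graphs; without the last two the claim fails for k=t=2. *)

theory Defs
  imports Main "HOL-Library.Extended_Nat"
begin

section \<open>Signed graphs\<close>

text \<open>
  A signed edge is a pair of its set of one (loop) or two end vertices and its sign \<open>1\<close> or \<open>-1\<close>.
  Two vertices may be joined by both a positive and a negative edge; such a pair of parallel edges
  is a negative 2-cycle.  Parallel edges of equal sign are not represented.
\<close>

record 'v sgraph =
  verts :: "'v set"
  sedges :: "('v set \<times> int) set"

definition signed_graph :: "'v sgraph \<Rightarrow> bool" where
  "signed_graph G \<longleftrightarrow> finite (verts G) \<and>
     (\<forall>(e, s) \<in> sedges G. e \<subseteq> verts G \<and> (card e = 1 \<or> card e = 2) \<and> s \<in> {-1, 1})"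

definition edges_of :: "'v sgraph \<Rightarrow> 'v set set" where
  "edges_of G = fst ` sedges G"

definition simple_graph :: "'v sgraph \<Rightarrow> bool" where
  "simple_graph G \<longleftrightarrow> (\<forall>e \<in> edges_of G. card e = 2) \<and> inj_on fst (sedges G)"

definition bipartite :: "'v sgraph \<Rightarrow> bool" where
  "bipartite G \<longleftrightarrow> (\<exists>X Y. X \<union> Y = verts G \<and> X \<inter> Y = {} \<and>
     (\<forall>e \<in> edges_of G. \<exists>x\<in>X. \<exists>y\<in>Y. e = {x, y}))"

definition walk :: "'v sgraph \<Rightarrow> 'v list \<Rightarrow> ('v set \<times> int) list \<Rightarrow> bool" where
  "walk G vs es \<longleftrightarrow> set vs \<subseteq> verts G \<and> length vs = Suc (length es) \<and>
     (\<forall>i < length es. es ! i \<in> sedges G \<and> fst (es ! i) = {vs ! i, vs ! Suc i})"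

text \<open>\<open>distinct es\<close> only matters for length 2, where it forbids going back along the same edge.\<close>

definition cycle :: "'v sgraph \<Rightarrow> 'v list \<Rightarrow> ('v set \<times> int) list \<Rightarrow> bool" where
  "cycle G vs es \<longleftrightarrow>
     walk G vs es \<and> es \<noteq> [] \<and> hd vs = last vs \<and> distinct (tl vs) \<and> distinct es"

definition path_between ::
    "'v sgraph \<Rightarrow> 'v \<Rightarrow> 'v \<Rightarrow> 'v list \<Rightarrow> ('v set \<times> int) list \<Rightarrow> bool" where
  "path_between G x y vs es \<longleftrightarrow> walk G vs es \<and> distinct vs \<and> hd vs = x \<and> last vs = y"

definition sign_of :: "('v set \<times> int) list \<Rightarrow> int" where
  "sign_of es = prod_list (map snd es)"

text \<open>The value is \<open>\<infinity>\<close> if there is no negative cycle.\<close>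

definition unbalanced_girth :: "'v sgraph \<Rightarrow> enat" where
  "unbalanced_girth G = Inf {enat (length es) | vs es. cycle G vs es \<and> sign_of es = -1}"

text \<open>
  As parallel edges are allowed, a homomorphism consists of a vertex map \<open>f\<close> and a compatible map
  \<open>g\<close> on signed edges; \<open>map g es\<close> is the image of a cycle.
\<close>

definition signed_hom ::
    "'a sgraph \<Rightarrow> 'b sgraph \<Rightarrow> ('a \<Rightarrow> 'b) \<Rightarrow> ('a set \<times> int \<Rightarrow> 'b set \<times> int) \<Rightarrow> bool" where
  "signed_hom G H f g \<longleftrightarrow>
     f ` verts G \<subseteq> verts H \<and>
     (\<forall>e \<in> sedges G. g e \<in> sedges H \<and> fst (g e) = f ` fst e) \<and>
     (\<forall>vs es. cycle G vs es \<longrightarrow> sign_of es = sign_of (map g es))"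

definition bounds :: "'b sgraph \<Rightarrow> 'a sgraph set \<Rightarrow> bool" where
  "bounds B \<C> \<longleftrightarrow> (\<forall>G \<in> \<C>. \<exists>f g. signed_hom G B f g)"


section \<open>Partial t-trees\<close>

inductive t_tree :: "nat \<Rightarrow> 'v set \<Rightarrow> 'v set set \<Rightarrow> bool" for t :: nat where
  base: "card V = Suc t \<Longrightarrow> t_tree t V {e. e \<subseteq> V \<and> card e = 2}"
| step: "t_tree t V E \<Longrightarrow> Q \<subseteq> V \<Longrightarrow> card Q = t \<Longrightarrow> (\<forall>u\<in>Q. \<forall>u'\<in>Q. u \<noteq> u' \<longrightarrow> {u, u'} \<in> E) \<Longrightarrow>
    v \<notin> V \<Longrightarrow> t_tree t (insert v V) (E \<union> {{u, v} | u. u \<in> Q})"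

definition partial_t_tree :: "nat \<Rightarrow> 'v set \<Rightarrow> 'v set set \<Rightarrow> bool" where
  "partial_t_tree t V E \<longleftrightarrow> (\<exists>V' E'. t_tree t V' E' \<and> V \<subseteq> V' \<and> E \<subseteq> E')"

text \<open>
  Every finite graph has a copy on natural numbers, so the class is formed over \<^typ>\<open>nat\<close>;
  an infinite vertex type also leaves room for the extra vertices of the surrounding t-tree.
\<close>

definition SBPT :: "nat \<Rightarrow> nat \<Rightarrow> nat sgraph set" where
  "SBPT t k = {G. signed_graph G \<and> simple_graph G \<and> bipartite G \<and>
     partial_t_tree t (verts G) (edges_of G) \<and> enat (2 * k) \<le> unbalanced_girth G}"


section \<open>Signed edge-weighted graphs\<close>

record 'v wgraph =
  wverts :: "'v set"
  wedges :: "'v set set"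
  wt :: "'v \<Rightarrow> 'v \<Rightarrow> int"

definition weighted_graph :: "'v wgraph \<Rightarrow> bool" where
  "weighted_graph H \<longleftrightarrow> finite (wverts H) \<and>
     (\<forall>e \<in> wedges H. e \<subseteq> wverts H \<and> card e = 2) \<and>
     (\<forall>u v. {u, v} \<in> wedges H \<longrightarrow> wt H u v \<noteq> 0 \<and> wt H u v = wt H v u)"

definition weights_upto :: "nat \<Rightarrow> 'v wgraph \<Rightarrow> bool" where
  "weights_upto k H \<longleftrightarrow>
     (\<forall>u v. {u, v} \<in> wedges H \<longrightarrow> 1 \<le> \<bar>wt H u v\<bar> \<and> \<bar>wt H u v\<bar> \<le> int k)"

definition wcomplete :: "'v wgraph \<Rightarrow> bool" where
  "wcomplete H \<longleftrightarrow> wedges H = {e. e \<subseteq> wverts H \<and> card e = 2}"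

definition wbipartite :: "'v wgraph \<Rightarrow> bool" where
  "wbipartite H \<longleftrightarrow> (\<exists>X Y. X \<union> Y = wverts H \<and> X \<inter> Y = {} \<and>
     (\<forall>u v. {u, v} \<in> wedges H \<longrightarrow> (odd (wt H u v) \<longleftrightarrow> (u \<in> X \<longleftrightarrow> v \<in> Y))))"

definition winduced :: "'v wgraph \<Rightarrow> 'v set \<Rightarrow> 'v wgraph" where
  "winduced H S = \<lparr>wverts = S, wedges = {e \<in> wedges H. e \<subseteq> S}, wt = wt H\<rparr>"

definition wcliques :: "nat \<Rightarrow> 'v wgraph \<Rightarrow> 'v set set" where
  "wcliques n H = {K. K \<subseteq> wverts H \<and> card K = n \<and> wcomplete (winduced H K)}"

text \<open>Switching at a vertex set, given by its \<open>\<plusminus>1\<close>-valued indicator \<open>c\<close>.\<close>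

definition wswitch :: "('v \<Rightarrow> int) \<Rightarrow> 'v wgraph \<Rightarrow> 'v wgraph" where
  "wswitch c H = H\<lparr>wt := \<lambda>u v. c u * c v * wt H u v\<rparr>"

text \<open>
  Weights \<open>k\<close> and \<open>-k\<close> are identified: both are replaced, in the graph \<open>path_replacement\<close> below,
  by one positive and one negative path of length \<open>k\<close>.  The identification is needed because the
  algebraic distance of two vertices at distance \<open>k\<close> joined by shortest paths of both signs
  is \<open>k\<close> by convention, and remains \<open>k\<close> when the signed graph is switched.
\<close>

definition weight_eq :: "nat \<Rightarrow> int \<Rightarrow> int \<Rightarrow> bool" where
  "weight_eq k a b \<longleftrightarrow> a = b \<or> (\<bar>a\<bar> = int k \<and> \<bar>b\<bar> = int k)"

text \<open>
  An isomorphism is the pair of a switching \<open>c\<close> and a bijection \<open>\<phi>\<close>; because of the identification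
  above, \<open>\<phi>\<close> alone need not determine \<open>c\<close> up to a global sign.
\<close>

definition wiso ::
    "nat \<Rightarrow> 'a wgraph \<Rightarrow> 'b wgraph \<Rightarrow> ('a \<Rightarrow> int) \<Rightarrow> ('a \<Rightarrow> 'b) \<Rightarrow> bool" where
  "wiso k H H' c \<phi> \<longleftrightarrow>
     (\<forall>u \<in> wverts H. c u \<in> {-1, 1}) \<and>
     bij_betw \<phi> (wverts H) (wverts H') \<and>
     (\<lambda>e. \<phi> ` e) ` wedges H = wedges H' \<and>
     (\<forall>u v. {u, v} \<in> wedges H \<longrightarrow>
        weight_eq k (wt (wswitch c H) u v) (wt H' (\<phi> u) (\<phi> v)))"


subsection \<open>Distance graphs\<close>

definition joined :: "'v sgraph \<Rightarrow> 'v \<Rightarrow> 'v \<Rightarrow> bool" where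
  "joined G x y \<longleftrightarrow> (\<exists>vs es. path_between G x y vs es)"

definition gdist :: "'v sgraph \<Rightarrow> 'v \<Rightarrow> 'v \<Rightarrow> nat" where
  "gdist G x y = (LEAST n. \<exists>vs es. path_between G x y vs es \<and> length es = n)"

definition alg_dist :: "'v sgraph \<Rightarrow> 'v \<Rightarrow> 'v \<Rightarrow> int" where
  "alg_dist G x y =
     (if \<exists>vs es. path_between G x y vs es \<and> length es = gdist G x y \<and> sign_of es = 1
      then int (gdist G x y) else - int (gdist G x y))"

text \<open>
  For a connected graph this is a complete graph; vertices in different components have no
  algebraic distance and stay non-adjacent.
\<close>

definition distance_graph :: "'v sgraph \<Rightarrow> 'v wgraph" where
  "distance_graph G =
     \<lparr>wverts = verts G,
      wedges = {{x, y} | x y. x \<in> verts G \<and> y \<in> verts G \<and> x \<noteq> y \<and> joined G x y},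
      wt = alg_dist G\<rparr>"

definition partial_distance_graph :: "'v sgraph \<Rightarrow> 'v wgraph \<Rightarrow> bool" where
  "partial_distance_graph G D \<longleftrightarrow>
     wverts D = wverts (distance_graph G) \<and>
     wedges D \<subseteq> wedges (distance_graph G) \<and>
     (\<forall>x y. {x, y} \<in> wedges D \<longrightarrow> wt D x y = wt (distance_graph G) x y)"


subsection \<open>Wide graphs\<close>

text \<open>
  \<open>Sub e b i\<close> is the \<open>i\<close>-th inner vertex, counted from \<open>Min e\<close>, of the path with index \<open>b\<close>
  that replaces the edge \<open>e\<close>.  The sign of a path is put on its first edge.
\<close>

datatype 'v subdiv = Orig 'v | Sub "'v set" bool nat

definition path_vertex :: "'v::linorder set \<Rightarrow> bool \<Rightarrow> nat \<Rightarrow> nat \<Rightarrow> 'v subdiv" where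
  "path_vertex e b n i =
     (if i = 0 then Orig (Min e) else if i = n then Orig (Max e) else Sub e b i)"

definition path_edges ::
    "'v::linorder set \<Rightarrow> bool \<Rightarrow> nat \<Rightarrow> int \<Rightarrow> ('v subdiv set \<times> int) set" where
  "path_edges e b n s =
     {({path_vertex e b n i, path_vertex e b n (Suc i)}, if i = 0 then s else 1) | i. i < n}"

definition path_replacement :: "nat \<Rightarrow> 'v::linorder wgraph \<Rightarrow> 'v subdiv sgraph" where
  "path_replacement k H = (let
       E = (\<Union>e \<in> wedges H. let a = wt H (Min e) (Max e) in
              path_edges e True (nat \<bar>a\<bar>) (sgn a) \<union>
              path_edges e False (2 * k - nat \<bar>a\<bar>) (- sgn a))
     in \<lparr>verts = Orig ` wverts H \<union> (\<Union>(e, s) \<in> E. e), sedges = E\<rparr>)"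

definition wide :: "nat \<Rightarrow> 'v::linorder wgraph \<Rightarrow> bool" where
  "wide k H \<longleftrightarrow>
     weights_upto k H \<and> unbalanced_girth (path_replacement k H) = enat (2 * k)"

text \<open>
  The set of unlabeled graphs is represented by all its labelled members on \<open>n\<close> natural numbers.
\<close>

definition wide_complete_graphs :: "nat \<Rightarrow> nat \<Rightarrow> nat wgraph set" where
  "wide_complete_graphs n k =
     {X. weighted_graph X \<and> card (wverts X) = n \<and> wcomplete X \<and> wbipartite X \<and> wide k X}"

text \<open>A clique is given by its vertex set.\<close>

definition closed_cliques :: "nat \<Rightarrow> nat \<Rightarrow> 'v wgraph \<Rightarrow> 'v set set \<Rightarrow> bool" where
  "closed_cliques t k D W \<longleftrightarrow>
     (\<forall>K\<in>W. \<forall>v\<in>K. \<forall>X \<in> wide_complete_graphs (Suc t) k. \<forall>x \<in> wverts X. \<forall>c \<phi>.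
        wiso k (winduced D (K - {v})) (winduced X (wverts X - {x})) c \<phi> \<longrightarrow>
        (\<exists>K'\<in>W. K - {v} \<subseteq> K' \<and>
           (\<exists>c' \<phi>'. (\<forall>u \<in> K - {v}. c' u = c u \<and> \<phi>' u = \<phi> u) \<and>
              wiso k (winduced D K') X c' \<phi>')))"

end

theory Submission
  imports Defs "HOL-Library.FuncSet"
begin

text \<open>
  In a signed bipartite graph of unbalanced girth at least \<open>2k\<close>, lengths of walks define a metric on
  the signed double cover in which the two lifts of a vertex are at distance at least \<open>2k\<close>. It
  dominates an integral metric which is antipodal: the lengths of the shortest positive
  and the shortest negative connection between any two vertices add up to exactly \<open>2k\<close>. On finitely
  many vertices such metrics are, up to the identification of \<open>k\<close> with \<open>-k\<close>, the bipartite \<open>2k\<close>-wide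
  complete graphs.

  If \<open>W\<close> is closed, a graph in the class is extended to a t-tree carrying an antipodal metric, which is
  mapped to \<open>B\<close> along the construction of the t-tree so that every clique goes to a member of \<open>W\<close>: closedness
  provides the image of a new vertex. The starting clique is reached from an arbitrary member of \<open>W\<close> by exchanging
  vertices one at a time inside an antipodal metric on the disjoint union.

  Conversely, take a long chain of metric t-trees, each containing all possible one-vertex extensions of the
  cliques of its predecessor, and realize all distances in the last one by paths inside a larger t-tree
  (this needs \<open>t \<ge> 2\<close>; for \<open>t = 1\<close> everything is mapped directly to a negative cycle of length \<open>2k\<close>). A homomorphism
  to \<open>B\<close> has to preserve the distances in cliques. The sets of images of the cliques form an increasing
  sequence of subsets of the power set of \<open>verts B\<close>, so two consecutive ones agree, and such a set is closed.
\<close>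

text \<open>Antipodality makes distances rigid under homomorphisms. If walks of lengths
  \<open>p\<close> and \<open>2k - p\<close> and opposite signs join \<open>u\<close> to
  \<open>v\<close>, their images do the same in \<open>B\<close>; since \<open>B\<close> has no
  negative closed walk shorter than \<open>2k\<close>, no walk between the images is shorter than
  the realized one of its sign. Hence homomorphisms, which in general only shrink distances, keep
  these up to switching. The metrics are flexible because they amalgamate. A vertex attached along a
  clique first gets its signed detour distances through the clique; the two signs add up to at least
  \<open>2k\<close>, and rounding them to exactly \<open>2k\<close> keeps all triangle inequalities.
  This fills in missing distances, joins the starting clique to the given t-tree and attaches
  vertices at prescribed distances. The rounding aims at \<open>k\<close>, or at
  \<open>k + 1\<close> when parity demands it, which needs \<open>k \<ge> 2\<close>; simplicity of
  \<open>B\<close> provides that. In the converse one map is fixed for the last t-tree of the chain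
  and then restricted: clique images under unrelated homomorphisms would not be nested.\<close>

section \<open>Walks and unbalanced girth\<close>

text \<open>\<open>wk \<tau> G x y n s\<close>: there is a walk of length \<open>n\<close> from \<open>x\<close> to \<open>y\<close> on which the product of \<open>\<tau>\<close> is \<open>s\<close>. For
  \<open>\<tau> = snd\<close> this is the sign of the walk; other \<open>\<tau>\<close> serve to compare the signs of a graph and its image.\<close>

inductive wk :: "('v set \<times> int \<Rightarrow> int) \<Rightarrow> 'v sgraph \<Rightarrow> 'v \<Rightarrow> 'v \<Rightarrow> nat \<Rightarrow> int \<Rightarrow> bool"
  for \<tau> G where
  refl: "x \<in> verts G \<Longrightarrow> wk \<tau> G x x 0 1"
| step: "wk \<tau> G x y n s \<Longrightarrow> e \<in> sedges G \<Longrightarrow> fst e = {y, z} \<Longrightarrow> z \<in> verts G \<Longrightarrow>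
    wk \<tau> G x z (Suc n) (s * \<tau> e)"

lemma wk_verts: "wk \<tau> G x y n s \<Longrightarrow> x \<in> verts G \<and> y \<in> verts G"
  by (induction rule: wk.induct) auto

lemma wk_edge:
  assumes "e \<in> sedges G" "fst e = {x, y}" "x \<in> verts G" "y \<in> verts G"
  shows "wk \<tau> G x y 1 (\<tau> e)"
  using wk.step[OF wk.refl[OF assms(3)] assms(1,2,4)] by simp

lemma wk_1E:
  assumes "wk \<tau> G x y 1 s"
  obtains e where "e \<in> sedges G" "fst e = {x, y}" "s = \<tau> e"
  using assms by (cases rule: wk.cases) (auto elim: wk.cases)

lemma wk_trans: "wk \<tau> G y z m s' \<Longrightarrow> wk \<tau> G x y n s \<Longrightarrow> wk \<tau> G x z (n + m) (s * s')"
proof (induction rule: wk.induct)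
  case (step y z m s' e w)
  from wk.step[OF step.IH[OF step.prems] step.hyps(2-4)] show ?case by (simp add: mult.assoc)
qed auto

lemma wk_sym: "wk \<tau> G x y n s \<Longrightarrow> wk \<tau> G y x n s"
proof (induction rule: wk.induct)
  case (step x y n s e z)
  have "wk \<tau> G z y 1 (\<tau> e)"
    using step.hyps wk_verts[OF step.hyps(1)] by (intro wk_edge) (auto simp: insert_commute)
  from wk_trans[OF step.IH this] show ?case by (simp add: mult.commute)
qed (auto intro: wk.refl)

lemma wk_sign:
  "wk \<tau> G x y n s \<Longrightarrow> (\<And>e. e \<in> sedges G \<Longrightarrow> \<tau> e \<in> {-1, 1}) \<Longrightarrow> s = 1 \<or> s = -1"
  by (induction rule: wk.induct) force+

lemma wk_subgraph:
  assumes "wk \<tau> G x y n s" "verts G \<subseteq> verts H" "sedges G \<subseteq> sedges H"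
  shows "wk \<tau> H x y n s"
  using assms by (induction rule: wk.induct) (auto intro: wk.intros)

lemma wk_imp_walk:
  "wk \<tau> G x y n s \<Longrightarrow> \<exists>vs es. walk G vs es \<and> hd vs = x \<and> last vs = y \<and> length es = n \<and>
     prod_list (map \<tau> es) = s"
proof (induction rule: wk.induct)
  case (refl x)
  then show ?case by (intro exI[of _ "[x]"] exI[of _ "[]"]) (auto simp: walk_def)
next
  case (step x y n s e z)
  then obtain vs es where w: "walk G vs es" "hd vs = x" "last vs = y" "length es = n"
    "prod_list (map \<tau> es) = s" by blast
  have l: "length vs = Suc n" using w by (auto simp: walk_def)
  hence ne: "vs \<noteq> []" by auto
  have y: "vs ! n = y" using w(3) l ne by (simp add: last_conv_nth)
  have "walk G (vs @ [z]) (es @ [e])"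
    unfolding walk_def
  proof (intro conjI allI impI)
    show "set (vs @ [z]) \<subseteq> verts G" using w(1) step by (auto simp: walk_def)
    show "length (vs @ [z]) = Suc (length (es @ [e]))" using l w by simp
    fix i assume i: "i < length (es @ [e])"
    show "(es @ [e]) ! i \<in> sedges G"
      using i w(1) step by (cases "i < length es") (auto simp: nth_append walk_def not_less less_Suc_eq)
    show "fst ((es @ [e]) ! i) = {(vs @ [z]) ! i, (vs @ [z]) ! Suc i}"
    proof (cases "i < n")
      case True
      then show ?thesis using w(1,4) l by (auto simp: nth_append walk_def)
    next
      case False
      then have "i = n" using i w(4) by simp
      then show ?thesis using w(4) l y step by (simp add: nth_append)
    qed
  qed
  then show ?case
    using w ne by (intro exI[of _ "vs @ [z]"] exI[of _ "es @ [e]"]) auto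
qed

lemma walk_imp_wk_prefix:
  assumes "walk G vs es" "j \<le> length es"
  shows "wk \<tau> G (hd vs) (vs ! j) j (prod_list (map \<tau> (take j es)))"
  using assms(2)
proof (induction j)
  case 0
  have "vs \<noteq> []" using assms(1) by (auto simp: walk_def)
  then show ?case using assms(1) by (auto intro!: wk.refl simp: hd_conv_nth walk_def)
next
  case (Suc j)
  have j: "j < length es" using Suc by simp
  have "wk \<tau> G (hd vs) (vs ! Suc j) (Suc j) (prod_list (map \<tau> (take j es)) * \<tau> (es ! j))"
    using assms(1) j Suc by (intro wk.step[of _ _ _ "vs ! j"]) (auto simp: walk_def)
  then show ?case using j by (simp add: take_Suc_conv_app_nth)
qed

lemma walk_imp_wk:
  assumes "walk G vs es"
  shows "wk \<tau> G (hd vs) (last vs) (length es) (prod_list (map \<tau> es))"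
proof -
  have "last vs = vs ! length es"
    using assms by (cases vs rule: rev_cases) (auto simp: walk_def nth_append)
  then show ?thesis using walk_imp_wk_prefix[OF assms, of "length es" \<tau>] by simp
qed

text \<open>The common initial piece of the two prefixes contributes the square of a sign, so the
  product of the prefix signs is the sign of the segment.\<close>

lemma walk_imp_wk_between:
  assumes w: "walk G vs es" and ij: "i \<le> j" "j \<le> length es"
    and \<tau>: "\<And>e. e \<in> sedges G \<Longrightarrow> \<tau> e \<in> {-1, 1}"
  shows "wk \<tau> G (vs ! i) (vs ! j) (j - i)
    (prod_list (map \<tau> (take i es)) * prod_list (map \<tau> (take j es)))"
  using ij
proof (induction j)
  case 0
  have "vs ! 0 \<in> verts G" using w by (cases vs) (auto simp: walk_def)
  then show ?case using 0 wk.refl[of "vs ! 0"] by simp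
next
  case (Suc j)
  show ?case
  proof (cases "i = Suc j")
    case True
    have "vs ! Suc j \<in> verts G" using w Suc.prems by (auto simp: walk_def)
    moreover have "prod_list (map \<tau> (take i es)) * prod_list (map \<tau> (take i es)) = 1"
      using wk_sign[OF walk_imp_wk_prefix[OF w, of i \<tau>] \<tau>] Suc.prems True by auto
    ultimately show ?thesis using True wk.refl by fastforce
  next
    case False
    then have IH: "wk \<tau> G (vs ! i) (vs ! j) (j - i)
       (prod_list (map \<tau> (take i es)) * prod_list (map \<tau> (take j es)))"
      using Suc by simp
    have j: "j < length es" using Suc by simp
    have "vs ! Suc j \<in> verts G" using w j by (auto simp: walk_def)
    with wk.step[OF IH, of "es ! j" "vs ! Suc j"] j w
    have "wk \<tau> G (vs ! i) (vs ! Suc j) (Suc (j - i))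
      (prod_list (map \<tau> (take i es)) * prod_list (map \<tau> (take j es)) * \<tau> (es ! j))"
      by (auto simp: walk_def)
    then show ?thesis using j False Suc.prems
      by (simp add: take_Suc_conv_app_nth Suc_diff_le mult.assoc)
  qed
qed

text \<open>Cutting a closed walk at a repeated vertex gives two shorter closed walks whose signs
  multiply to -1, so one of them is negative again. Repetitions are sought from index 1 on, since
  the vertices with indices 0 and \<open>n\<close> always agree.\<close>

lemma negative_closed_walk_imp_negative_cycle:
  assumes \<tau>: "\<And>e. e \<in> sedges G \<Longrightarrow> \<tau> e \<in> {-1, 1}"
    and "wk \<tau> G x x n (-1)"
  shows "\<exists>vs es. cycle G vs es \<and> length es \<le> n \<and> prod_list (map \<tau> es) = -1"
  using assms(2)
proof (induction n arbitrary: x rule: less_induct)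
  case (less n)
  from wk_imp_walk[OF less.prems] obtain vs es where
    w: "walk G vs es" and hl: "hd vs = x" "last vs = x" and n: "length es = n"
    and neg: "prod_list (map \<tau> es) = -1" by blast
  have lv: "length vs = Suc n" using w n by (auto simp: walk_def)
  have v0: "vs ! 0 = x" using lv hl by (cases vs) auto
  have vn: "vs ! n = x" using lv hl by (cases vs rule: rev_cases) (auto simp: nth_append)
  let ?S = "\<lambda>i. prod_list (map \<tau> (take i es))"
  show ?case
  proof (cases "\<exists>i j. 1 \<le> i \<and> i < j \<and> j \<le> n \<and> vs ! i = vs ! j")
    case True
    then obtain i j where ij: "1 \<le> i" "i < j" "j \<le> n" "vs ! i = vs ! j" by blast
    have a: "wk \<tau> G (vs ! i) (vs ! i) (j - i) (?S i * ?S j)"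
      using walk_imp_wk_between[OF w, of i j \<tau>] \<tau> ij n by simp
    have b: "wk \<tau> G x (vs ! i) i (?S i)"
      using walk_imp_wk_prefix[OF w, of i \<tau>] hl ij n by simp
    have c: "wk \<tau> G (vs ! i) x (n - j) (- ?S j)"
      using walk_imp_wk_between[OF w, of j n \<tau>] \<tau> ij n neg vn by simp
    have "?S i * ?S j = 1 \<or> ?S i * ?S j = -1" using wk_sign[OF a] \<tau> by blast
    then show ?thesis
    proof
      assume "?S i * ?S j = 1"
      then have "wk \<tau> G x x (i + (n - j)) (-1)" using wk_trans[OF _ b, of x "n - j" "- ?S j"] c ij by simp
      moreover have lt: "i + (n - j) < n" using ij by simp
      ultimately obtain vs' es' where
        "cycle G vs' es'" "length es' \<le> i + (n - j)" "prod_list (map \<tau> es') = -1"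
        using less.IH[OF lt, of x] by blast
      then show ?thesis using lt by (intro exI[of _ vs'] exI[of _ es']) simp
    next
      assume "?S i * ?S j = -1"
      then have "wk \<tau> G (vs ! i) (vs ! i) (j - i) (-1)" using a by simp
      moreover have lt: "j - i < n" using ij by simp
      ultimately obtain vs' es' where
        "cycle G vs' es'" "length es' \<le> j - i" "prod_list (map \<tau> es') = -1"
        using less.IH[OF lt, of "vs ! i"] by blast
      then show ?thesis using lt by (intro exI[of _ vs'] exI[of _ es']) simp
    qed
  next
    case False
    have dt: "distinct (tl vs)"
      unfolding distinct_conv_nth
    proof (intro allI impI)
      fix i j assume "i < length (tl vs)" "j < length (tl vs)" "i \<noteq> j"
      then show "tl vs ! i \<noteq> tl vs ! j"
        using False[simplified, rule_format, of "Suc i" "Suc j"]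
          False[simplified, rule_format, of "Suc j" "Suc i"] lv
        by (cases "i < j") (auto simp: nth_tl)
    qed
    have ne: "es \<noteq> []" using neg by auto
    \<comment> \<open>When the vertices after the first are distinct, a repeated edge can only be
      traversed once in each direction, which forces \<open>n = 2\<close>; the product is then a
      square and cannot be -1.\<close>
    have "distinct es"
    proof (rule ccontr)
      assume "\<not> distinct es"
      then obtain i j where ij: "i < j" "j < n" "es ! i = es ! j"
        unfolding distinct_conv_nth n by (metis nat_neq_iff)
      have "{vs ! i, vs ! Suc i} = {vs ! j, vs ! Suc j}"
      proof -
        have "\<forall>i < n. fst (es ! i) = {vs ! i, vs ! Suc i}" using w n by (simp add: walk_def)
        then have "fst (es ! i) = {vs ! i, vs ! Suc i}" "fst (es ! j) = {vs ! j, vs ! Suc j}"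
          using ij(1,2) by (meson less_trans)+
        then show ?thesis using ij by simp
      qed
      moreover have "vs ! Suc i \<noteq> vs ! Suc j" using False ij by auto
      ultimately have eq: "vs ! Suc i = vs ! j" "vs ! i = vs ! Suc j"
        by (auto simp: doubleton_eq_iff)
      have j: "j = Suc i"
      proof (rule ccontr)
        assume "j \<noteq> Suc i"
        then have "1 \<le> Suc i \<and> Suc i < j \<and> j \<le> n \<and> vs ! Suc i = vs ! j" using eq ij by simp
        then show False using False by blast
      qed
      have i0: "i = 0"
      proof (rule ccontr)
        assume "i \<noteq> 0"
        then have "1 \<le> i \<and> i < Suc j \<and> Suc j \<le> n \<and> vs ! i = vs ! Suc j" using eq ij by simp
        then show False using False by blast
      qed
      moreover have "Suc j = n"
      proof (rule ccontr)
        assume "Suc j \<noteq> n"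
        then have "1 \<le> Suc j \<and> Suc j < n \<and> n \<le> n \<and> vs ! Suc j = vs ! n"
          using eq ij i0 v0 vn by simp
        then show False using False by blast
      qed
      ultimately have "length es = 2" "es ! 0 = es ! 1" using ij j n by auto
      then obtain e where "es = [e, e]"
        by (auto simp: numeral_2_eq_2 length_Suc_conv)
      moreover have "e \<in> sedges G" using w calculation by (auto simp: walk_def)
      ultimately show False using neg \<tau>[of e] by auto
    qed
    then have "cycle G vs es" using w ne hl dt by (auto simp: cycle_def)
    then show ?thesis using n neg by blast
  qed
qed

lemma sedge_sign: "signed_graph G \<Longrightarrow> e \<in> sedges G \<Longrightarrow> snd e \<in> {-1, 1}"
  by (cases e) (auto simp: signed_graph_def)

lemma sedge_verts: "signed_graph G \<Longrightarrow> e \<in> sedges G \<Longrightarrow> fst e \<subseteq> verts G"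
  by (cases e) (auto simp: signed_graph_def)

lemma wk_snd_sign: "signed_graph G \<Longrightarrow> wk snd G x y n s \<Longrightarrow> s \<in> {-1, 1}"
  using wk_sign[of snd G x y n s] sedge_sign by blast

lemma girth_le_closed_walk:
  assumes "signed_graph G" "enat m \<le> unbalanced_girth G" "wk snd G x x n (-1)"
  shows "m \<le> n"
proof -
  obtain vs es where "cycle G vs es" "length es \<le> n" "sign_of es = -1"
    using negative_closed_walk_imp_negative_cycle[OF sedge_sign[OF assms(1)] assms(3)]
    by (auto simp: sign_of_def)
  then have "unbalanced_girth G \<le> enat (length es)"
    unfolding unbalanced_girth_def by (intro Inf_lower) auto
  with assms(2) \<open>length es \<le> n\<close> show ?thesis
    by (meson enat_ord_simps(1) order_trans)
qed

lemma cycle_imp_wk: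
  "cycle G vs es \<Longrightarrow> wk \<tau> G (hd vs) (hd vs) (length es) (prod_list (map \<tau> es))"
  using walk_imp_wk by (fastforce simp: cycle_def)

lemma girth_geI:
  assumes "\<And>vs es. cycle G vs es \<Longrightarrow> sign_of es = -1 \<Longrightarrow> m \<le> length es"
  shows "enat m \<le> unbalanced_girth G"
  unfolding unbalanced_girth_def using assms by (intro Inf_greatest) auto

lemma girth_attained:
  assumes "unbalanced_girth G = enat m"
  obtains vs es where "cycle G vs es" "length es = m" "sign_of es = -1"
proof -
  let ?A = "{enat (length es) | vs es. cycle G vs es \<and> sign_of es = -1}"
  have "?A \<noteq> {}"
  proof
    assume "?A = {}"
    then have "unbalanced_girth G = \<infinity>" unfolding unbalanced_girth_def
      by (simp add: top_enat_def del: Collect_empty_eq empty_Collect_eq)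
    then show False using assms by simp
  qed
  then have "Inf ?A \<in> ?A" unfolding Inf_enat_def by (metis (no_types, lifting) LeastI equals0I)
  then show thesis using assms that unfolding unbalanced_girth_def by auto
qed

lemma girth_eqI:
  assumes "signed_graph G" "\<And>vs es. cycle G vs es \<Longrightarrow> sign_of es = -1 \<Longrightarrow> m \<le> length es"
    "wk snd G x x m (-1)"
  shows "unbalanced_girth G = enat m"
proof (rule antisym)
  obtain vs es where "cycle G vs es" "length es \<le> m" "sign_of es = -1"
    using negative_closed_walk_imp_negative_cycle[OF sedge_sign[OF assms(1)] assms(3)]
    by (auto simp: sign_of_def)
  then have "unbalanced_girth G \<le> enat (length es)"
    unfolding unbalanced_girth_def by (intro Inf_lower) auto
  then show "unbalanced_girth G \<le> enat m" using \<open>length es \<le> m\<close>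
    by (meson enat_ord_simps(1) order_trans)
qed (use girth_geI assms in blast)

section \<open>Shortest paths and algebraic distances\<close>

lemma path_between_rev:
  assumes "path_between G x y vs es"
  shows "path_between G y x (rev vs) (rev es)"
proof -
  have w: "walk G vs es" and d: "distinct vs" "hd vs = x" "last vs = y"
    using assms by (auto simp: path_between_def)
  have l: "length vs = Suc (length es)" using w by (auto simp: walk_def)
  have "walk G (rev vs) (rev es)"
    unfolding walk_def
  proof (intro conjI allI impI)
    fix i assume i: "i < length (rev es)"
    let ?j = "length es - Suc i"
    have j: "?j < length es" using i by simp
    have *: "rev es ! i = es ! ?j" using i by (simp add: rev_nth)
    show "rev es ! i \<in> sedges G" using w j * by (auto simp: walk_def)
    have "rev vs ! i = vs ! Suc ?j" "rev vs ! Suc i = vs ! ?j"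
      using i l by (simp_all add: rev_nth Suc_diff_Suc)
    then show "fst (rev es ! i) = {rev vs ! i, rev vs ! Suc i}"
      using w j * unfolding walk_def by (metis insert_commute)
  qed (use w in \<open>auto simp: walk_def\<close>)
  moreover have "vs \<noteq> []" using l by auto
  ultimately show ?thesis using d by (auto simp: path_between_def hd_rev last_rev)
qed

text \<open>Removing the segment between two equal vertices may change the sign, so only the length
  is controlled.\<close>

lemma wk_imp_path:
  assumes "wk snd G x y n s"
  shows "\<exists>vs es. path_between G x y vs es \<and> length es \<le> n"
  using assms
proof (induction n arbitrary: s rule: less_induct)
  case (less n)
  from wk_imp_walk[OF less.prems] obtain vs es where
    w: "walk G vs es" "hd vs = x" "last vs = y" "length es = n" by blast
  have lv: "length vs = Suc n" using w by (auto simp: walk_def)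
  have vn: "vs ! n = y" using lv w(3) by (cases vs rule: rev_cases) (auto simp: nth_append)
  show ?case
  proof (cases "distinct vs")
    case True
    then show ?thesis using w by (auto simp: path_between_def)
  next
    case False
    then obtain i j where ij: "i < j" "j \<le> n" "vs ! i = vs ! j"
      unfolding distinct_conv_nth lv by (metis less_Suc_eq_le nat_neq_iff)
    have "\<exists>s. wk snd G x (vs ! i) i s" using walk_imp_wk_prefix[OF w(1), of i snd] w ij by auto
    moreover have "\<exists>s. wk snd G (vs ! j) y (n - j) s"
    proof -
      have "walk G (drop j vs) (drop j es)"
        using w(1) lv ij by (auto simp: walk_def dest: in_set_dropD)
      from walk_imp_wk[OF this, of snd] show ?thesis
        using w lv ij by (auto simp: hd_drop_conv_nth)
    qed
    ultimately obtain s1 s2 where "wk snd G x (vs ! i) i s1" "wk snd G (vs ! j) y (n - j) s2"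
      by blast
    then have "wk snd G x y (i + (n - j)) (s1 * s2)" using ij(3) wk_trans by simp
    moreover have lt: "i + (n - j) < n" using ij by simp
    ultimately obtain vs' es' where "path_between G x y vs' es'" "length es' \<le> i + (n - j)"
      using less.IH[OF lt] by blast
    then show ?thesis using lt by (intro exI[of _ vs'] exI[of _ es']) simp
  qed
qed

lemma joined_iff_wk: "joined G x y \<longleftrightarrow> (\<exists>n s. wk snd G x y n s)"
proof
  assume "joined G x y"
  then obtain vs es where "walk G vs es" "hd vs = x" "last vs = y"
    by (auto simp: joined_def path_between_def)
  then show "\<exists>n s. wk snd G x y n s" using walk_imp_wk[of G vs es snd] by auto
qed (use wk_imp_path in \<open>fastforce simp: joined_def\<close>)

lemma joined_sym: "joined G x y \<longleftrightarrow> joined G y x"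
  unfolding joined_def using path_between_rev[of G x y] path_between_rev[of G y x] by blast

lemma gdist_le_wk: "wk snd G x y n s \<Longrightarrow> gdist G x y \<le> n"
  using wk_imp_path[of G x y n s] unfolding gdist_def
  by (metis (mono_tags, lifting) Least_le le_trans)

lemma path_rev_ex:
  "(\<exists>vs es. path_between G x y vs es \<and> length es = n \<and> R (sign_of es)) \<longleftrightarrow>
   (\<exists>vs es. path_between G y x vs es \<and> length es = n \<and> R (sign_of es))"
proof -
  have *: "\<exists>vs es. path_between G y x vs es \<and> length es = n \<and> R (sign_of es)"
    if "path_between G x y vs es" "length es = n" "R (sign_of es)" for x y vs es
  proof -
    have "sign_of (rev es) = sign_of es"
      unfolding sign_of_def by (simp flip: rev_map add: prod_list.rev)
    then show ?thesis using path_between_rev[OF that(1)] that by (metis length_rev)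
  qed
  show ?thesis using *[of x y] *[of y x] by blast
qed

lemma gdist_commute: "gdist G x y = gdist G y x"
  using path_rev_ex[of G x y _ "\<lambda>_. True"] unfolding gdist_def by simp

lemma alg_dist_commute: "alg_dist G x y = alg_dist G y x"
  using path_rev_ex[of G x y _ "\<lambda>s. s = 1"] 
  
  unfolding alg_dist_def by (simp only: gdist_commute[of G x y])

text \<open>If no shortest path is positive, the one that attains the distance is negative; either
  way the sign selected by the convention belongs to an actual walk.\<close>

lemma alg_dist_wk:
  assumes "signed_graph G" "joined G x y"
  obtains s where "s = 1 \<or> s = -1" "wk snd G x y (gdist G x y) s"
    "alg_dist G x y = s * int (gdist G x y)"
proof -
  have "\<exists>vs es. path_between G x y vs es \<and> length es = gdist G x y"
    unfolding gdist_def by (rule LeastI_ex) (use assms(2) in \<open>auto simp: joined_def\<close>)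
  then obtain vs es where p: "path_between G x y vs es" "length es = gdist G x y" by blast
  have *: "wk snd G x y (length es) (sign_of es)" if "path_between G x y vs es" for vs es
    using walk_imp_wk[of G vs es snd] that by (auto simp: path_between_def sign_of_def)
  show thesis
  proof (cases "\<exists>vs es. path_between G x y vs es \<and> length es = gdist G x y \<and> sign_of es = 1")
    case True
    then show ?thesis using that[of 1] * by (metis (mono_tags, lifting) alg_dist_def mult_1)
  next
    case False
    then have "sign_of es = -1"
      using wk_sign[OF *[OF p(1)] sedge_sign[OF assms(1)]] p by blast
    moreover have "alg_dist G x y = - int (gdist G x y)" using False by (auto simp: alg_dist_def)
    ultimately show ?thesis using that[of "-1"] *[OF p(1)] p by simp
  qed
qed

lemma gdist_pos:
  assumes "joined G x y" "x \<noteq> y" shows "gdist G x y > 0"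
proof (rule ccontr)
  have "\<exists>vs es. path_between G x y vs es \<and> length es = gdist G x y"
    unfolding gdist_def by (rule LeastI_ex) (use assms in \<open>auto simp: joined_def\<close>)
  moreover assume "\<not> gdist G x y > 0"
  ultimately obtain vs where "path_between G x y vs []" by auto
  then show False using assms(2) by (auto simp: path_between_def walk_def length_Suc_conv)
qed

section \<open>Antipodal metrics\<close>

text \<open>An antipodal metric on the signed double cover is given by the distances \<open>p x y\<close> of the lifts of equal
  sign; the lifts of opposite sign are at distance \<open>2k - p x y\<close>. Hence the triangle inequalities of the double cover
  become the triangle inequality of \<open>p\<close> and the bound \<open>4k\<close> on perimeters. Even perimeters express bipartiteness.\<close>

definition signed_val :: "nat \<Rightarrow> int \<Rightarrow> int \<Rightarrow> int" where
  "signed_val k s a = (if s = 1 then a else 2 * int k - a)"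

lemma signed_val_simps [simp]:
  "signed_val k 1 a = a" "signed_val k (-1) a = 2 * int k - a"
  by (auto simp: signed_val_def)

lemma even_signed_val [simp]: "even (signed_val k s a) \<longleftrightarrow> even a"
  by (auto simp: signed_val_def)

text \<open>The upper bound \<open>2 * int k - 1\<close> says that lifts of distinct vertices on
  opposite sheets are at distance at least 1.\<close>

definition antipodal_metric :: "nat \<Rightarrow> 'v set \<Rightarrow> ('v \<Rightarrow> 'v \<Rightarrow> int) \<Rightarrow> bool" where
  "antipodal_metric k S p \<longleftrightarrow>
     (\<forall>x\<in>S. p x x = 0) \<and>
     (\<forall>x\<in>S. \<forall>y\<in>S. p x y = p y x \<and> (x \<noteq> y \<longrightarrow> 1 \<le> p x y \<and> p x y \<le> 2 * int k - 1)) \<and>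
     (\<forall>x\<in>S. \<forall>y\<in>S. \<forall>z\<in>S. p x z \<le> p x y + p y z \<and>
        p x y + p y z + p x z \<le> 4 * int k \<and> even (p x y + p y z + p x z))"

lemma antipodal_metricD:
  assumes "antipodal_metric k S p" "x \<in> S" "y \<in> S"
  shows "p x x = 0" "p x y = p y x" "x \<noteq> y \<Longrightarrow> 1 \<le> p x y" "x \<noteq> y \<Longrightarrow> p x y \<le> 2 * int k - 1"
    "0 \<le> p x y" "p x y \<le> 2 * int k"
  using assms unfolding antipodal_metric_def
  by (blast, blast, blast, blast, (cases "x = y", force, force)+)

lemma antipodal_metric_triangle:
  assumes "antipodal_metric k S p" "x \<in> S" "y \<in> S" "z \<in> S"
  shows "p x z \<le> p x y + p y z" "p x y + p y z + p x z \<le> 4 * int k" "even (p x y + p y z + p x z)"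
  using assms unfolding antipodal_metric_def by blast+

lemma antipodal_metric_subset:
  "antipodal_metric k S p \<Longrightarrow> T \<subseteq> S \<Longrightarrow> antipodal_metric k T p"
  unfolding antipodal_metric_def by blast

lemma antipodal_metric_cong:
  assumes "antipodal_metric k S p" "\<And>x y. x \<in> S \<Longrightarrow> y \<in> S \<Longrightarrow> p x y = q x y"
  shows "antipodal_metric k S q"
  using assms unfolding antipodal_metric_def by simp

text \<open>A triple with a repetition has perimeter zero or twice a distance, hence even and at
  most \<open>4k\<close>, so only proper triangles need to be checked.\<close>

lemma antipodal_metricI:
  assumes k: "k \<ge> 1"
    and "\<And>x. x \<in> S \<Longrightarrow> p x x = 0"
    and "\<And>x y. x \<in> S \<Longrightarrow> y \<in> S \<Longrightarrow> x \<noteq> y \<Longrightarrow> p x y = p y x \<and> 1 \<le> p x y \<and> p x y \<le> 2 * int k - 1"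
    and "\<And>x y z. x \<in> S \<Longrightarrow> y \<in> S \<Longrightarrow> z \<in> S \<Longrightarrow> x \<noteq> y \<Longrightarrow> y \<noteq> z \<Longrightarrow> x \<noteq> z \<Longrightarrow>
      p x z \<le> p x y + p y z \<and> p x y + p y z + p x z \<le> 4 * int k \<and> even (p x y + p y z + p x z)"
  shows "antipodal_metric k S p"
proof -
  have sym: "p x y = p y x" if "x \<in> S" "y \<in> S" for x y
    using assms(3)[OF that] by (cases "x = y") auto
  have bd: "0 \<le> p x y \<and> p x y \<le> 2 * int k" if "x \<in> S" "y \<in> S" for x y
    using assms(2)[OF that(1)] assms(3)[OF that] by (cases "x = y") auto
  have "p x z \<le> p x y + p y z \<and> p x y + p y z + p x z \<le> 4 * int k \<and> even (p x y + p y z + p x z)"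
    if xyz: "x \<in> S" "y \<in> S" "z \<in> S" for x y z
  proof (cases "x \<noteq> y \<and> y \<noteq> z \<and> x \<noteq> z")
    case True
    then show ?thesis using assms(4) xyz by blast
  next
    case False
    then show ?thesis
      using bd[OF xyz(1,2)] bd[OF xyz(2,3)] bd[OF xyz(1,3)] assms(2)[OF xyz(1)] assms(2)[OF xyz(2)]
        assms(2)[OF xyz(3)] sym[OF xyz(1,2)] sym[OF xyz(2,3)] by auto
  qed
  then show ?thesis unfolding antipodal_metric_def using assms(2,3) sym by blast
qed

text \<open>This is the triangle inequality on the double cover. The four choices of signs amount to
  the three triangle inequalities of \<open>x\<close>, \<open>y\<close>, \<open>z\<close> and the
  bound on their perimeter.\<close>

lemma antipodal_metric_signed_triangle:
  assumes "antipodal_metric k S p" "x \<in> S" "y \<in> S" "z \<in> S" "s \<in> {-1, 1}" "t \<in> {-1, 1}"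
  shows "signed_val k (s * t) (p x z) \<le> signed_val k s (p x y) + signed_val k t (p y z)"
  using assms(5,6) antipodal_metric_triangle[OF assms(1-4)]
    antipodal_metric_triangle[OF assms(1,3,2,4)] antipodal_metric_triangle[OF assms(1,2,4,3)]
    antipodal_metricD(2)[OF assms(1,2,3)] antipodal_metricD(2)[OF assms(1,3,4)]
    antipodal_metricD(2)[OF assms(1,2,4)]
  by auto

lemma antipodal_metric_pullback:
  assumes "antipodal_metric k K m" "inj_on \<beta> U" "\<beta> ` U \<subseteq> K"
  shows "antipodal_metric k U (\<lambda>x y. m (\<beta> x) (\<beta> y))"
proof -
  have im: "x \<in> U \<Longrightarrow> \<beta> x \<in> K" for x using assms(3) by blast
  have ne: "x \<in> U \<Longrightarrow> y \<in> U \<Longrightarrow> x \<noteq> y \<Longrightarrow> \<beta> x \<noteq> \<beta> y" for x y using assms(2) by (auto simp: inj_on_def)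
  show ?thesis
    unfolding antipodal_metric_def
  proof (intro conjI ballI impI)
    fix x y assume xy: "x \<in> U" "y \<in> U"
    show "m (\<beta> x) (\<beta> x) = 0" "m (\<beta> x) (\<beta> y) = m (\<beta> y) (\<beta> x)"
      using antipodal_metricD(1,2)[OF assms(1) im im] xy by blast+
    show "1 \<le> m (\<beta> x) (\<beta> y)" "m (\<beta> x) (\<beta> y) \<le> 2 * int k - 1" if "x \<noteq> y"
      using antipodal_metricD(3,4)[OF assms(1) im im ne] xy that by blast+
    fix z assume "z \<in> U"
    then show "m (\<beta> x) (\<beta> z) \<le> m (\<beta> x) (\<beta> y) + m (\<beta> y) (\<beta> z)"
      "m (\<beta> x) (\<beta> y) + m (\<beta> y) (\<beta> z) + m (\<beta> x) (\<beta> z) \<le> 4 * int k"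
      "even (m (\<beta> x) (\<beta> y) + m (\<beta> y) (\<beta> z) + m (\<beta> x) (\<beta> z))"
      using antipodal_metric_triangle[OF assms(1) im im im] xy by blast+
  qed
qed

text \<open>Switching swaps the two lifts of the vertices with \<open>e x = -1\<close>, which only
  permutes the four inequalities of each triangle.\<close>

lemma antipodal_metric_switch:
  assumes k: "k \<ge> 1" and m: "antipodal_metric k S m" and e: "\<And>x. x \<in> S \<Longrightarrow> e x \<in> {-1, 1}"
  shows "antipodal_metric k S (\<lambda>x y. if x = y then 0 else signed_val k (e x * e y) (m x y))"
proof (rule antipodal_metricI[OF k])
  fix x y assume xy: "x \<in> S" "y \<in> S" "x \<noteq> y"
  have "m x y = m y x" "1 \<le> m x y" "m x y \<le> 2 * int k - 1"
    using antipodal_metricD(2-4)[OF m xy(1,2)] xy(3) by auto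
  then show "(if x = y then 0 else signed_val k (e x * e y) (m x y)) = (if y = x then 0 else signed_val k (e y * e x) (m y x)) \<and>
    1 \<le> (if x = y then 0 else signed_val k (e x * e y) (m x y)) \<and>
    (if x = y then 0 else signed_val k (e x * e y) (m x y)) \<le> 2 * int k - 1"
    using xy(3) by (simp add: mult.commute[of "e y"] signed_val_def)
next
  fix x y z assume S: "x \<in> S" "y \<in> S" "z \<in> S" and ne: "x \<noteq> y" "y \<noteq> z" "x \<noteq> z"
  have E: "e x = 1 \<or> e x = -1" "e y = 1 \<or> e y = -1" "e z = 1 \<or> e z = -1" using e S by blast+
  have T: "m x z \<le> m x y + m y z" "m x y + m y z + m x z \<le> 4 * int k" "even (m x y + m y z + m x z)"
    "m x y \<le> m x z + m y z" "m y z \<le> m x y + m x z"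
    using antipodal_metric_triangle[OF m S] antipodal_metric_triangle(1)[OF m S(1,3,2)]
      antipodal_metric_triangle(1)[OF m S(2,1,3)] antipodal_metricD(2)[OF m S(2,3)]
      antipodal_metricD(2)[OF m S(1,2)] by auto
  show "(if x = z then 0 else signed_val k (e x * e z) (m x z)) \<le>
      (if x = y then 0 else signed_val k (e x * e y) (m x y)) + (if y = z then 0 else signed_val k (e y * e z) (m y z)) \<and>
    (if x = y then 0 else signed_val k (e x * e y) (m x y)) + (if y = z then 0 else signed_val k (e y * e z) (m y z)) +
      (if x = z then 0 else signed_val k (e x * e z) (m x z)) \<le> 4 * int k \<and>
    even ((if x = y then 0 else signed_val k (e x * e y) (m x y)) + (if y = z then 0 else signed_val k (e y * e z) (m y z)) +
      (if x = z then 0 else signed_val k (e x * e z) (m x z)))"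
    unfolding if_not_P[OF ne(1)] if_not_P[OF ne(2)] if_not_P[OF ne(3)]
    using E T by (elim disjE) (simp; blast)+
qed simp

section \<open>Rounding signed distances to antipodal ones\<close>

text \<open>For \<open>l \<le> u\<close> this is the median of the three numbers, the point of the
  interval nearest to \<open>m\<close>.\<close>

definition clamp :: "int \<Rightarrow> int \<Rightarrow> int \<Rightarrow> int" where
  "clamp l m u = max l (min m u)"

lemma clamp_cases:
  assumes "l \<le> (u::int)"
  shows "clamp l m u = u \<and> u \<le> m \<or> clamp l m u = m \<and> l \<le> m \<and> m \<le> u \<or> clamp l m u = l \<and> m \<le> l"
  using assms unfolding clamp_def by linarith

lemma clamp_bounds:
  assumes "l \<le> (u::int)"
  shows "l \<le> clamp l m u" "clamp l m u \<le> u" "clamp l m u = u \<or> m \<le> clamp l m u"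
    "clamp l m u = l \<or> clamp l m u \<le> m"
  using assms unfolding clamp_def by linarith+

text \<open>Only upper bounds on \<open>a\<close> and lower bounds on \<open>b\<close> and
  \<open>c\<close> enter. Each value is either at an end of its interval or on the favourable side
  of its target \<open>ha\<close>, \<open>hb\<close>, \<open>hc\<close>, and each of the eight
  combinations comes down to one inequality between ends and targets. Stated this way, the lemma
  also applies to reflected values.\<close>

lemma clamp_triangle_aux:
  fixes K :: int
  assumes "a \<le> ap" "a = 2 * K - am \<or> a \<le> ha"
    and "2 * K - bm \<le> b" "b = bp \<or> hb \<le> b"
    and "2 * K - cm \<le> c" "c = cp \<or> hc \<le> c"
    and "ap \<le> bp + cp" "cm \<le> am + bp" "bm \<le> am + cp"
    and "ha \<le> hb + hc" "ha \<le> hc + bp" "ha \<le> hb + cp" "2 * K \<le> am + hb + hc"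
  shows "a \<le> b + c"
  using assms(2,4,6)
proof (elim disjE)
  assume "a \<le> ha" "hb \<le> b" "hc \<le> c" then show ?thesis using assms(10) by linarith
next
  assume "a \<le> ha" "hb \<le> b" "c = cp" then show ?thesis using assms(12) by linarith
next
  assume "a \<le> ha" "b = bp" "hc \<le> c" then show ?thesis using assms(11) by linarith
next
  assume "a = 2 * K - am" "b = bp" "c = cp" then show ?thesis using assms(1,7) by linarith
next
  assume "a \<le> ha" "b = bp" "c = cp" then show ?thesis using assms(1,7) by linarith
next
  assume "a = 2 * K - am" "hb \<le> b" "hc \<le> c" then show ?thesis using assms(13) by linarith
next
  assume "a = 2 * K - am" "hb \<le> b" "c = cp" then show ?thesis using assms(3,9) by linarith
next
  assume "a = 2 * K - am" "b = bp" "hc \<le> c" then show ?thesis using assms(5,8) by linarith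
qed

lemma clamp_triangle:
  fixes K :: int
  assumes "2 * K \<le> ap + am" "2 * K \<le> bp + bm" "2 * K \<le> cp + cm"
    and "ap \<le> bp + cp" "ap \<le> bm + cm"
    and "bp \<le> am + cm" "bm \<le> am + cp"
    and "cp \<le> am + bm" "cm \<le> am + bp"
    and "\<bar>ha - hb\<bar> \<le> cp" "\<bar>ha + hb - 2 * K\<bar> \<le> cm"
    and "\<bar>ha - hc\<bar> \<le> bp" "\<bar>ha + hc - 2 * K\<bar> \<le> bm" "\<bar>hb + hc - 2 * K\<bar> \<le> am"
    and "ha \<le> hb + hc" "ha + hb + hc \<le> 4 * K"
  defines "a \<equiv> clamp (2 * K - am) ha ap" and "b \<equiv> clamp (2 * K - bm) hb bp"
    and "c \<equiv> clamp (2 * K - cm) hc cp"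
  shows "a \<le> b + c \<and> a + b + c \<le> 4 * K"
proof
  have A: "a \<le> ap" "a = 2 * K - am \<or> a \<le> ha"
    unfolding a_def using clamp_bounds[of "2 * K - am" ap ha] assms(1) by auto
  have B: "2 * K - bm \<le> b" "b \<le> bp" "b = bp \<or> hb \<le> b" "b = 2 * K - bm \<or> b \<le> hb"
    unfolding b_def using clamp_bounds[of "2 * K - bm" bp hb] assms(2) by auto
  have C: "2 * K - cm \<le> c" "c \<le> cp" "c = cp \<or> hc \<le> c" "c = 2 * K - cm \<or> c \<le> hc"
    unfolding c_def using clamp_bounds[of "2 * K - cm" cp hc] assms(3) by auto
  note f = assms(4-16)[unfolded abs_le_iff]
  show "a \<le> b + c"
    by (rule clamp_triangle_aux[where ap = ap and K = K and am = am and ha = ha and bm = bm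
        and bp = bp and hb = hb and cm = cm and cp = cp and hc = hc]) (use A B C f in linarith)+
  \<comment> \<open>The perimeter bound is the same inequality for the other lift of the vertex
    common to \<open>b\<close> and \<open>c\<close>: this swaps \<open>bp\<close> with
    \<open>bm\<close> and \<open>cp\<close> with \<open>cm\<close> and reflects their targets at
    \<open>K\<close>.\<close>
  have "a \<le> (2 * K - b) + (2 * K - c)"
    by (rule clamp_triangle_aux[where ap = ap and K = K and am = am and ha = ha and bm = bp
        and bp = bm and hb = "2 * K - hb" and cm = cp and cp = cm and hc = "2 * K - hc"])
      (use A B C f in linarith)+
  then show "a + b + c \<le> 4 * K" by linarith
qed

text \<open>A pair of distance functions \<open>d 1\<close>, \<open>d (-1)\<close> with \<open>d 1 + d (-1) \<ge> 2k\<close> is made antipodal by moving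
  \<open>d 1\<close> into \<open>[2k - d (-1), d 1]\<close> as close as possible to \<open>half\<close>, which is \<open>k\<close> or \<open>k + 1\<close> according to parity.\<close>

definition half :: "nat \<Rightarrow> bool \<Rightarrow> int" where
  "half k same = (if even k = same then int k else int k + 1)"

text \<open>The targets \<open>half\<close> satisfy the triangle inequality and the perimeter bound
  by themselves and differ by at most 1, so moving towards them does not break the inequalities of
  \<open>d\<close>. Where \<open>d 1 + d (-1) = 2k\<close> the interval is a single point, so values
  that are already antipodal survive.\<close>

lemma antipodal_metric_clamp:
  fixes d :: "int \<Rightarrow> 'v \<Rightarrow> 'v \<Rightarrow> int"
  assumes k: "k \<ge> 2"
    and sym: "\<And>s x y. s \<in> {-1, 1} \<Longrightarrow> x \<in> S \<Longrightarrow> y \<in> S \<Longrightarrow> x \<noteq> y \<Longrightarrow> d s x y = d s y x"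
    and pos: "\<And>s x y. s \<in> {-1, 1} \<Longrightarrow> x \<in> S \<Longrightarrow> y \<in> S \<Longrightarrow> x \<noteq> y \<Longrightarrow> 1 \<le> d s x y"
    and par: "\<And>s x y. s \<in> {-1, 1} \<Longrightarrow> x \<in> S \<Longrightarrow> y \<in> S \<Longrightarrow> x \<noteq> y \<Longrightarrow>
      even (d s x y) \<longleftrightarrow> (col x = (col y :: bool))"
    and neg: "\<And>x y. x \<in> S \<Longrightarrow> y \<in> S \<Longrightarrow> x \<noteq> y \<Longrightarrow> 2 * int k \<le> d 1 x y + d (-1) x y"
    and tri: "\<And>s t x y z. s \<in> {-1, 1} \<Longrightarrow> t \<in> {-1, 1} \<Longrightarrow> x \<in> S \<Longrightarrow> y \<in> S \<Longrightarrow> z \<in> S \<Longrightarrow>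
      x \<noteq> y \<Longrightarrow> y \<noteq> z \<Longrightarrow> x \<noteq> z \<Longrightarrow> d (s * t) x z \<le> d s x y + d t y z"
  shows "antipodal_metric k S (\<lambda>x y. if x = y then 0 else
           clamp (2 * int k - d (-1) x y) (half k (col x = col y)) (d 1 x y))"
    (is "antipodal_metric k S ?p")
proof (rule antipodal_metricI)
  show "k \<ge> 1" using k by simp
  have pm: "(1::int) \<in> {-1, 1}" "(-1::int) \<in> {-1, 1}" by auto
  let ?h = "\<lambda>x y. half k (col x = col y)"
  have evp: "even (?p x y) \<longleftrightarrow> col x = col y" if "x \<in> S" "y \<in> S" "x \<noteq> y" for x y
  proof -
    have ev: "even (?h x y) \<longleftrightarrow> col x = col y" "even (2 * int k - d (-1) x y) \<longleftrightarrow> col x = col y"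
      "even (d 1 x y) \<longleftrightarrow> col x = col y"
      using par[of "-1" x y] par[of 1 x y] that by (auto simp: half_def)
    have "?p x y = ?h x y \<or> ?p x y = 2 * int k - d (-1) x y \<or> ?p x y = d 1 x y"
      using that by (auto simp: clamp_def max_def min_def)
    then show ?thesis by (elim disjE) (simp_all only: ev)
  qed
  show "?p x y = ?p y x \<and> 1 \<le> ?p x y \<and> ?p x y \<le> 2 * int k - 1"
    if "x \<in> S" "y \<in> S" "x \<noteq> y" for x y
  proof -
    have "?h x y \<le> int k + 1" "?h x y \<ge> int k" "?h x y = ?h y x" by (auto simp: half_def)
    moreover have "?p x y = ?p y x"
      using sym[of 1 x y] sym[of "-1" x y] that by (simp add: eq_commute[of "col x"])
    ultimately show ?thesis
      using pos[OF pm(1) that] pos[OF pm(2) that] neg[OF that] that k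
        clamp_cases[of "2 * int k - d (-1) x y" "d 1 x y" "?h x y"] by auto
  qed
  fix x y z assume S: "x \<in> S" "y \<in> S" "z \<in> S" and ne: "x \<noteq> y" "y \<noteq> z" "x \<noteq> z"
  have ne': "y \<noteq> x" "z \<noteq> y" "z \<noteq> x" using ne by auto
  note pos' = pos[OF pm(1) S(1,2) ne(1)] pos[OF pm(1) S(2,3) ne(2)] pos[OF pm(1) S(1,3) ne(3)]
    pos[OF pm(2) S(1,2) ne(1)] pos[OF pm(2) S(2,3) ne(2)] pos[OF pm(2) S(1,3) ne(3)]
  note par' = par[OF pm(2) S(1,2) ne(1)] par[OF pm(2) S(2,3) ne(2)] par[OF pm(2) S(1,3) ne(3)]
  \<comment> \<open>If the two targets at the third vertex both equal \<open>k + 1\<close>, their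
    sum exceeds \<open>2k\<close> by 2; but then \<open>x\<close> and \<open>y\<close> have the same
    colour, and an even positive distance is at least 2.\<close>
  have two: "2 \<le> d (-1) x y" if "col x = col y" using pos'(4) par'(1) that by (cases "d (-1) x y = 1") auto
  have two': "2 \<le> d (-1) y z" if "col y = col z" using pos'(5) par'(2) that by (cases "d (-1) y z = 1") auto
  have two'': "2 \<le> d (-1) x z" if "col x = col z" using pos'(6) par'(3) that by (cases "d (-1) x z = 1") auto
  have s: "d s y x = d s x y" "d s z y = d s y z" "d s z x = d s x z" if "s \<in> {-1,1}" for s
    using sym[OF that] S ne by auto
  \<comment> \<open>For \<open>k \<ge> 3\<close> three targets add up to at most
    \<open>3k + 3 \<le> 4k\<close>. For \<open>k = 2\<close> the target 3 belongs to differently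
    coloured pairs, of which a triangle has at most two.\<close>
  have k3: "k = 2 \<or> k \<ge> 3" using k by linarith
  have "?p x z \<le> ?p x y + ?p y z \<and> ?p x z + ?p x y + ?p y z \<le> 4 * int k"
    unfolding if_not_P[OF ne(1)] if_not_P[OF ne(2)] if_not_P[OF ne(3)]
  proof (rule clamp_triangle)
    show "2 * int k \<le> d 1 x z + d (- 1) x z" "2 * int k \<le> d 1 x y + d (- 1) x y"
      "2 * int k \<le> d 1 y z + d (- 1) y z" using neg S ne by blast+
    show "d 1 x z \<le> d 1 x y + d 1 y z" "d 1 x z \<le> d (-1) x y + d (-1) y z"
      using tri[OF pm(1) pm(1) S ne] tri[OF pm(2) pm(2) S ne] by simp_all
    show "d 1 x y \<le> d (-1) x z + d (-1) y z" "d (-1) x y \<le> d (-1) x z + d 1 y z"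
      using tri[OF pm(2) pm(2) S(1,3,2) ne(3) ne'(2) ne(1)] tri[OF pm(2) pm(1) S(1,3,2) ne(3) ne'(2) ne(1)]
        s[OF pm(1)] s[OF pm(2)] by simp_all
    show "d 1 y z \<le> d (-1) x z + d (-1) x y" "d (-1) y z \<le> d (-1) x z + d 1 x y"
      using tri[OF pm(2) pm(2) S(2,1,3) ne'(1) ne(3) ne(2)] tri[OF pm(1) pm(2) S(2,1,3) ne'(1) ne(3) ne(2)]
        s[OF pm(1)] s[OF pm(2)] by simp_all
    show "\<bar>?h x z - ?h x y\<bar> \<le> d 1 y z" "\<bar>?h x z - ?h y z\<bar> \<le> d 1 x y"
      using pos' by (auto simp: half_def)
    show "\<bar>?h x z + ?h x y - 2 * int k\<bar> \<le> d (-1) y z" "\<bar>?h x z + ?h y z - 2 * int k\<bar> \<le> d (-1) x y"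
      "\<bar>?h x y + ?h y z - 2 * int k\<bar> \<le> d (-1) x z"
      using pos' two two' two'' by (auto simp: half_def)
    show "?h x z \<le> ?h x y + ?h y z" using k by (auto simp: half_def)
    show "?h x z + ?h x y + ?h y z \<le> 4 * int k" using k3 by (auto simp: half_def)
  qed
  moreover have "even (?p x y + ?p y z + ?p x z)"
    using evp[OF S(1,2) ne(1)] evp[OF S(2,3) ne(2)] evp[OF S(1,3) ne(3)]
    by (simp only: even_add) blast
  ultimately show "?p x z \<le> ?p x y + ?p y z \<and> ?p x y + ?p y z + ?p x z \<le> 4 * int k
    \<and> even (?p x y + ?p y z + ?p x z)" by linarith
qed simp

section \<open>Amalgamation of antipodal metrics\<close>

text \<open>On the double cover, \<open>z\<close> is glued to \<open>V\<close> along
  \<open>Q\<close>: its distance to a lift of \<open>y\<close> is first the length of a shortest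
  detour through \<open>Q\<close> and is then rounded. Distances inside \<open>V\<close> and between
  \<open>z\<close> and \<open>Q\<close> are already antipodal, so the rounding leaves them
  alone.\<close>

lemma antipodal_metric_extend:
  assumes k: "k \<ge> 2" and p: "antipodal_metric k V p" and z: "z \<notin> V"
    and Q: "Q \<subseteq> V" "finite Q" "Q \<noteq> {}"
    and q: "antipodal_metric k (insert z Q) q"
    and pq: "\<And>x y. x \<in> Q \<Longrightarrow> y \<in> Q \<Longrightarrow> q x y = p x y"
  shows "\<exists>p'. antipodal_metric k (insert z V) p' \<and>
    (\<forall>x\<in>V. \<forall>y\<in>V. p' x y = p x y) \<and> (\<forall>u\<in>Q. p' z u = q z u \<and> p' u z = q z u)"
proof -
  define a where "a = q z"
  \<comment> \<open>\<open>t\<close> is the sign of the leg from \<open>z\<close> to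
    \<open>u\<close>, so the leg from \<open>u\<close> to \<open>y\<close> has to supply the sign
    \<open>s * t\<close>.\<close>
  define T where "T = (\<lambda>s y (u, t). signed_val k t (a u) + signed_val k (s * t) (p u y))"
  define g where "g = (\<lambda>s y. Min (T s y ` (Q \<times> {-1, 1})))"
  have fin: "finite (T s y ` (Q \<times> {-1, 1}))" "T s y ` (Q \<times> {-1, 1}) \<noteq> {}" for s y
    using Q by auto
  have g_le: "g s y \<le> signed_val k t (a u) + signed_val k (s * t) (p u y)"
    if "u \<in> Q" "t \<in> {-1, 1}" for s y u t
  proof -
    have "T s y (u, t) \<in> T s y ` (Q \<times> {-1, 1})" using that by (intro imageI) simp
    from Min_le[OF fin(1) this] show ?thesis by (simp add: g_def T_def)
  qed
  have g_ex: "\<exists>u t. u \<in> Q \<and> t \<in> {-1, 1} \<and> g s y = signed_val k t (a u) + signed_val k (s * t) (p u y)" for s y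
    using Min_in[OF fin[of s y]] unfolding g_def T_def by auto
  obtain u0 where u0: "u0 \<in> Q" using Q by blast
  define col where "col = (\<lambda>y. if y = z then even (a u0) else even (p u0 y))"
  have pm: "s * t \<in> {-1, 1}" if "s \<in> {-1, 1}" "t \<in> {-1, 1}" for s t :: int using that by auto
  have zQ: "u \<in> Q \<Longrightarrow> u \<in> V \<and> u \<noteq> z" for u using Q z by auto
  have a_tri: "signed_val k (s * t) (a v) \<le> signed_val k s (a u) + signed_val k t (p u v)"
    if "u \<in> Q" "v \<in> Q" "s \<in> {-1, 1}" "t \<in> {-1, 1}" for s t u v
    using antipodal_metric_signed_triangle[OF q, of z u v s t] that pq unfolding a_def by simp
  have a_tri2: "signed_val k (s * t) (p u v) \<le> signed_val k s (a u) + signed_val k t (a v)"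
    if "u \<in> Q" "v \<in> Q" "s \<in> {-1, 1}" "t \<in> {-1, 1}" for s t u v
    using antipodal_metric_signed_triangle[OF q, of u z v s t] that pq antipodal_metricD(2)[OF q, of u z]
    unfolding a_def by simp
  have g_even: "even (g s y) \<longleftrightarrow> col y = col z" if "y \<in> V" "s \<in> {-1, 1}" for s y
  proof -
    obtain u t where u: "u \<in> Q" "t \<in> {-1, 1}" "g s y = signed_val k t (a u) + signed_val k (s * t) (p u y)"
      using g_ex by blast
    have "even (p u0 u + p u y + p u0 y)" using antipodal_metric_triangle(3)[OF p] u u0 Q that by blast
    moreover have "even (q z u0 + p u0 u + q z u)"
      using antipodal_metric_triangle(3)[OF q, of z u0 u] u u0 pq by auto
    ultimately show ?thesis using u that z unfolding col_def a_def by auto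
  qed
  have g_tri: "g (s * t) y \<le> g s x + signed_val k t (p x y)"
    if "x \<in> V" "y \<in> V" "s \<in> {-1, 1}" "t \<in> {-1, 1}" for s t x y
  proof -
    obtain u r where u: "u \<in> Q" "r \<in> {-1, 1}" "g s x = signed_val k r (a u) + signed_val k (s * r) (p u x)"
      using g_ex by blast
    have "signed_val k (s * r * t) (p u y) \<le> signed_val k (s * r) (p u x) + signed_val k t (p x y)"
      by (rule antipodal_metric_signed_triangle[OF p]) (use u zQ that in auto)
    moreover have "g (s * t) y \<le> signed_val k r (a u) + signed_val k (s * t * r) (p u y)"
      by (rule g_le) (use u in auto)
    ultimately show ?thesis using u(3) by (simp add: mult_ac)
  qed
  \<comment> \<open>The detours from \<open>x\<close> and \<open>y\<close> meet in \<open>z\<close>;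
    replacing the passage from \<open>u\<close> through \<open>z\<close> to \<open>v\<close> by the
    direct one is the triangle inequality of \<open>q\<close>. With \<open>x = y\<close> and
    opposite signs this gives the lower bound \<open>2k\<close> that the rounding needs.\<close>
  have g_tri2: "signed_val k (s * t) (p x y) \<le> g s x + g t y"
    if xy: "x \<in> V" "y \<in> V" "s \<in> {-1, 1}" "t \<in> {-1, 1}" for s t x y
  proof -
    obtain u r where u: "u \<in> Q" "r \<in> {-1, 1}" "g s x = signed_val k r (a u) + signed_val k (s * r) (p u x)"
      using g_ex by blast
    obtain v r' where v: "v \<in> Q" "r' \<in> {-1, 1}" "g t y = signed_val k r' (a v) + signed_val k (t * r') (p v y)"
      using g_ex by blast
    have 1: "signed_val k (r * r') (p u v) \<le> signed_val k r (a u) + signed_val k r' (a v)"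
      using a_tri2 u v by blast
    have 2: "signed_val k (s * r * (r * r')) (p x v) \<le> signed_val k (s * r) (p x u) + signed_val k (r * r') (p u v)"
      by (rule antipodal_metric_signed_triangle[OF p]) (use u v zQ that in auto)
    have 3: "signed_val k (s * r * (r * r') * (t * r')) (p x y) \<le>
      signed_val k (s * r * (r * r')) (p x v) + signed_val k (t * r') (p v y)"
      by (rule antipodal_metric_signed_triangle[OF p]) (use u v zQ that in auto)
    have 4: "s * r * (r * r') * (t * r') = s * t" using u v by auto
    show ?thesis using 1 2 3 u v antipodal_metricD(2)[OF p, of u x] zQ xy unfolding 4 by simp
  qed
  have g_pos: "1 \<le> g s y" if "y \<in> V" "s \<in> {-1, 1}" for s y
  proof -
    obtain u r where u: "u \<in> Q" "r \<in> {-1, 1}" "g s y = signed_val k r (a u) + signed_val k (s * r) (p u y)"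
      using g_ex by blast
    have "1 \<le> a u \<and> a u \<le> 2 * int k - 1"
      using antipodal_metricD(3,4)[OF q, of z u] u zQ by (auto simp: a_def)
    moreover have "0 \<le> p u y \<and> p u y \<le> 2 * int k"
      using antipodal_metricD(5,6)[OF p, of u y] u zQ that by auto
    ultimately show ?thesis using u by (auto simp: signed_val_def)
  qed
  have g_Q: "g s u = signed_val k s (a u)" if "u \<in> Q" "s \<in> {-1, 1}" for s u
  proof (rule antisym)
    show "g s u \<le> signed_val k s (a u)"
      using g_le[OF that, of s u] that antipodal_metricD(1)[OF p, of u u] zQ by auto
    obtain v r where v: "v \<in> Q" "r \<in> {-1, 1}" "g s u = signed_val k r (a v) + signed_val k (s * r) (p v u)"
      using g_ex by blast
    have "signed_val k (r * (s * r)) (a u) \<le> signed_val k r (a v) + signed_val k (s * r) (p v u)"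
      using a_tri that v pm by blast
    moreover have "r * (s * r) = s" using v by auto
    ultimately show "signed_val k s (a u) \<le> g s u" using v by simp
  qed
  define d where "d = (\<lambda>s x y. if x = z then g s y else if y = z then g s x else signed_val k s (p x y))"
  define p' where "p' = (\<lambda>x y. if x = y then 0 else
           clamp (2 * int k - d (-1) x y) (half k (col x = col y)) (d 1 x y))"
  have "antipodal_metric k (insert z V) p'"
    unfolding p'_def
  proof (rule antipodal_metric_clamp[OF k])
    fix s x y assume *: "s \<in> {-1, 1::int}" "x \<in> insert z V" "y \<in> insert z V" "x \<noteq> y"
    show "d s x y = d s y x"
      using * antipodal_metricD(2)[OF p, of x y] by (auto simp: d_def)
    show "1 \<le> d s x y"
      using * g_pos antipodal_metricD(3,4)[OF p, of x y] by (auto simp: d_def)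
    show "even (d s x y) \<longleftrightarrow> col x = col y"
    proof (cases "x = z \<or> y = z")
      case True
      then show ?thesis using * g_even by (auto simp: d_def)
    next
      case False
      then have "even (p u0 x + p x y + p u0 y)"
        using antipodal_metric_triangle(3)[OF p, of u0 x y] * u0 zQ by auto
      then show ?thesis using False by (auto simp: d_def col_def)
    qed
  next
    fix x y assume *: "x \<in> insert z V" "y \<in> insert z V" "x \<noteq> y"
    have "2 * int k \<le> g 1 y + g (-1) y" if "y \<in> V" for y
      using g_tri2[of y y 1 "-1"] that antipodal_metricD(1)[OF p, of y] by simp
    then show "2 * int k \<le> d 1 x y + d (-1) x y" using * by (auto simp: d_def)
  next
    fix s t x y w assume *: "s \<in> {-1, 1::int}" "t \<in> {-1, 1::int}" "x \<in> insert z V" "y \<in> insert z V"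
      "w \<in> insert z V" "x \<noteq> y" "y \<noteq> w" "x \<noteq> w"
    consider "x = z" | "y = z" | "w = z" | "x \<noteq> z" "y \<noteq> z" "w \<noteq> z" by blast
    then show "d (s * t) x w \<le> d s x y + d t y w"
    proof cases
      case 1
      then show ?thesis using g_tri[of y w s t] * by (auto simp: d_def)
    next
      case 2
      then show ?thesis using g_tri2[of x w s t] * by (auto simp: d_def)
    next
      case 3
      then show ?thesis using g_tri[of y x t s] * antipodal_metricD(2)[OF p, of x y]
        by (auto simp: d_def mult.commute)
    next
      case 4
      then show ?thesis using antipodal_metric_signed_triangle[OF p, of x y w s t] *
        by (auto simp: d_def)
    qed
  qed
  moreover have "p' x y = p x y" if "x \<in> V" "y \<in> V" for x y
    using that z antipodal_metricD(1)[OF p, of x] by (auto simp: p'_def d_def clamp_def)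
  moreover have "p' z u = q z u" if "u \<in> Q" for u
    using that zQ[OF that] g_Q[OF that, of 1] g_Q[OF that, of "-1"] by (auto simp: p'_def d_def clamp_def a_def)
  moreover have "p' u z = q z u" if "u \<in> Q" for u
    using that zQ[OF that] g_Q[OF that, of 1] g_Q[OF that, of "-1"] by (auto simp: p'_def d_def clamp_def a_def)
  ultimately show ?thesis by blast
qed

text \<open>The vertices of \<open>A\<close> are attached one at a time, each along the part of
  \<open>A\<close> that is already present.\<close>

lemma antipodal_metric_union:
  assumes k: "k \<ge> 2" and q: "antipodal_metric k U q" and p: "antipodal_metric k A p"
    and U: "finite U" "U \<noteq> {}" and A: "finite A" "U \<inter> A = {}"
  shows "\<exists>r. antipodal_metric k (U \<union> A) r \<and> (\<forall>x\<in>U. \<forall>y\<in>U. r x y = q x y) \<and>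
    (\<forall>x\<in>A. \<forall>y\<in>A. r x y = p x y)"
  using A(1) p A(2)
proof (induction A rule: finite_induct)
  case empty
  then show ?case using q by auto
next
  case (insert z A)
  have "antipodal_metric k A p" by (rule antipodal_metric_subset[OF insert.prems(1)]) blast
  then obtain r where r: "antipodal_metric k (U \<union> A) r" "\<forall>x\<in>U. \<forall>y\<in>U. r x y = q x y"
    "\<forall>x\<in>A. \<forall>y\<in>A. r x y = p x y" using insert by auto
  have z: "z \<notin> U \<union> A" using insert by auto
  have "\<exists>r'. antipodal_metric k (insert z (U \<union> A)) r' \<and>
    (\<forall>x\<in>U \<union> A. \<forall>y\<in>U \<union> A. r' x y = r x y) \<and> (\<forall>x\<in>A. r' z x = p z x \<and> r' x z = p z x)"
  \<comment> \<open>The first vertex has no prescribed distances yet; it is put at distance 1 from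
    an arbitrary vertex of \<open>U\<close>.\<close>
  proof (cases "A = {}")
    case True
    obtain u where u: "u \<in> U" using U by blast
    have "antipodal_metric k {z, u} (\<lambda>x y. if x = y then 0 else 1)"
      using k by (intro antipodal_metricI) auto
    from antipodal_metric_extend[OF k r(1) z _ _ _ this] u True
    show ?thesis using antipodal_metricD(1)[OF q u] r(2) by auto
  next
    case False
    show ?thesis
      by (rule antipodal_metric_extend[OF k r(1) z _ insert.hyps(1) False insert.prems(1)]) (use r(3) in auto)
  qed
  then obtain r' where r': "antipodal_metric k (insert z (U \<union> A)) r'"
    "\<forall>x\<in>U \<union> A. \<forall>y\<in>U \<union> A. r' x y = r x y" "\<forall>x\<in>A. r' z x = p z x \<and> r' x z = p z x" by blast
  have "r' x y = p x y" if "x \<in> insert z A" "y \<in> insert z A" for x y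
  proof (cases "x = z \<or> y = z")
    case True
    then show ?thesis
      using r'(3) that antipodal_metricD(1)[OF r'(1), of z z] antipodal_metricD(1)[OF insert.prems(1), of z z]
        antipodal_metricD(2)[OF insert.prems(1), of x y] by auto
  next
    case False
    then show ?thesis using that r'(2) r(3) by simp
  qed
  moreover have "r' x y = q x y" if "x \<in> U" "y \<in> U" for x y using that r'(2) r(2) by simp
  moreover have "antipodal_metric k (U \<union> insert z A) r'" using r'(1) by simp
  ultimately show ?case by blast
qed

section \<open>Antipodal metrics of signed bipartite graphs\<close>

lemma bipartite_colouring:
  fixes G :: "'v sgraph"
  assumes "bipartite G"
  shows "\<exists>col :: 'v \<Rightarrow> bool. (\<forall>e y z. e \<in> sedges G \<longrightarrow> fst e = {y, z} \<longrightarrow> col y \<noteq> col z) \<and>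
    (\<forall>x y n s. wk \<tau> G x y n s \<longrightarrow> (even n \<longleftrightarrow> col x = col y))"
proof -
  obtain X Y where XY: "X \<inter> Y = {}" "\<forall>e \<in> edges_of G. \<exists>x\<in>X. \<exists>y\<in>Y. e = {x, y}"
    using assms unfolding bipartite_def by (elim exE conjE)
  have ecol: "(y \<in> X) \<noteq> (z \<in> X)" if "e \<in> sedges G" "fst e = {y, z}" for e y z
  proof -
    have "fst e \<in> edges_of G" using that by (auto simp: edges_of_def)
    then have "\<exists>a\<in>X. \<exists>b\<in>Y. {y, z} = {a, b}" using bspec[OF XY(2)] that(2) by simp
    then obtain a b where "a \<in> X" "b \<in> Y" "{y, z} = {a, b}" by blast
    then show ?thesis using XY(1) unfolding doubleton_eq_iff by blast
  qed
  moreover have "even n \<longleftrightarrow> (x \<in> X) = (y \<in> X)" if "wk \<tau> G x y n s" for x y n s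
    using that by (induction rule: wk.induct) (use ecol in auto)
  ultimately show ?thesis by (intro exI[of _ "\<lambda>v. v \<in> X"]) blast
qed

text \<open>Walk lengths on the double cover are rounded. The metric lives on all of
  \<open>UNIV\<close> so that it also covers the vertices that a surrounding t-tree adds.\<close>

lemma bipartite_antipodal_metric:
  assumes k: "k \<ge> 2" and G: "signed_graph G" "bipartite G" "enat (2 * k) \<le> unbalanced_girth G"
  shows "\<exists>p. antipodal_metric k UNIV p \<and>
    (\<forall>u v s. ({u, v}, s) \<in> sedges G \<longrightarrow> p u v = signed_val k s 1)"
proof -
  obtain col where ecol: "\<And>e y z. e \<in> sedges G \<Longrightarrow> fst e = {y, z} \<Longrightarrow> col y \<noteq> (col z :: bool)"
    and wcol: "\<And>x y n s. wk snd G x y n s \<Longrightarrow> even n \<longleftrightarrow> col x = col y"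
    using bipartite_colouring[OF G(2)] by metis
  define R where "R = (\<lambda>x y n s. wk snd G x y n s \<or>
     s \<in> {-1, 1} \<and> 4 * k \<le> n \<and> (even n \<longleftrightarrow> col x = col y))"
  have R_par: "even n \<longleftrightarrow> col x = col y" if "R x y n s" for x y n s
    using that wcol unfolding R_def by blast
  have R_sym: "R y x n s" if "R x y n s" for x y n s using that wk_sym[of snd G x y n s] unfolding R_def by auto
  have wks: "wk snd G x y n s \<Longrightarrow> s \<in> {-1, 1}" for x y n s
    using wk_snd_sign[OF G(1)] .
  have R_sign: "s \<in> {-1, 1}" if "R x y n s" for x y n s using that wks unfolding R_def by blast
  have R_trans: "R x z (m + n) (s * t)" if "R x y m s" "R y z n t" for x y z m n s t
  proof (cases "wk snd G x y m s \<and> wk snd G y z n t")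
    case True
    then show ?thesis using wk_trans[of snd G y z n t x m s] unfolding R_def by simp
  next
    case False
    then have "4 * k \<le> m + n" using that unfolding R_def by auto
    moreover have "s * t \<in> {-1, 1}" using R_sign[OF that(1)] R_sign[OF that(2)] by auto
    moreover have "even (m + n) \<longleftrightarrow> col x = col z" using R_par[OF that(1)] R_par[OF that(2)] by auto
    ultimately show ?thesis unfolding R_def by blast
  qed
  have R_neg: "2 * k \<le> n" if "R x x n (-1)" for x n
    using that girth_le_closed_walk[OF G(1,3)] unfolding R_def by fastforce
  have R_pos: "1 \<le> n" if "R x y n s" "x \<noteq> y" for x y n s
  proof -
    have "n \<noteq> 0" if "wk snd G x y n s" using that \<open>x \<noteq> y\<close> by (cases rule: wk.cases) auto
    then show ?thesis using that k unfolding R_def by auto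
  qed
  define d where "d = (\<lambda>s x y. LEAST n. R x y n s)"
  have d_R: "R x y (d s x y) s" if "s \<in> {-1, 1}" for s x y
  proof -
    have "R x y (4 * k) s \<or> R x y (4 * k + 1) s" using that unfolding R_def by auto
    then show ?thesis unfolding d_def by (metis (mono_tags) LeastI)
  qed
  have d_le: "d s x y \<le> n" if "R x y n s" for s x y n unfolding d_def using that by (rule Least_le)
  define p where "p = (\<lambda>x y. if x = y then 0 else
           clamp (2 * int k - int (d (-1) x y)) (half k (col x = col y)) (int (d 1 x y)))"
  have neg: "2 * int k \<le> int (d 1 x y) + int (d (-1) x y)" for x y
  proof -
    have "R x x (d 1 x y + d (-1) x y) (1 * -1)" by (rule R_trans[of x y]) (use d_R R_sym in auto)
    then show ?thesis using R_neg by fastforce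
  qed
  have "antipodal_metric k UNIV p"
    unfolding p_def
  proof (rule antipodal_metric_clamp[OF k, where d = "\<lambda>s x y. int (d s x y)"])
    fix s :: int and x y assume s: "s \<in> {-1, 1}"
    have "R x y n s \<longleftrightarrow> R y x n s" for n using R_sym by blast
    then show "int (d s x y) = int (d s y x)" unfolding d_def by simp
    show "1 \<le> int (d s x y)" if "x \<noteq> y" using R_pos[OF d_R[OF s] that] by simp
    show "even (int (d s x y)) \<longleftrightarrow> col x = col y" using R_par[OF d_R[OF s]] by simp
  next
    fix s t :: int and x y z assume "s \<in> {-1, 1}" "t \<in> {-1, 1}"
    then have "R x z (d s x y + d t y z) (s * t)" using R_trans d_R by blast
    then show "int (d (s * t) x z) \<le> int (d s x y) + int (d t y z)" using d_le by fastforce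
  qed (use neg in auto)
  moreover have "p u v = signed_val k s 1" if e: "({u, v}, s) \<in> sedges G" for u v s
  proof -
    have uv: "u \<noteq> v" using ecol[OF e] by auto
    have s: "s \<in> {-1, 1}" using sedge_sign[OF G(1) e] by simp
    have "wk snd G u v 1 s" using wk_edge[OF e, of u v snd] e G(1) by (auto simp: signed_graph_def)
    then have "d s u v \<le> 1" using d_le unfolding R_def by blast
    moreover have "1 \<le> d s u v" using R_pos[OF d_R[OF s] uv] .
    ultimately have d1: "d s u v = 1" by simp
    \<comment> \<open>The rounding interval ends at 1 for a positive edge and begins at
      \<open>2k - 1\<close> for a negative one. The target lies between 1 and \<open>2k - 1\<close>,
      so the rounding stops at that end.\<close>
    have "int k \<le> half k (col u = col v)" "half k (col u = col v) \<le> int k + 1" by (auto simp: half_def)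
    then show ?thesis using d1 s uv neg[of u v] k by (auto simp: p_def clamp_def)
  qed
  ultimately show ?thesis by blast
qed

section \<open>Wide complete graphs\<close>

text \<open>Rotating a cycle keeps its sign, since the sign of the initial piece enters twice. It
  serves to start a cycle at an original vertex of a subdivided graph.\<close>

lemma cycle_imp_wk_at:
  assumes "signed_graph G" "cycle G vs es" "j \<le> length es"
  shows "wk snd G (vs ! j) (vs ! j) (length es) (sign_of es)"
proof -
  have w: "walk G vs es" and hl: "hd vs = last vs" using assms by (auto simp: cycle_def)
  have lv: "length vs = Suc (length es)" using w by (auto simp: walk_def)
  have vn: "vs ! length es = hd vs" using lv hl by (cases vs rule: rev_cases) (auto simp: nth_append)
  have \<tau>: "\<And>e. e \<in> sedges G \<Longrightarrow> snd e \<in> {-1, 1}" using sedge_sign[OF assms(1)] .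
  let ?S = "prod_list (map snd (take j es))"
  have a: "wk snd G (hd vs) (vs ! j) j ?S" using walk_imp_wk_prefix[OF w assms(3)] .
  have b: "wk snd G (vs ! j) (hd vs) (length es - j) (?S * sign_of es)"
    using walk_imp_wk_between[OF w assms(3) order_refl \<tau>] vn by (simp add: sign_of_def)
  have "?S * ?S = 1" using wk_snd_sign[OF assms(1) a] by auto
  then have "?S * sign_of es * ?S = sign_of es" by (simp add: mult.left_commute mult.commute)
  with wk_trans[OF a b] assms(3) show ?thesis by simp
qed

text \<open>The length of the positive one of the two paths that replace an edge of weight
  \<open>a\<close>. The weights \<open>k\<close> and \<open>-k\<close> both give \<open>k\<close>,
  so their identification becomes equality.\<close>

definition pos_val :: "nat \<Rightarrow> int \<Rightarrow> int" where
  "pos_val k a = (if a > 0 then a else 2 * int k + a)"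

definition weight_metric :: "nat \<Rightarrow> ('v \<Rightarrow> 'v \<Rightarrow> int) \<Rightarrow> 'v \<Rightarrow> 'v \<Rightarrow> int" where
  "weight_metric k w x y = (if x = y then 0 else pos_val k (w x y))"

lemma weight_eq_iff:
  assumes "1 \<le> \<bar>a\<bar>" "\<bar>a\<bar> \<le> int k" "1 \<le> \<bar>b\<bar>" "\<bar>b\<bar> \<le> int k" "s \<in> {-1, 1}"
  shows "weight_eq k (s * a) b \<longleftrightarrow> pos_val k b = signed_val k s (pos_val k a)"
  using assms by (auto simp: weight_eq_def pos_val_def)

lemma card_doubleton [simp]: "card {u, v} = 2 \<longleftrightarrow> u \<noteq> v"
  by (cases "u = v") auto

lemma wcomplete_edge: "wcomplete H \<Longrightarrow> {u, v} \<in> wedges H \<longleftrightarrow> u \<in> wverts H \<and> v \<in> wverts H \<and> u \<noteq> v"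
  by (auto simp: wcomplete_def)

lemma image_pairs:
  assumes "bij_betw \<phi> V V'"
  shows "(\<lambda>e. \<phi> ` e) ` {e. e \<subseteq> V \<and> card e = 2} = {e. e \<subseteq> V' \<and> card e = 2}"
proof (intro set_eqI iffI)
  fix e assume "e \<in> (\<lambda>e. \<phi> ` e) ` {e. e \<subseteq> V \<and> card e = 2}"
  then obtain e' where e': "e = \<phi> ` e'" "e' \<subseteq> V" "card e' = 2" by auto
  then have "card e = 2" using assms card_image[of \<phi> e'] inj_on_subset[of \<phi> V e'] by (auto simp: bij_betw_def)
  then show "e \<in> {e. e \<subseteq> V' \<and> card e = 2}" using e' assms by (auto simp: bij_betw_def)
next
  fix e assume e: "e \<in> {e. e \<subseteq> V' \<and> card e = 2}"
  then obtain a where a: "a \<subseteq> V" "e = \<phi> ` a" using assms by (auto simp: bij_betw_def subset_image_iff)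
  then have "card a = 2" using e assms card_image[of \<phi> a] inj_on_subset[of \<phi> V a] by (auto simp: bij_betw_def)
  then show "e \<in> (\<lambda>e. \<phi> ` e) ` {e. e \<subseteq> V \<and> card e = 2}" using a by blast
qed

text \<open>In terms of \<open>pos_val\<close> an isomorphism is an isometry up to swapping lifts,
  and the tolerant comparison \<open>weight_eq\<close> disappears.\<close>

lemma wiso_complete_iff:
  assumes "wcomplete H" "wcomplete H'" "weights_upto k H" "weights_upto k H'"
  shows "wiso k H H' c \<phi> \<longleftrightarrow> (\<forall>u \<in> wverts H. c u \<in> {-1, 1}) \<and> bij_betw \<phi> (wverts H) (wverts H') \<and>
    (\<forall>u\<in>wverts H. \<forall>v\<in>wverts H. u \<noteq> v \<longrightarrow>
      pos_val k (wt H' (\<phi> u) (\<phi> v)) = signed_val k (c u * c v) (pos_val k (wt H u v)))"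
proof -
  have "weight_eq k (wt (wswitch c H) u v) (wt H' (\<phi> u) (\<phi> v)) \<longleftrightarrow>
      pos_val k (wt H' (\<phi> u) (\<phi> v)) = signed_val k (c u * c v) (pos_val k (wt H u v))"
    if b: "bij_betw \<phi> (wverts H) (wverts H')" and uv: "u \<in> wverts H" "v \<in> wverts H" "u \<noteq> v"
      and c: "\<forall>u \<in> wverts H. c u \<in> {-1, 1}" for u v
  proof -
    have "\<phi> u \<in> wverts H'" "\<phi> v \<in> wverts H'" "\<phi> u \<noteq> \<phi> v"
      using b uv by (auto simp: bij_betw_def inj_on_def)
    then have "{\<phi> u, \<phi> v} \<in> wedges H'" using wcomplete_edge[OF assms(2)] by blast
    moreover have "{u, v} \<in> wedges H" using wcomplete_edge[OF assms(1)] uv by blast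
    moreover have "c u * c v \<in> {-1, 1}" using bspec[OF c uv(1)] bspec[OF c uv(2)] by auto
    ultimately show ?thesis
      using assms(3,4) weight_eq_iff[of "wt H u v" k "wt H' (\<phi> u) (\<phi> v)" "c u * c v"]
      by (simp add: wswitch_def weights_upto_def)
  qed
  moreover have "(\<lambda>e. \<phi> ` e) ` wedges H = wedges H'" if "bij_betw \<phi> (wverts H) (wverts H')"
    using image_pairs[OF that] assms(1,2) by (simp add: wcomplete_def)
  ultimately show ?thesis
    unfolding wiso_def using wcomplete_edge[OF assms(1)] by (smt (verit, ccfv_threshold))
qed

lemma winduced_simps [simp]:
  "wverts (winduced H S) = S" "wt (winduced H S) = wt H"
  by (auto simp: winduced_def)

lemma wcomplete_winduced_subset:
  assumes "wcomplete (winduced H K)" "S \<subseteq> K"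
  shows "wcomplete (winduced H S)"
  using assms unfolding wcomplete_def winduced_def by auto

lemma weights_upto_winduced: "weights_upto k H \<Longrightarrow> weights_upto k (winduced H S)"
  by (auto simp: weights_upto_def winduced_def)

lemma wcomplete_imp_winduced: "wcomplete H \<Longrightarrow> S \<subseteq> wverts H \<Longrightarrow> wcomplete (winduced H S)"
  by (auto simp: wcomplete_def winduced_def)

section \<open>Weighted edges replaced by pairs of paths\<close>

definition path_len :: "nat \<Rightarrow> 'v::linorder wgraph \<Rightarrow> 'v set \<Rightarrow> bool \<Rightarrow> nat" where
  "path_len k H e b = (let a = nat \<bar>wt H (Min e) (Max e)\<bar> in if b then a else 2 * k - a)"

definition path_sgn :: "'v::linorder wgraph \<Rightarrow> 'v set \<Rightarrow> bool \<Rightarrow> int" where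
  "path_sgn H e b = (let a = wt H (Min e) (Max e) in if b then sgn a else - sgn a)"

lemma sedges_path_replacement:
  "sedges (path_replacement k H) = (\<Union>e \<in> wedges H. \<Union>b. path_edges e b (path_len k H e b) (path_sgn H e b))"
  by (auto simp: path_replacement_def path_len_def path_sgn_def Let_def UNIV_bool split: if_splits)

lemma verts_path_replacement:
  "verts (path_replacement k H) = Orig ` wverts H \<union> (\<Union>(e, s) \<in> sedges (path_replacement k H). e)"
  by (simp add: path_replacement_def Let_def)

locale weighted_upto =
  fixes k :: nat and H :: "'v::linorder wgraph"
  assumes k: "k \<ge> 1" and weighted: "weighted_graph H" and upto: "weights_upto k H"
begin

abbreviation "R \<equiv> path_replacement k H"
abbreviation "p \<equiv> weight_metric k (wt H)"

lemma edge_Min_Max: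
  assumes "e \<in> wedges H"
  shows "e = {Min e, Max e}" "Min e \<in> wverts H" "Max e \<in> wverts H" "Min e \<noteq> Max e"
proof -
  have "e \<subseteq> wverts H" "card e = 2" using assms weighted by (auto simp: weighted_graph_def)
  then obtain u v where uv: "e = {u, v}" "u \<noteq> v" by (auto simp: card_2_iff)
  then show "e = {Min e, Max e}" by (cases "u < v") (auto simp: insert_commute)
  then show "Min e \<in> wverts H" "Max e \<in> wverts H" using \<open>e \<subseteq> wverts H\<close> by blast+
  show "Min e \<noteq> Max e" using uv by (cases "u < v") auto
qed

lemma wt_sym: "{u, v} \<in> wedges H \<Longrightarrow> wt H u v = wt H v u"
  using weighted unfolding weighted_graph_def by blast

lemma edge_weight:
  assumes "e \<in> wedges H"
  shows "1 \<le> \<bar>wt H (Min e) (Max e)\<bar>" "\<bar>wt H (Min e) (Max e)\<bar> \<le> int k"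
  using edge_Min_Max(1)[OF assms] assms upto unfolding weights_upto_def by metis+

lemma path_sgn: "e \<in> wedges H \<Longrightarrow> path_sgn H e b \<in> {-1, 1}"
  using edge_weight[of e] by (auto simp: path_sgn_def Let_def sgn_if)

lemma path_len:
  assumes "e \<in> wedges H"
  shows "int (path_len k H e b) = signed_val k (path_sgn H e b) (p (Min e) (Max e))" "path_len k H e b \<ge> 1"
  using edge_weight[OF assms] edge_Min_Max(4)[OF assms] k
  by (auto simp: path_len_def path_sgn_def weight_metric_def pos_val_def Let_def sgn_if of_nat_diff nat_le_iff)

lemma signed_graph_R: "signed_graph R"
proof -
  have "finite (wedges H)"
    using weighted finite_subset[of "wedges H" "Pow (wverts H)"] by (auto simp: weighted_graph_def)
  then have "finite (sedges R)"
    unfolding sedges_path_replacement path_edges_def by auto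
  moreover have "finite e" if "(e, s) \<in> sedges R" for e s
    using that unfolding sedges_path_replacement path_edges_def by auto
  ultimately have "finite (verts R)"
    unfolding verts_path_replacement using weighted by (auto simp: weighted_graph_def)
  moreover have "card e = 1 \<or> card e = 2" if "(e, s) \<in> sedges R" for e s
  proof -
    have "\<exists>x y. e = {x, y}"
      using that unfolding sedges_path_replacement path_edges_def by auto
    then obtain x y where "e = {x, y}" by blast
    then show ?thesis by (cases "x = y") auto
  qed
  moreover have "s \<in> {-1, 1}" if "(e, s) \<in> sedges R" for e s
    using that path_sgn unfolding sedges_path_replacement path_edges_def by (fastforce split: if_splits)
  moreover have "e \<subseteq> verts R" if "(e, s) \<in> sedges R" for e s
    using that unfolding verts_path_replacement by auto
  ultimately show ?thesis unfolding signed_graph_def by blast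
qed

lemma path_wk:
  assumes e: "e \<in> wedges H" and "i \<le> path_len k H e b"
  shows "wk snd R (Orig (Min e)) (path_vertex e b (path_len k H e b) i) i (if i = 0 then 1 else path_sgn H e b)"
  using assms(2)
proof (induction i)
  case 0
  then show ?case using edge_Min_Max[OF e]
    by (auto intro!: wk.refl simp: path_vertex_def verts_path_replacement)
next
  case (Suc i)
  let ?n = "path_len k H e b"
  let ?ed = "({path_vertex e b ?n i, path_vertex e b ?n (Suc i)}, if i = 0 then path_sgn H e b else 1)"
  have "?ed \<in> path_edges e b ?n (path_sgn H e b)" unfolding path_edges_def
    using Suc.prems by (intro CollectI exI[of _ i]) simp
  then have ed: "?ed \<in> sedges R" unfolding sedges_path_replacement using e by blast
  then have v: "path_vertex e b ?n (Suc i) \<in> verts R"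
    using sedge_verts[OF signed_graph_R ed] by simp
  have "wk snd R (Orig (Min e)) (path_vertex e b ?n (Suc i)) (Suc i)
    ((if i = 0 then 1 else path_sgn H e b) * snd ?ed)"
    by (rule wk.step[OF Suc.IH ed]) (use Suc.prems v in auto)
  then show ?case by (cases "i = 0") auto
qed

lemma wk_Orig:
  assumes e: "{u, v} \<in> wedges H" and s: "s \<in> {-1, 1}"
  shows "wk snd R (Orig u) (Orig v) (nat (signed_val k s (p u v))) s"
proof -
  \<comment> \<open>\<open>b\<close> selects the replacing path of sign \<open>s\<close>.\<close>
  define b where "b = (s = path_sgn H {u, v} True)"
  have sb: "path_sgn H {u, v} b = s"
    using s path_sgn[OF e, of True] unfolding b_def path_sgn_def Let_def by auto
  let ?n = "path_len k H {u, v} b"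
  have uv: "u \<noteq> v" using e weighted by (auto simp: weighted_graph_def)
  have "wk snd R (Orig (Min {u, v})) (Orig (Max {u, v})) ?n s"
    using path_wk[OF e, of ?n b] path_len(2)[OF e, of b] sb by (simp add: path_vertex_def)
  moreover have "?n = nat (signed_val k s (p (Min {u, v}) (Max {u, v})))"
    using path_len(1)[OF e, of b] sb by simp
  ultimately have w: "wk snd R (Orig (Min {u, v})) (Orig (Max {u, v}))
    (nat (signed_val k s (p (Min {u, v}) (Max {u, v})))) s" by simp
  have sym: "p u v = p v u" using wt_sym[OF e] by (simp add: weight_metric_def)
  show ?thesis
  proof (cases "u < v")
    case True
    then show ?thesis using w by simp
  next
    case False
    then have "Min {u, v} = v" "Max {u, v} = u" using uv by auto
    then show ?thesis using wk_sym[OF w] sym by simp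
  qed
qed

text \<open>The potential \<open>F\<close> extends the distance from \<open>u\<close> on the signed double cover to the inner
  vertices of the replacing paths; it is 1-Lipschitz along signed edges.\<close>

context
  assumes metric: "antipodal_metric k (wverts H) p"
begin

definition F :: "'v \<Rightarrow> 'v subdiv \<Rightarrow> int \<Rightarrow> int" where
  "F u y s = (case y of Orig v \<Rightarrow> signed_val k s (p u v) | Sub e b i \<Rightarrow>
     min (int i + signed_val k (s * path_sgn H e b) (p u (Min e)))
         (int (path_len k H e b) - int i + signed_val k s (p u (Max e))))"

text \<open>At an end of the path one term of the minimum is redundant by the triangle inequality
  over the replaced edge, and the other is the value at the original vertex. At \<open>i = 0\<close>
  the sign is taken before the first edge, which carries the sign of the whole path.\<close>

lemma F_path_vertex:
  assumes u: "u \<in> wverts H" and e: "e \<in> wedges H" and s: "s \<in> {-1, 1}" and i: "i \<le> path_len k H e b"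
  shows "F u (path_vertex e b (path_len k H e b) i) (if i = 0 then s * path_sgn H e b else s) =
    min (int i + signed_val k (s * path_sgn H e b) (p u (Min e)))
         (int (path_len k H e b) - int i + signed_val k s (p u (Max e)))"
proof -
  let ?\<sigma> = "path_sgn H e b"
  have m: "Min e \<in> wverts H" "Max e \<in> wverts H" using edge_Min_Max[OF e] by auto
  have \<sigma>: "?\<sigma> \<in> {-1, 1}" "s * ?\<sigma> \<in> {-1, 1}" "s * ?\<sigma> * ?\<sigma> = s" using path_sgn[OF e, of b] s by auto
  have sym: "p (Max e) (Min e) = p (Min e) (Max e)" using antipodal_metricD(2)[OF metric m] by simp
  have 1: "signed_val k (s * ?\<sigma>) (p u (Min e)) \<le> signed_val k s (p u (Max e)) + signed_val k ?\<sigma> (p (Max e) (Min e))"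
    by (rule antipodal_metric_signed_triangle[OF metric u m(2,1) s \<sigma>(1)])
  have 2: "signed_val k s (p u (Max e)) \<le> signed_val k (s * ?\<sigma>) (p u (Min e)) + signed_val k ?\<sigma> (p (Min e) (Max e))"
    using antipodal_metric_signed_triangle[OF metric u m \<sigma>(2,1)] \<sigma>(3) by simp
  consider "i = 0" | "i \<noteq> 0" "i = path_len k H e b" | "i \<noteq> 0" "i \<noteq> path_len k H e b" by blast
  then show ?thesis
  proof cases
    case 1
    then show ?thesis using \<open>signed_val k (s * ?\<sigma>) (p u (Min e)) \<le> _\<close> path_len(1)[OF e, of b] sym
      by (simp add: F_def path_vertex_def)
  next
    case 2
    then show ?thesis using \<open>signed_val k s (p u (Max e)) \<le> _\<close> path_len(1)[OF e, of b]
      by (simp add: F_def path_vertex_def)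
  next
    case 3
    then show ?thesis by (simp add: F_def path_vertex_def)
  qed
qed

lemma F_step:
  assumes u: "u \<in> wverts H" and ed: "ed \<in> sedges R" "fst ed = {y, z}" and s: "s \<in> {-1, 1}"
  shows "F u z (s * snd ed) \<le> F u y s + 1"
proof -
  obtain e b i where e: "e \<in> wedges H" and i: "i < path_len k H e b"
    and ed': "ed = ({path_vertex e b (path_len k H e b) i, path_vertex e b (path_len k H e b) (Suc i)},
      if i = 0 then path_sgn H e b else 1)"
    using ed(1) unfolding sedges_path_replacement path_edges_def by blast
  let ?n = "path_len k H e b" and ?\<sigma> = "path_sgn H e b"
  have \<sigma>: "?\<sigma> \<in> {-1, 1}" using path_sgn[OF e] .
  have sgn: "s * ?\<sigma> \<in> {-1, 1}" "s * ?\<sigma> * ?\<sigma> = s" using \<sigma> s by auto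
  have "y = path_vertex e b ?n i \<and> z = path_vertex e b ?n (Suc i) \<or>
    z = path_vertex e b ?n i \<and> y = path_vertex e b ?n (Suc i)"
    using ed(2) ed' by (auto simp: doubleton_eq_iff)
  then show ?thesis
  proof (elim disjE conjE)
    assume yz: "y = path_vertex e b ?n i" "z = path_vertex e b ?n (Suc i)"
    show ?thesis
      using F_path_vertex[OF u e sgn(1), of i b] F_path_vertex[OF u e s, of i b] i
        F_path_vertex[OF u e sgn(1), of "Suc i" b] F_path_vertex[OF u e s, of "Suc i" b] sgn yz ed'
      by (cases "i = 0") auto
  next
    assume yz: "z = path_vertex e b ?n i" "y = path_vertex e b ?n (Suc i)"
    show ?thesis
      using F_path_vertex[OF u e sgn(1), of i b] F_path_vertex[OF u e s, of i b] i
        F_path_vertex[OF u e sgn(1), of "Suc i" b] F_path_vertex[OF u e s, of "Suc i" b] sgn yz ed'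
      by (cases "i = 0") auto
  qed
qed

lemma F_le_wk:
  assumes u: "u \<in> wverts H" and w: "wk snd R (Orig u) y n s"
  shows "F u y s \<le> int n"
  using w
proof (induction "Orig u :: 'v subdiv" y n s rule: wk.induct)
  case refl
  then show ?case using antipodal_metricD(1)[OF metric u u] by (simp add: F_def)
next
  case (step y n s e z)
  then have "s \<in> {-1, 1}" using wk_snd_sign[OF signed_graph_R] by blast
  from F_step[OF u step.hyps(3,4) this] step.hyps(2) show ?case by simp
qed

lemma girth_R:
  assumes ne: "{u, v} \<in> wedges H"
  shows "unbalanced_girth R = enat (2 * k)"
proof (rule girth_eqI[OF signed_graph_R])
  fix vs es assume c: "cycle R vs es" and neg: "sign_of es = -1"
  then have w: "walk R vs es" by (auto simp: cycle_def)
  \<comment> \<open>A negative cycle uses an edge of sign -1. This is the first edge of a replacing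
    path and therefore meets an original vertex, from which \<open>F\<close> bounds the
    length.\<close>
  have "\<exists>ed\<in>set es. snd ed \<noteq> 1"
  proof (rule ccontr)
    assume "\<not> ?thesis"
    then have "map snd es = replicate (length es) 1" by (intro replicate_eqI) auto
    then show False using neg by (simp add: sign_of_def)
  qed
  then obtain i where i: "i < length es" "snd (es ! i) \<noteq> 1" by (metis in_set_conv_nth)
  then have "es ! i \<in> sedges R" "fst (es ! i) = {vs ! i, vs ! Suc i}" using w by (auto simp: walk_def)
  then obtain e where "e \<in> wedges H" "Orig (Min e) \<in> {vs ! i, vs ! Suc i}"
    using i(2) unfolding sedges_path_replacement path_edges_def
    by (fastforce simp: path_vertex_def split: if_splits)
  then obtain j where j: "j \<le> length es" "vs ! j = Orig (Min e)" using i(1)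
    by (metis Suc_leI insert_iff less_imp_le singletonD)
  have m: "Min e \<in> wverts H" using edge_Min_Max \<open>e \<in> wedges H\<close> by blast
  have "wk snd R (Orig (Min e)) (Orig (Min e)) (length es) (-1)"
    using cycle_imp_wk_at[OF signed_graph_R c j(1)] neg j(2) by simp
  from F_le_wk[OF m this] show "2 * k \<le> length es"
    using antipodal_metricD(1)[OF metric m m] by (simp add: F_def)
next
  have uv: "u \<in> wverts H" "v \<in> wverts H" using ne weighted by (auto simp: weighted_graph_def)
  \<comment> \<open>The two paths that replace one edge close up to a negative closed walk of length
    \<open>2k\<close>.\<close>
  have "wk snd R (Orig u) (Orig u) (nat (p u v) + nat (2 * int k - p u v)) (-1)"
    using wk_trans[OF wk_sym[OF wk_Orig[OF ne, of "-1"]] wk_Orig[OF ne, of 1]] by simp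
  moreover have "nat (p u v) + nat (2 * int k - p u v) = 2 * k"
    using antipodal_metricD(5,6)[OF metric uv] by linarith
  ultimately show "wk snd R (Orig u) (Orig u) (2 * k) (-1)" by simp
qed

end

lemma pos_val_bounds:
  assumes "{u, v} \<in> wedges H"
  shows "1 \<le> pos_val k (wt H u v)" "pos_val k (wt H u v) \<le> 2 * int k - 1"
proof -
  have "1 \<le> \<bar>wt H u v\<bar>" "\<bar>wt H u v\<bar> \<le> int k" using assms upto unfolding weights_upto_def by blast+
  then show "1 \<le> pos_val k (wt H u v)" "pos_val k (wt H u v) \<le> 2 * int k - 1"
    using k unfolding pos_val_def by auto
qed

lemma antipodal_metric_if_girth:
  assumes comp: "wcomplete H" and bip: "wbipartite H" and girth: "enat (2 * k) \<le> unbalanced_girth R"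
  shows "antipodal_metric k (wverts H) p"
proof (rule antipodal_metricI[OF k])
  show "p x x = 0" for x by (simp add: weight_metric_def)
  have edge: "{x, y} \<in> wedges H" if "x \<in> wverts H" "y \<in> wverts H" "x \<noteq> y" for x y
    using wcomplete_edge[OF comp] that by blast
  show sb: "p x y = p y x \<and> 1 \<le> p x y \<and> p x y \<le> 2 * int k - 1"
    if "x \<in> wverts H" "y \<in> wverts H" "x \<noteq> y" for x y
    using pos_val_bounds[OF edge[OF that]] wt_sym[OF edge[OF that]] that
    by (simp add: weight_metric_def)
  obtain X Y where XY: "X \<union> Y = wverts H" "X \<inter> Y = {}"
    "\<forall>u v. {u, v} \<in> wedges H \<longrightarrow> (odd (wt H u v) \<longleftrightarrow> (u \<in> X \<longleftrightarrow> v \<in> Y))"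
    using bip unfolding wbipartite_def by blast
  fix x y z assume S: "x \<in> wverts H" "y \<in> wverts H" "z \<in> wverts H" and ne: "x \<noteq> y" "y \<noteq> z" "x \<noteq> z"
  note E = edge[OF S(1,2) ne(1)] edge[OF S(2,3) ne(2)] edge[OF S(1,3) ne(3)]
  have par: "even (p u v) \<longleftrightarrow> (u \<in> X \<longleftrightarrow> v \<in> X)" if "{u, v} \<in> wedges H" for u v
  proof -
    have "u \<in> wverts H" "v \<in> wverts H" "u \<noteq> v" using that wcomplete_edge[OF comp] by auto
    then show ?thesis using XY that by (auto simp: weight_metric_def pos_val_def)
  qed
  \<comment> \<open>Around the triangle one replacing path is chosen for each edge. The signs 1, 1,
    -1 yield a triangle inequality and -1, -1, -1 the perimeter bound.\<close>
  have closed: "2 * int k \<le> signed_val k r (p x y) + signed_val k s (p y z) + signed_val k t (p x z)"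
    if sg: "r \<in> {-1, 1}" "s \<in> {-1, 1}" "t \<in> {-1, 1}" and "r * s * t = -1" for r s t
  proof -
    have "wk snd R (Orig x) (Orig x) (nat (signed_val k r (p x y)) + nat (signed_val k s (p y z))
        + nat (signed_val k t (p x z))) (r * s * t)"
      using wk_trans[OF wk_sym[OF wk_Orig[OF E(3) sg(3)]] wk_trans[OF wk_Orig[OF E(2) sg(2)] wk_Orig[OF E(1) sg(1)]]] .
    with that(4) girth_le_closed_walk[OF signed_graph_R girth]
    have "2 * k \<le> nat (signed_val k r (p x y)) + nat (signed_val k s (p y z)) + nat (signed_val k t (p x z))"
      by simp
    moreover have "0 \<le> signed_val k r (p x y)" "0 \<le> signed_val k s (p y z)" "0 \<le> signed_val k t (p x z)"
      using sb[OF S(1,2) ne(1)] sb[OF S(2,3) ne(2)] sb[OF S(1,3) ne(3)] by (auto simp: signed_val_def)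
    ultimately show ?thesis by linarith
  qed
  show "p x z \<le> p x y + p y z \<and> p x y + p y z + p x z \<le> 4 * int k \<and> even (p x y + p y z + p x z)"
    using closed[of 1 1 "-1"] closed[of "-1" "-1" "-1"] par[OF E(1)] par[OF E(2)] par[OF E(3)] by auto
qed

end

lemma wide_complete_graphs_metric:
  assumes "k \<ge> 1" "X \<in> wide_complete_graphs n k"
  shows "antipodal_metric k (wverts X) (weight_metric k (wt X))"
proof -
  interpret weighted_upto k X
    using assms by unfold_locales (auto simp: wide_complete_graphs_def wide_def)
  show ?thesis
    using antipodal_metric_if_girth assms by (auto simp: wide_complete_graphs_def wide_def)
qed

section \<open>Wide complete graphs from antipodal metrics\<close>

text \<open>A right inverse of \<open>pos_val\<close> on distances from 1 to \<open>2k - 1\<close>;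
  of the two weights for distance \<open>k\<close> the positive one is taken.\<close>

definition metric_graph :: "nat \<Rightarrow> 'v set \<Rightarrow> ('v \<Rightarrow> 'v \<Rightarrow> int) \<Rightarrow> 'v wgraph" where
  "metric_graph k S p = \<lparr>wverts = S, wedges = {e. e \<subseteq> S \<and> card e = 2},
     wt = \<lambda>u v. if p u v \<le> int k then p u v else p u v - 2 * int k\<rparr>"

lemma metric_graph_wide:
  fixes S :: "nat set"
  assumes k: "k \<ge> 1" and p: "antipodal_metric k S p" and S: "finite S" "card S = n" "n \<ge> 2"
  shows "metric_graph k S p \<in> wide_complete_graphs n k"
    "\<And>u v. u \<in> S \<Longrightarrow> v \<in> S \<Longrightarrow> u \<noteq> v \<Longrightarrow> pos_val k (wt (metric_graph k S p) u v) = p u v"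
proof -
  let ?X = "metric_graph k S p"
  have sel [simp]: "wverts ?X = S" "wedges ?X = {e. e \<subseteq> S \<and> card e = 2}"
    "wt ?X = (\<lambda>u v. if p u v \<le> int k then p u v else p u v - 2 * int k)"
    by (auto simp: metric_graph_def)
  have b: "1 \<le> p u v" "p u v \<le> 2 * int k - 1" if "u \<in> S" "v \<in> S" "u \<noteq> v" for u v
    using antipodal_metricD[OF p] that by blast+
  show pv: "pos_val k (wt ?X u v) = p u v" if "u \<in> S" "v \<in> S" "u \<noteq> v" for u v
    using b[OF that] by (auto simp: pos_val_def)
  have wg: "weighted_graph ?X"
    unfolding weighted_graph_def
  proof (intro conjI allI impI ballI)
    fix u v assume "{u, v} \<in> wedges ?X"
    then have uv: "u \<in> S" "v \<in> S" "u \<noteq> v" by auto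
    show "wt ?X u v \<noteq> 0" using b[OF uv] by auto
    show "wt ?X u v = wt ?X v u" using antipodal_metricD(2)[OF p uv(1,2)] by simp
  qed (use S in auto)
  have up: "weights_upto k ?X"
    unfolding weights_upto_def
  proof (intro allI impI)
    fix u v assume "{u, v} \<in> wedges ?X"
    then have uv: "u \<in> S" "v \<in> S" "u \<noteq> v" by auto
    then show "1 \<le> \<bar>wt ?X u v\<bar> \<and> \<bar>wt ?X u v\<bar> \<le> int k" using b[OF uv] by auto
  qed
  interpret weighted_upto k ?X using k wg up by unfold_locales
  have m: "antipodal_metric k (wverts ?X) (weight_metric k (wt ?X))"
    by (rule antipodal_metric_cong[where p = p])
      (use p pv antipodal_metricD(1)[OF p] in \<open>auto simp: weight_metric_def simp del: sel(3)\<close>)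
  \<comment> \<open>Some edge must exist for the girth to be \<open>2k\<close> and not infinite;
    this is where \<open>n \<ge> 2\<close> enters.\<close>
  obtain u v where uv: "u \<in> S" "v \<in> S" "u \<noteq> v"
    using S by (metis card_le_Suc0_iff_eq not_less_eq_eq numeral_2_eq_2)
  have "wbipartite ?X"
    unfolding wbipartite_def
  proof (intro exI conjI allI impI)
    let ?A = "{x \<in> S. even (p u x)}" and ?B = "{x \<in> S. odd (p u x)}"
    show "?A \<union> ?B = wverts ?X" "?A \<inter> ?B = {}" by auto
    fix x y assume "{x, y} \<in> wedges ?X"
    then have xy: "x \<in> S" "y \<in> S" "x \<noteq> y" by auto
    then have "even (p u x + p x y + p u y)" using antipodal_metric_triangle(3)[OF p] uv by blast
    then show "odd (wt ?X x y) = ((x \<in> ?A) = (y \<in> ?B))" using xy by auto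
  qed
  moreover have "{u, v} \<in> wedges ?X" using uv by auto
  moreover have "wcomplete ?X" by (simp add: wcomplete_def)
  ultimately show "?X \<in> wide_complete_graphs n k"
    unfolding wide_complete_graphs_def wide_def using girth_R[OF m] wg up S by auto
qed

section \<open>Homomorphisms from closed sets of cliques\<close>

text \<open>Each pair contributes only a shortest walk, of length at most \<open>k\<close>. If the
  three signs multiply to 1, the triangle inequality of \<open>gdist\<close> is decisive; if to -1,
  the three walks form a negative closed walk, to which the girth applies. The remaining
  inequalities follow from the bound \<open>k\<close>.\<close>

lemma distance_antipodal_metric:
  assumes B: "signed_graph B" "bipartite B" "enat (2 * k) \<le> unbalanced_girth B" and k: "k \<ge> 1"
    and K: "\<And>x y. x \<in> K \<Longrightarrow> y \<in> K \<Longrightarrow> x \<noteq> y \<Longrightarrow> joined B x y \<and> \<bar>alg_dist B x y\<bar> \<le> int k"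
  shows "antipodal_metric k K (weight_metric k (alg_dist B))"
proof (rule antipodal_metricI[OF k])
  let ?p = "weight_metric k (alg_dist B)"
  obtain col where col: "\<And>x y n s. wk snd B x y n s \<Longrightarrow> even n \<longleftrightarrow> col x = (col y :: bool)"
    using bipartite_colouring[OF B(2), of snd] by metis
  have ex: "\<exists>s d. (s = 1 \<and> ?p x y = int d \<or> s = -1 \<and> ?p x y = 2 * int k - int d) \<and> wk snd B x y d s \<and>
    d = gdist B x y \<and> 1 \<le> d \<and> d \<le> k"
    if "x \<in> K" "y \<in> K" "x \<noteq> y" for x y
  proof -
    have j: "joined B x y" "\<bar>alg_dist B x y\<bar> \<le> int k" using K[OF that] by auto
    obtain s where s: "s = 1 \<or> s = -1" "wk snd B x y (gdist B x y) s"
      "alg_dist B x y = s * int (gdist B x y)" using alg_dist_wk[OF B(1) j(1)] .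
    have "gdist B x y > 0" using gdist_pos[OF j(1) that(3)] .
    then show ?thesis using s j(2) that
      by (intro exI[of _ s] exI[of _ "gdist B x y"]) (auto simp: weight_metric_def pos_val_def)
  qed
  show "?p x x = 0" for x by (simp add: weight_metric_def)
  show "?p x y = ?p y x \<and> 1 \<le> ?p x y \<and> ?p x y \<le> 2 * int k - 1"
    if "x \<in> K" "y \<in> K" "x \<noteq> y" for x y
    using ex[OF that] that alg_dist_commute[of B x y] by (auto simp: weight_metric_def)
  fix x y z assume S: "x \<in> K" "y \<in> K" "z \<in> K" and ne: "x \<noteq> y" "y \<noteq> z" "x \<noteq> z"
  obtain r a where ra: "r = 1 \<and> ?p x y = int a \<or> r = -1 \<and> ?p x y = 2 * int k - int a" "wk snd B x y a r"
    "a = gdist B x y" "a \<le> k" using ex[OF S(1,2) ne(1)] by blast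
  obtain s b where sb: "s = 1 \<and> ?p y z = int b \<or> s = -1 \<and> ?p y z = 2 * int k - int b" "wk snd B y z b s"
    "b = gdist B y z" "b \<le> k" using ex[OF S(2,3) ne(2)] by blast
  obtain t c where tc: "t = 1 \<and> ?p x z = int c \<or> t = -1 \<and> ?p x z = 2 * int k - int c" "wk snd B x z c t"
    "c = gdist B x z" "c \<le> k" using ex[OF S(1,3) ne(3)] by blast
  have "c \<le> a + b" using gdist_le_wk[OF wk_trans[OF sb(2) ra(2)]] tc(3) by simp
  moreover have "a \<le> c + b" using gdist_le_wk[OF wk_trans[OF wk_sym[OF sb(2)] tc(2)]] ra(3) by simp
  moreover have "b \<le> a + c" using gdist_le_wk[OF wk_trans[OF tc(2) wk_sym[OF ra(2)]]] sb(3) by simp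
  moreover have "r * s * t = -1 \<Longrightarrow> 2 * k \<le> a + b + c"
    using girth_le_closed_walk[OF B(1,3), of x "a + b + c"] wk_trans[OF wk_sym[OF tc(2)] wk_trans[OF sb(2) ra(2)]]
    by simp
  moreover have "even (?p x y + ?p y z + ?p x z)"
  proof -
    have "even (?p x y) \<longleftrightarrow> even a" "even (?p y z) \<longleftrightarrow> even b" "even (?p x z) \<longleftrightarrow> even c"
      using ra(1) sb(1) tc(1) by auto
    then show ?thesis using col[OF ra(2)] col[OF sb(2)] col[OF tc(2)] by (simp only: even_add) blast
  qed
  ultimately show "?p x z \<le> ?p x y + ?p y z \<and> ?p x y + ?p y z + ?p x z \<le> 4 * int k \<and>
     even (?p x y + ?p y z + ?p x z)"
    using ra(1,4) sb(1,4) tc(1,4) by (elim disjE conjE) auto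
qed

lemma alg_dist_unit_edge:
  assumes "signed_graph B" "joined B x y" "\<bar>alg_dist B x y\<bar> = 1"
  shows "({x, y}, alg_dist B x y) \<in> sedges B"
proof -
  obtain s where s: "s = 1 \<or> s = -1" "wk snd B x y (gdist B x y) s"
    "alg_dist B x y = s * int (gdist B x y)" using alg_dist_wk[OF assms(1,2)] .
  then have g: "gdist B x y = 1" using assms(3) by (auto simp: abs_mult)
  then have "wk snd B x y 1 s" using s by simp
  then obtain e where "e \<in> sedges B" "fst e = {x, y}" "s = snd e" by (rule wk_1E)
  then show ?thesis using s g by (cases e) auto
qed

section \<open>Mapping t-trees along a closed family of cliques\<close>

lemma t_tree_subset:
  assumes "t_tree t V E"
  shows "E \<subseteq> {e. e \<subseteq> V \<and> card e = 2}"
  using assms by (induction rule: t_tree.induct) auto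

lemma t_tree_finite: "t_tree t V E \<Longrightarrow> finite V"
  by (induction rule: t_tree.induct) (auto intro: card_ge_0_finite)

definition clique :: "'v set set \<Rightarrow> 'v set \<Rightarrow> bool" where
  "clique E Q \<longleftrightarrow> (\<forall>u\<in>Q. \<forall>v\<in>Q. u \<noteq> v \<longrightarrow> {u, v} \<in> E)"

locale closed_family =
  fixes t k :: nat and D :: "'b wgraph" and W :: "'b set set"
  assumes k: "k \<ge> 1" and t: "t \<ge> 1" and upto: "weights_upto k D"
    and W: "W \<subseteq> wcliques (Suc t) D" and closed: "closed_cliques t k D W"
begin

definition embeds :: "(nat \<Rightarrow> nat \<Rightarrow> int) \<Rightarrow> nat set \<Rightarrow> (nat \<Rightarrow> 'b) \<Rightarrow> (nat \<Rightarrow> int) \<Rightarrow> bool" where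
  "embeds p S f c \<longleftrightarrow> inj_on f S \<and> f ` S \<in> W \<and> (\<forall>u\<in>S. c u \<in> {-1, 1}) \<and>
    (\<forall>u\<in>S. \<forall>v\<in>S. u \<noteq> v \<longrightarrow> pos_val k (wt D (f u) (f v)) = signed_val k (c u * c v) (p u v))"

lemma embeds_cong:
  assumes "embeds p S f c" "\<And>u. u \<in> S \<Longrightarrow> f u = f' u \<and> c u = c' u"
  shows "embeds p S f' c'"
proof -
  have "inj_on f S \<longleftrightarrow> inj_on f' S" by (rule inj_on_cong) (simp add: assms(2))
  moreover have "f ` S = f' ` S" by (rule image_cong) (simp_all add: assms(2))
  ultimately show ?thesis using assms unfolding embeds_def by simp
qed

text \<open>Closedness extends isomorphisms from cliques to wide graphs. So the metric on the new
  vertex set is turned into such a graph \<open>X\<close>, the inverse of \<open>f\<close> serves as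
  isomorphism on the common vertices, and the extension is inverted again. Only the values at
  \<open>z\<close> change.\<close>

lemma embeds_exchange:
  assumes emb: "embeds p S f c" and v: "v \<in> S" and z: "z \<notin> S"
    and p: "antipodal_metric k (insert z (S - {v})) p"
  shows "\<exists>b s. embeds p (insert z (S - {v})) (f(z := b)) (c(z := s))"
proof -
  define T where "T = insert z (S - {v})"
  define K where "K = f ` S"
  have inj: "inj_on f S" and KW: "K \<in> W" using emb by (auto simp: embeds_def K_def)
  have Kc: "wcomplete (winduced D K)" "card K = Suc t" using KW W by (auto simp: wcliques_def)
  have cS: "card S = Suc t" using card_image[OF inj] Kc by (simp add: K_def)
  have finS: "finite S" using cS by (metis card.infinite nat.distinct(1))
  have finT: "finite T" and cT: "card T = Suc t"
    using finS cS v z by (auto simp: T_def card_insert_if card_Diff_singleton)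
  have Tz: "T - {z} = S - {v}" using z by (auto simp: T_def)
  have pT: "antipodal_metric k T p" using p by (simp add: T_def)
  define X where "X = metric_graph k T p"
  have X: "X \<in> wide_complete_graphs (Suc t) k"
    and Xp: "\<And>u v. u \<in> T \<Longrightarrow> v \<in> T \<Longrightarrow> u \<noteq> v \<Longrightarrow> pos_val k (wt X u v) = p u v"
    using metric_graph_wide[OF k pT finT cT] t by (auto simp: X_def)
  have XT: "wverts X = T" by (simp add: X_def metric_graph_def)
  have Xc: "wcomplete X" "weights_upto k X" using X by (auto simp: wide_complete_graphs_def wide_def)
  define \<phi> where "\<phi> = inv_into S f"
  have \<phi>f: "\<phi> (f u) = u" if "u \<in> S" for u using inj that by (simp add: \<phi>_def)
  have Kv: "K - {f v} = f ` (S - {v})" using inj v by (auto simp: K_def inj_on_def)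
  have iso: "wiso k (winduced D (K - {f v})) (winduced X (wverts X - {z})) (c \<circ> \<phi>) \<phi>"
  proof (subst wiso_complete_iff)
    show "wcomplete (winduced D (K - {f v}))" using wcomplete_winduced_subset[OF Kc(1)] by blast
    show "wcomplete (winduced X (wverts X - {z}))" using wcomplete_imp_winduced[OF Xc(1)] by blast
    show "weights_upto k (winduced D (K - {f v}))" "weights_upto k (winduced X (wverts X - {z}))"
      using weights_upto_winduced upto Xc(2) by blast+
    have "bij_betw \<phi> (K - {f v}) (S - {v})"
      unfolding Kv by (rule bij_betw_byWitness[where f' = f]) (auto simp: \<phi>f)
    moreover have "pos_val k (wt X (\<phi> x) (\<phi> y)) = signed_val k (c (\<phi> x) * c (\<phi> y)) (pos_val k (wt D x y))"
      if xy: "x \<in> K - {f v}" "y \<in> K - {f v}" "x \<noteq> y" for x y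
    proof -
      obtain u u' where u: "u \<in> S - {v}" "x = f u" "u' \<in> S - {v}" "y = f u'" using xy unfolding Kv by blast
      have uu: "u \<noteq> u'" using u xy by blast
      have "pos_val k (wt D (f u) (f u')) = signed_val k (c u * c u') (p u u')" "c u \<in> {-1, 1}" "c u' \<in> {-1, 1}"
        using emb u uu unfolding embeds_def by auto
      moreover have "pos_val k (wt X u u') = p u u'" using Xp u uu by (auto simp: T_def)
      ultimately show ?thesis using u \<phi>f by (auto simp: signed_val_def)
    qed
    moreover have "\<forall>u\<in>S. c u \<in> {-1, 1}" using emb by (simp add: embeds_def)
    ultimately show "(\<forall>u\<in>wverts (winduced D (K - {f v})). (c \<circ> \<phi>) u \<in> {- 1, 1}) \<and>
      bij_betw \<phi> (wverts (winduced D (K - {f v}))) (wverts (winduced X (wverts X - {z}))) \<and>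
      (\<forall>u\<in>wverts (winduced D (K - {f v})). \<forall>va\<in>wverts (winduced D (K - {f v})). u \<noteq> va \<longrightarrow>
        pos_val k (wt (winduced X (wverts X - {z})) (\<phi> u) (\<phi> va)) =
        signed_val k ((c \<circ> \<phi>) u * (c \<circ> \<phi>) va) (pos_val k (wt (winduced D (K - {f v})) u va)))"
      by (auto simp: XT Tz Kv \<phi>f)
  qed
  have "f v \<in> K" using v by (simp add: K_def)
  moreover have "z \<in> wverts X" by (simp add: XT T_def)
  ultimately obtain K' c' \<phi>' where K': "K' \<in> W" "K - {f v} \<subseteq> K'"
    and ext: "\<forall>u \<in> K - {f v}. c' u = (c \<circ> \<phi>) u \<and> \<phi>' u = \<phi> u" and iso': "wiso k (winduced D K') X c' \<phi>'"
    using closed[unfolded closed_cliques_def, rule_format, OF KW _ X _ iso] by blast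
  have K'c: "wcomplete (winduced D K')" using K' W by (auto simp: wcliques_def)
  have i: "\<forall>u\<in>K'. c' u \<in> {-1, 1}" "bij_betw \<phi>' K' T"
    "\<forall>u\<in>K'. \<forall>v\<in>K'. u \<noteq> v \<longrightarrow> pos_val k (wt X (\<phi>' u) (\<phi>' v)) = signed_val k (c' u * c' v) (pos_val k (wt D u v))"
    using iso' wiso_complete_iff[OF K'c Xc(1) weights_upto_winduced[OF upto] Xc(2)] by (auto simp: XT)
  define f' where "f' = inv_into K' \<phi>'"
  have f': "bij_betw f' T K'" unfolding f'_def by (rule bij_betw_inv_into[OF i(2)])
  have \<phi>f': "\<phi>' (f' u) = u" if "u \<in> T" for u
    using i(2) that unfolding f'_def by (simp add: bij_betw_def f_inv_into_f)
  have f'f: "f' u = f u \<and> c' (f' u) = c u" if "u \<in> S - {v}" for u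
  proof -
    have "f u \<in> K - {f v}" using that Kv by blast
    then have "f u \<in> K'" "\<phi>' (f u) = u" "c' (f u) = c u" using K'(2) ext \<phi>f that by auto
    moreover have "f' (\<phi>' (f u)) = f u" unfolding f'_def using i(2) \<open>f u \<in> K'\<close> by (simp add: bij_betw_def)
    ultimately show ?thesis by simp
  qed
  have "embeds p T f' (c' \<circ> f')"
    unfolding embeds_def
  proof (intro conjI ballI impI)
    show "inj_on f' T" "f' ` T \<in> W" using f' K' by (auto simp: bij_betw_def)
    show "(c' \<circ> f') u \<in> {-1, 1}" if "u \<in> T" for u using f' i(1) that by (auto simp: bij_betw_def)
    fix u w assume uw: "u \<in> T" "w \<in> T" "u \<noteq> w"
    then have "f' u \<in> K'" "f' w \<in> K'" "f' u \<noteq> f' w" using f' by (auto simp: bij_betw_def inj_on_def)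
    then have "pos_val k (wt X (\<phi>' (f' u)) (\<phi>' (f' w))) =
        signed_val k (c' (f' u) * c' (f' w)) (pos_val k (wt D (f' u) (f' w)))"
      "c' (f' u) \<in> {-1, 1}" "c' (f' w) \<in> {-1, 1}" using i(1,3) by blast+
    moreover have "\<phi>' (f' u) = u" "\<phi>' (f' w) = w" "pos_val k (wt X u w) = p u w"
      using \<phi>f' Xp uw by auto
    ultimately have "p u w = signed_val k (c' (f' u) * c' (f' w)) (pos_val k (wt D (f' u) (f' w)))"
      "c' (f' u) \<in> {-1, 1}" "c' (f' w) \<in> {-1, 1}" by simp_all
    then show "pos_val k (wt D (f' u) (f' w)) = signed_val k ((c' \<circ> f') u * (c' \<circ> f') w) (p u w)"
      by (auto simp: signed_val_def)
  qed
  then have "embeds p T (f(z := f' z)) (c(z := c' (f' z)))"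
    by (rule embeds_cong) (use f'f in \<open>auto simp: T_def\<close>)
  then show ?thesis unfolding T_def by blast
qed

text \<open>The vertices of a given member of \<open>W\<close> are exchanged one by one for those of \<open>A\<close>.\<close>

lemma embeds_exchange_all:
  assumes p: "antipodal_metric k (U \<union> V) p" and emb: "embeds p U f0 c0" "finite U" "card U = Suc t" "U \<inter> V = {}"
    and A: "finite A" "A \<subseteq> V" "card A \<le> Suc t"
  shows "\<exists>S f c. embeds p S f c \<and> A \<subseteq> S \<and> S \<subseteq> A \<union> U \<and> card S = Suc t"
  using A
proof (induction A rule: finite_induct)
  case empty
  then show ?case using emb by blast
next
  case (insert a A)
  then obtain S f c where S: "embeds p S f c" "A \<subseteq> S" "S \<subseteq> A \<union> U" "card S = Suc t" by auto
  have fin: "finite S" using S(4) by (metis card.infinite nat.distinct(1))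
  have "card A < card S" using insert S by simp
  then obtain v where v: "v \<in> S" "v \<notin> A" using S(2) by (metis order_less_irrefl subsetI subset_antisym)
  have a: "a \<notin> S" using S(3) insert emb(4) by auto
  have "antipodal_metric k (insert a (S - {v})) p"
    by (rule antipodal_metric_subset[OF p]) (use S(3) insert in auto)
  from embeds_exchange[OF S(1) v(1) a this]
  obtain b s where "embeds p (insert a (S - {v})) (f(a := b)) (c(a := s))" by blast
  moreover have "card (insert a (S - {v})) = Suc t" using S(4) fin v a by (simp add: card_Diff_singleton)
  moreover have "insert a A \<subseteq> insert a (S - {v})" "insert a (S - {v}) \<subseteq> insert a A \<union> U"
    using S v by auto
  ultimately show ?case by blast
qed

text \<open>Beyond edges and vertices, the invariant covers every clique of size \<open>t\<close>,
  because the next vertex may be attached to any of them. The maps are changed only at the new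
  vertex, so sets embedded before stay embedded.\<close>

lemma t_tree_embeds:
  assumes p: "antipodal_metric k (U \<union> V') p" and emb: "embeds p U f0 c0" "finite U" "card U = Suc t" "U \<inter> V' = {}"
    and "t_tree t V E" "V \<subseteq> V'"
  shows "\<exists>f c. (\<forall>Q\<subseteq>V. card Q = t \<and> clique E Q \<longrightarrow> (\<exists>S\<subseteq>V. Q \<subseteq> S \<and> embeds p S f c)) \<and>
    (\<forall>e\<in>E. \<exists>S\<subseteq>V. e \<subseteq> S \<and> embeds p S f c) \<and> (\<forall>u\<in>V. \<exists>S\<subseteq>V. u \<in> S \<and> embeds p S f c)"
  using assms(6,7)
proof (induction rule: t_tree.induct)
  case (base V)
  have fin: "finite V" using base by (metis card.infinite nat.distinct(1))
  obtain S f c where S: "embeds p S f c" "V \<subseteq> S" "S \<subseteq> V \<union> U" "card S = Suc t"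
    using embeds_exchange_all[OF p emb fin] base by auto
  have "finite S" using S(4) by (metis card.infinite nat.distinct(1))
  then have "V = S" using S base by (intro card_subset_eq) auto
  then show ?case using S by (intro exI[of _ f] exI[of _ c]) auto
next
  case (step V E Q z)
  then obtain f c where f: "\<forall>Q\<subseteq>V. card Q = t \<and> clique E Q \<longrightarrow> (\<exists>S\<subseteq>V. Q \<subseteq> S \<and> embeds p S f c)"
    "\<forall>e\<in>E. \<exists>S\<subseteq>V. e \<subseteq> S \<and> embeds p S f c" "\<forall>u\<in>V. \<exists>S\<subseteq>V. u \<in> S \<and> embeds p S f c" by auto
  have "clique E Q" using step.hyps(4) by (simp add: clique_def)
  then obtain S where S: "S \<subseteq> V" "Q \<subseteq> S" "embeds p S f c"
    using f(1) step.hyps(2,3) by blast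
  have cS: "card S = Suc t"
    using S(3) W card_image[of f S] by (auto simp: embeds_def wcliques_def)
  have fin: "finite S" using cS by (metis card.infinite nat.distinct(1))
  \<comment> \<open>\<open>S\<close> has exactly one vertex outside \<open>Q\<close>; the new vertex
    takes its place in the clique.\<close>
  have "card (S - Q) = 1" using card_Diff_subset[OF finite_subset[OF S(2) fin] S(2)] cS step.hyps(3) by simp
  then obtain v where "S - Q = {v}" by (auto simp: card_1_singleton_iff)
  then have v: "v \<in> S" "S - {v} = Q" using S(2) by auto
  have "antipodal_metric k (insert z (S - {v})) p"
    by (rule antipodal_metric_subset[OF p]) (use S(1) step.prems in auto)
  moreover have "z \<notin> S" using S(1) step.hyps(5) by blast
  ultimately obtain b s where new: "embeds p (insert z Q) (f(z := b)) (c(z := s))"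
    using embeds_exchange[OF S(3) v(1)] v(2) by metis
  have old: "embeds p S (f(z := b)) (c(z := s))" if "embeds p S f c" "S \<subseteq> V" for S
    by (rule embeds_cong[OF that(1)]) (use that step.hyps(5) in auto)
  have EV: "E \<subseteq> {e. e \<subseteq> V \<and> card e = 2}" using t_tree_subset[OF step.hyps(1)] .
  let ?E = "E \<union> {{u, z} | u. u \<in> Q}"
  have 1: "\<exists>S\<subseteq>insert z V. P \<subseteq> S \<and> embeds p S (f(z := b)) (c(z := s))"
    if P: "P \<subseteq> insert z V" "card P = t" "clique ?E P" for P
  proof (cases "z \<in> P")
    case True
    \<comment> \<open>The new vertex has no neighbours outside \<open>Q\<close>.\<close>
    have "P \<subseteq> insert z Q"
    proof
      fix u assume u: "u \<in> P"
      show "u \<in> insert z Q"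
      proof (cases "u = z")
        case False
        then have "{u, z} \<in> ?E" using P(3) u True unfolding clique_def by blast
        moreover have "{u, z} \<notin> E" using EV step.hyps(5) by blast
        ultimately obtain u' where "{u, z} = {u', z}" "u' \<in> Q" by blast
        then show ?thesis using False by (auto simp: doubleton_eq_iff)
      qed simp
    qed
    then show ?thesis using new step.hyps(2) by (intro exI[of _ "insert z Q"]) auto
  next
    case False
    have "clique E P"
      unfolding clique_def
    proof (intro ballI impI)
      fix u u' assume u: "u \<in> P" "u' \<in> P" "u \<noteq> u'"
      then have "{u, u'} \<in> ?E" using P(3) unfolding clique_def by blast
      then show "{u, u'} \<in> E" using u False by (auto simp: doubleton_eq_iff)
    qed
    moreover have "P \<subseteq> V" using P False by blast
    ultimately obtain S where "S \<subseteq> V" "P \<subseteq> S" "embeds p S f c" using f(1) P(2) by blast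
    then show ?thesis using old by (intro exI[of _ S]) auto
  qed
  have 2: "\<exists>S\<subseteq>insert z V. e \<subseteq> S \<and> embeds p S (f(z := b)) (c(z := s))" if "e \<in> ?E" for e
    using that
  proof
    assume "e \<in> E"
    then obtain S where "S \<subseteq> V" "e \<subseteq> S" "embeds p S f c" using f(2) by blast
    then show ?thesis using old by (intro exI[of _ S]) auto
  next
    assume "e \<in> {{u, z} | u. u \<in> Q}"
    then have "e \<subseteq> insert z Q" by blast
    then show ?thesis using new step.hyps(2) by (intro exI[of _ "insert z Q"]) auto
  qed
  have 3: "\<exists>S\<subseteq>insert z V. u \<in> S \<and> embeds p S (f(z := b)) (c(z := s))" if "u \<in> insert z V" for u
    using that
  proof
    assume "u = z"
    then show ?thesis using new step.hyps(2) by (intro exI[of _ "insert z Q"]) auto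
  next
    assume "u \<in> V"
    then obtain S where "S \<subseteq> V" "u \<in> S" "embeds p S f c" using f(3) by blast
    then show ?thesis using old by (intro exI[of _ S]) auto
  qed
  show ?case
  proof (intro exI[of _ "f(z := b)"] exI[of _ "c(z := s)"] conjI allI ballI impI)
    fix P assume "P \<subseteq> insert z V" "card P = t \<and> clique ?E P"
    then show "\<exists>S\<subseteq>insert z V. P \<subseteq> S \<and> embeds p S (f(z := b)) (c(z := s))" using 1 by simp
  qed (fact 2, fact 3)
qed

end

section \<open>Homomorphisms from switched maps\<close>

lemma prod_list_map_mult:
  "prod_list (map (\<lambda>e. a e * b e) es) = prod_list (map a es) * (prod_list (map b es) :: int)"
  by (induction es) (auto simp: mult_ac)

text \<open>The product telescopes: every inner vertex of the walk contributes \<open>c\<close>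
  twice.\<close>

lemma wk_potential:
  assumes "wk \<tau> G x y n s" "\<And>e y z. e \<in> sedges G \<Longrightarrow> fst e = {y, z} \<Longrightarrow> \<tau> e = c y * c z"
    "\<And>x. x \<in> verts G \<Longrightarrow> c x \<in> {-1, 1}"
  shows "s = c x * c y"
  using assms
proof (induction rule: wk.induct)
  case (step x y n s e z)
  have "c y * c y = 1" using step.prems(2)[of y] wk_verts[OF step.hyps(1)] by auto
  then show ?case using step.IH[OF step.prems] step.prems(1)[OF step.hyps(2,3)] by (simp add: mult_ac)
qed force

lemma signed_homI:
  fixes G :: "'a sgraph" and H :: "'c sgraph"
  assumes G: "signed_graph G" "simple_graph G"
    and f: "f ` verts G \<subseteq> verts H" and c: "\<And>x. x \<in> verts G \<Longrightarrow> c x \<in> {-1, 1}"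
    and e: "\<And>u v s. ({u, v}, s) \<in> sedges G \<Longrightarrow> ({f u, f v}, s * (c u * c v)) \<in> sedges H"
  shows "\<exists>g. signed_hom G H f g"
proof -
  \<comment> \<open>Switching by \<open>c\<close> multiplies the sign of an edge by \<open>c\<close>
    at both ends; around a cycle these factors cancel.\<close>
  define g where "g = (\<lambda>e. (f ` fst e, snd e * (\<Prod>x\<in>fst e. c x)))"
  have g: "g (e, s) \<in> sedges H \<and> fst (g (e, s)) = f ` e \<and>
      (\<forall>u v. e = {u, v} \<longrightarrow> snd (g (e, s)) * s = c u * c v)" if es: "(e, s) \<in> sedges G" for e s
  proof -
    have "card e = 2" using es G(2) unfolding simple_graph_def edges_of_def by force
    then have *: "u \<noteq> v" if "e = {u, v}" for u v using that by auto
    obtain u v where uv: "e = {u, v}" using \<open>card e = 2\<close> by (auto simp: card_2_iff)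
    have s: "s \<in> {-1, 1}" using sedge_sign[OF G(1) es] by simp
    have "snd (g (e, s)) * s = c u * c v" if "e = {u, v}" for u v
      using s *[OF that] that by (auto simp: g_def)
    moreover have "g (e, s) \<in> sedges H" using e[of u v s] es uv *[OF uv] by (simp add: g_def)
    ultimately show ?thesis by (simp add: g_def)
  qed
  have "sign_of es = sign_of (map g es)" if cyc: "cycle G vs es" for vs es
  proof -
    let ?\<tau> = "\<lambda>e. snd (g e) * snd e"
    have w: "wk ?\<tau> G (hd vs) (hd vs) (length es) (prod_list (map ?\<tau> es))" using cycle_imp_wk[OF cyc] .
    have "prod_list (map ?\<tau> es) = c (hd vs) * c (hd vs)"
      by (rule wk_potential[OF w _ c]) (use g in force)+
    also have "\<dots> = 1" using c[of "hd vs"] wk_verts[OF w] by auto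
    finally have "sign_of (map g es) * sign_of es = 1"
      unfolding prod_list_map_mult sign_of_def by (simp add: comp_def)
    moreover have "sign_of es \<in> {-1, 1}"
      using wk_snd_sign[OF G(1) cycle_imp_wk[OF cyc]] by (simp add: sign_of_def)
    ultimately show ?thesis by auto
  qed
  then have "signed_hom G H f g" unfolding signed_hom_def using f g by auto
  then show ?thesis by (intro exI[of _ g])
qed

lemma bounds_if_closed_cliques:
  fixes B :: "'b sgraph"
  assumes k2: "k \<ge> 2" and t: "t \<ge> 1"
    and B: "signed_graph B" "bipartite B" "enat (2 * k) \<le> unbalanced_girth B"
    and D: "partial_distance_graph B D" "weights_upto k D"
    and W0: "W \<noteq> {}" "W \<subseteq> wcliques (Suc t) D" "closed_cliques t k D W"
  shows "bounds B (SBPT t k)"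
  unfolding bounds_def
proof
  fix G assume "G \<in> SBPT t k"
  then have G: "signed_graph G" "simple_graph G" "bipartite G" "enat (2 * k) \<le> unbalanced_girth G"
    and pt: "partial_t_tree t (verts G) (edges_of G)" by (auto simp: SBPT_def)
  interpret closed_family t k D W using k2 t D W0 by unfold_locales auto
  obtain V E where VE: "t_tree t V E" "verts G \<subseteq> V" "edges_of G \<subseteq> E"
    using pt unfolding partial_t_tree_def by blast
  have finV: "finite V" using t_tree_finite[OF VE(1)] .
  obtain p where p: "antipodal_metric k UNIV p"
    "\<And>u v s. ({u, v}, s) \<in> sedges G \<Longrightarrow> p u v = signed_val k s 1"
    using bipartite_antipodal_metric[OF k2 G(1,3,4)] by blast
  obtain K where KW: "K \<in> W" using W0(1) by blast
  have K: "K \<subseteq> wverts D" "card K = Suc t" "wcomplete (winduced D K)" using KW W by (auto simp: wcliques_def)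
  have dist: "joined B x y \<and> wt D x y = alg_dist B x y \<and> \<bar>alg_dist B x y\<bar> \<le> int k"
    if "K \<in> W" "x \<in> K" "y \<in> K" "x \<noteq> y" for K x y
  proof -
    have "wcomplete (winduced D K)" using that W by (auto simp: wcliques_def)
    then have e: "{x, y} \<in> wedges D" using that wcomplete_edge[of "winduced D K" x y] by (simp add: winduced_def)
    then have "{x, y} \<in> wedges (distance_graph B)" "wt D x y = alg_dist B x y"
      using D(1) by (auto simp: partial_distance_graph_def distance_graph_def)
    moreover have "\<bar>wt D x y\<bar> \<le> int k" using D(2) e unfolding weights_upto_def by blast
    ultimately show ?thesis using joined_sym[of B] by (auto simp: distance_graph_def doubleton_eq_iff)
  qed
  have mK: "antipodal_metric k K (weight_metric k (alg_dist B))"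
    using distance_antipodal_metric[OF B] dist[OF KW] k by auto
  have finK: "finite K" using K(2) by (metis card.infinite nat.distinct(1))
  \<comment> \<open>A copy of the clique is placed outside the t-tree, since the exchange of
    vertices presupposes disjoint sets.\<close>
  obtain U where U: "finite U" "card U = Suc t" "U \<subseteq> - V"
    using infinite_arbitrarily_large[of "- V" "Suc t"] finV by (auto simp: Compl_eq_Diff_UNIV)
  obtain \<beta> where \<beta>: "bij_betw \<beta> U K" using finite_same_card_bij[OF U(1) finK] U(2) K(2) by auto
  define q where "q = (\<lambda>x y. weight_metric k (alg_dist B) (\<beta> x) (\<beta> y))"
  have inj: "\<beta> x \<noteq> \<beta> y" if "x \<in> U" "y \<in> U" "x \<noteq> y" for x y using \<beta> that by (auto simp: bij_betw_def inj_on_def)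
  have im: "x \<in> U \<Longrightarrow> \<beta> x \<in> K" for x using \<beta> by (auto simp: bij_betw_def)
  have q: "antipodal_metric k U q"
    unfolding q_def using antipodal_metric_pullback[OF mK] \<beta> by (auto simp: bij_betw_def)
  obtain r where r: "antipodal_metric k (U \<union> V) r" "\<forall>x\<in>U. \<forall>y\<in>U. r x y = q x y" "\<forall>x\<in>V. \<forall>y\<in>V. r x y = p x y"
    using antipodal_metric_union[OF k2 q antipodal_metric_subset[OF p(1)] U(1) _ finV] U by fastforce
  have emb: "embeds r U \<beta> (\<lambda>_. 1)"
    using \<beta> KW r(2) inj im dist[OF KW] unfolding embeds_def
    by (auto simp: bij_betw_def q_def weight_metric_def)
  have "U \<inter> V = {}" using U(3) by blast
  from t_tree_embeds[OF r(1) emb U(1,2) this VE(1) order_refl] obtain f c where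
    f: "\<forall>e\<in>E. \<exists>S\<subseteq>V. e \<subseteq> S \<and> embeds r S f c" "\<forall>u\<in>V. \<exists>S\<subseteq>V. u \<in> S \<and> embeds r S f c"
    by (elim exE conjE) (rule that; assumption)
  have "\<exists>g. signed_hom G B f g"
  proof (rule signed_homI[OF G(1,2)])
    show "f ` verts G \<subseteq> verts B"
    proof
      fix y assume "y \<in> f ` verts G"
      then obtain u S where "u \<in> S" "embeds r S f c" "y = f u" using f(2) VE(2) by blast
      then have "y \<in> f ` S" "f ` S \<in> W" by (auto simp: embeds_def)
      then have "y \<in> wverts D" using W by (auto simp: wcliques_def)
      then show "y \<in> verts B" using D(1) by (simp add: partial_distance_graph_def distance_graph_def)
    qed
    show "c x \<in> {-1, 1}" if x: "x \<in> verts G" for x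
    proof -
      obtain S where "x \<in> S" "embeds r S f c" using f(2) VE(2) x by blast
      then show ?thesis unfolding embeds_def by blast
    qed
    fix u v s assume uvs: "({u, v}, s) \<in> sedges G"
    then have e: "{u, v} \<in> edges_of G" unfolding edges_of_def by force
    then have uv: "u \<noteq> v" using G(2) unfolding simple_graph_def by force
    obtain S where S: "S \<subseteq> V" "u \<in> S" "v \<in> S" "embeds r S f c" using bspec[OF f(1), of "{u, v}"] e VE(3) by blast
    then have c: "c u \<in> {-1, 1}" "c v \<in> {-1, 1}" and ne: "f u \<noteq> f v" and SW: "f ` S \<in> W"
      and "pos_val k (wt D (f u) (f v)) = signed_val k (c u * c v) (r u v)"
      using uv unfolding embeds_def inj_on_def by blast+
    moreover have "r u v = signed_val k s 1" using r(3) S(1-3) p(2)[OF uvs] by (metis subsetD)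
    moreover have s: "s \<in> {-1, 1}" using sedge_sign[OF G(1) uvs] by simp
    ultimately have pv: "pos_val k (wt D (f u) (f v)) = signed_val k (s * (c u * c v)) 1"
      by (auto simp: signed_val_def)
    have d: "joined B (f u) (f v)" "wt D (f u) (f v) = alg_dist B (f u) (f v)" "\<bar>alg_dist B (f u) (f v)\<bar> \<le> int k"
      using dist[OF SW _ _ ne] S by auto
    \<comment> \<open>Distances 1 and \<open>2k - 1\<close> stand for algebraic distances 1 and -1:
      their other preimages under \<open>pos_val\<close> have absolute value \<open>2k - 1\<close>,
      which exceeds \<open>k\<close>.\<close>
    have "alg_dist B (f u) (f v) = s * (c u * c v)"
      using pv d(2,3) s c k2 by (auto simp: pos_val_def signed_val_def split: if_splits)
    moreover have "\<bar>s * (c u * c v)\<bar> = 1" using s c by auto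
    ultimately show "({f u, f v}, s * (c u * c v)) \<in> sedges B"
      using alg_dist_unit_edge[OF B(1) d(1)] by simp
  qed
  then show "\<exists>f g. signed_hom G B f g" by blast
qed

section \<open>Metric t-trees\<close>

text \<open>\<open>\<tau>\<close> compares the sign of an edge with that of its image. It is
  balanced: a closed walk with product -1 would yield a cycle whose sign is not preserved. Hence the
  product of \<open>\<tau>\<close> along a walk from a root of the component is a well-defined
  potential.\<close>

lemma signed_hom_potential:
  fixes G :: "'a sgraph" and H :: "'c sgraph"
  assumes G: "signed_graph G" and H: "signed_graph H" and hom: "signed_hom G H f g"
  shows "\<exists>c. (\<forall>x. c x \<in> {-1, 1::int}) \<and>
    (\<forall>x y n s. wk snd G x y n s \<longrightarrow> wk snd H (f x) (f y) n (s * (c x * c y)))"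
proof -
  define \<tau> where "\<tau> = (\<lambda>e. snd e * snd (g e))"
  have g: "g e \<in> sedges H" "fst (g e) = f ` fst e" if "e \<in> sedges G" for e
    using hom that unfolding signed_hom_def by blast+
  have fv: "x \<in> verts G \<Longrightarrow> f x \<in> verts H" for x using hom unfolding signed_hom_def by blast
  have sg: "snd e \<in> {-1, 1}" "snd (g e) \<in> {-1, 1}" "\<tau> e \<in> {-1, 1}" if "e \<in> sedges G" for e
    using sedge_sign[OF G that] sedge_sign[OF H g(1)[OF that]] by (auto simp: \<tau>_def)
  have sgw: "s \<in> {-1, 1}" if "wk \<tau> G x y n s" for x y n s
    using wk_sign[OF that sg(3)] by blast
  have closed: "s = 1" if w: "wk \<tau> G x x n s" for x n s
  proof (rule ccontr)
    assume "s \<noteq> 1"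
    then have "wk \<tau> G x x n (-1)" using w sgw[OF w] by auto
    from negative_closed_walk_imp_negative_cycle[OF sg(3) this]
    obtain vs es where es: "cycle G vs es" "prod_list (map \<tau> es) = -1" by blast
    have "sign_of es = sign_of (map g es)" using hom es(1) unfolding signed_hom_def by blast
    moreover have "prod_list (map \<tau> es) = sign_of es * sign_of (map g es)"
      unfolding \<tau>_def prod_list_map_mult sign_of_def by (simp add: comp_def)
    moreover have "sign_of es \<in> {-1, 1}"
      using wk_snd_sign[OF G cycle_imp_wk[OF es(1)]] by (simp add: sign_of_def)
    ultimately show False using es(2) by auto
  qed
  define r where "r = (\<lambda>x. SOME r. \<exists>n s. wk \<tau> G r x n s)"
  define c where "c = (\<lambda>x. if x \<in> verts G then SOME s. \<exists>n. wk \<tau> G (r x) x n s else 1)"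
  have cw: "\<exists>n. wk \<tau> G (r x) x n (c x)" if "x \<in> verts G" for x
  proof -
    have "\<exists>n s. wk \<tau> G (r x) x n s"
      unfolding r_def by (rule someI_ex) (use wk.refl[OF that] in blast)
    then have "\<exists>s n. wk \<tau> G (r x) x n s" by blast
    from someI_ex[OF this] show ?thesis using that by (simp add: c_def)
  qed
  have cs: "c x \<in> {-1, 1}" for x
  proof (cases "x \<in> verts G")
    case True
    then show ?thesis using cw sgw by blast
  qed (simp add: c_def)
  have edge: "\<tau> e = c y * c z" if e: "e \<in> sedges G" "fst e = {y, z}" for e y z
  proof -
    have yz: "y \<in> verts G" "z \<in> verts G" using sedge_verts[OF G e(1)] e(2) by auto
    have w: "wk \<tau> G y z 1 (\<tau> e)" by (rule wk_edge[OF e yz])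
    \<comment> \<open>The choice in \<open>r\<close> depends only on the set of vertices that reach
      \<open>x\<close>, so adjacent vertices get the same root.\<close>
    have "(\<exists>n s. wk \<tau> G q y n s) \<longleftrightarrow> (\<exists>n s. wk \<tau> G q z n s)" for q
      using wk_trans[OF w, of q] wk_trans[OF wk_sym[OF w], of q] by blast
    then have rr: "r y = r z" unfolding r_def by simp
    obtain n m where "wk \<tau> G (r y) y n (c y)" "wk \<tau> G (r z) z m (c z)" using cw yz by blast
    then have "wk \<tau> G (r y) (r y) (n + 1 + m) (c y * \<tau> e * c z)"
      using wk_trans[OF wk_sym wk_trans[OF w]] rr by simp
    then have "c y * \<tau> e * c z = 1" by (rule closed)
    then show ?thesis using cs[of y] cs[of z] by auto
  qed
  have "wk snd H (f x) (f y) n (s * (c x * c y))" if "wk snd G x y n s" for x y n s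
    using that
  proof (induction rule: wk.induct)
    case (refl x)
    have "c x * c x = 1" using cs[of x] by auto
    then show ?case using wk.refl[OF fv[OF refl]] by simp
  next
    case (step x y n s e z)
    have "wk snd H (f x) (f z) (Suc n) (s * (c x * c y) * snd (g e))"
      by (rule wk.step[OF step.IH g(1)[OF step.hyps(2)]]) (use g(2) step.hyps fv in auto)
    moreover have "s * (c x * c y) * snd (g e) = s * snd e * (c x * c z)"
      using edge[OF step.hyps(2,3)] cs[of y] cs[of z] cs[of x] sg(1,2)[OF step.hyps(2)] by (auto simp: \<tau>_def)
    ultimately show ?case by simp
  qed
  then show ?thesis using cs by blast
qed

lemma wk_split:
  assumes "wk \<tau> G x z (m + n) s"
  shows "\<exists>y s1 s2. wk \<tau> G x y m s1 \<and> wk \<tau> G y z n s2 \<and> s = s1 * s2"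
  using assms
proof (induction n arbitrary: z s)
  case 0
  then show ?case using wk.refl[of z G \<tau>] wk_verts[OF 0] by (metis add.right_neutral mult.right_neutral)
next
  case (Suc n)
  from Suc.prems obtain y s' e where y: "wk \<tau> G x y (m + n) s'" "e \<in> sedges G" "fst e = {y, z}"
    "z \<in> verts G" "s = s' * \<tau> e" by (cases rule: wk.cases) auto
  from Suc.IH[OF y(1)] obtain w s1 s2 where "wk \<tau> G x w m s1" "wk \<tau> G w y n s2" "s' = s1 * s2" by blast
  then show ?case using wk.step[OF _ y(2,3,4), of \<tau> w n s2] y(5) by (metis mult.assoc)
qed

text \<open>Both signs are demanded: the two walks then close up to a negative walk of length
  \<open>2k\<close>, which leaves no room for shorter connections.\<close>

definition realizes ::
    "nat \<Rightarrow> 'b sgraph \<Rightarrow> 'v set \<Rightarrow> 'v set set \<Rightarrow> ('v \<Rightarrow> 'v \<Rightarrow> int) \<Rightarrow> ('v \<Rightarrow> 'b) \<Rightarrow> ('v \<Rightarrow> int) \<Rightarrow> bool" where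
  "realizes k B V E p f c \<longleftrightarrow> (\<forall>u\<in>V. f u \<in> verts B \<and> c u \<in> {-1, 1}) \<and>
    (\<forall>u v s. {u, v} \<in> E \<longrightarrow> s \<in> {-1, 1} \<longrightarrow>
       wk snd B (f u) (f v) (nat (signed_val k s (p u v))) (s * (c u * c v)))"

text \<open>A shortest walk from \<open>x\<close> to \<open>y\<close>, closed by the prescribed walk
  of the opposite sign, has total length at least \<open>2k\<close>; so it is as long as the
  prescribed walk of its own sign.\<close>

lemma realized_alg_dist:
  assumes B: "signed_graph B" "enat (2 * k) \<le> unbalanced_girth B"
    and m: "1 \<le> m" "m \<le> 2 * int k - 1" and \<sigma>: "\<sigma> \<in> {-1, 1}"
    and w: "\<And>s. s \<in> {-1, 1} \<Longrightarrow> wk snd B x y (nat (signed_val k s m)) (s * \<sigma>)"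
  shows "x \<noteq> y" "joined B x y" "\<bar>alg_dist B x y\<bar> \<le> int k" "pos_val k (alg_dist B x y) = signed_val k \<sigma> m"
proof -
  show xy: "x \<noteq> y"
  proof
    assume "x = y"
    then have "wk snd B x x (nat (signed_val k (- \<sigma>) m)) (-1)" using w[of "- \<sigma>"] \<sigma> by auto
    from girth_le_closed_walk[OF B this] show False using m \<sigma> by (auto simp: signed_val_def)
  qed
  show j: "joined B x y" using w[of 1] unfolding joined_iff_wk by auto
  obtain s where s: "s = 1 \<or> s = -1" "wk snd B x y (gdist B x y) s" "alg_dist B x y = s * int (gdist B x y)"
    using alg_dist_wk[OF B(1) j] .
  have pos: "gdist B x y > 0" using gdist_pos[OF j xy] .
  have le: "gdist B x y \<le> nat m" "gdist B x y \<le> nat (2 * int k - m)"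
    using gdist_le_wk[OF w[of 1]] gdist_le_wk[OF w[of "-1"]] by auto
  then show "\<bar>alg_dist B x y\<bar> \<le> int k" using s(1,3) by auto
  have "wk snd B x x (gdist B x y + nat (signed_val k (- s * \<sigma>) m)) (-1)"
    using wk_trans[OF wk_sym[OF w[of "- s * \<sigma>"]] s(2)] s(1) \<sigma> by auto
  from girth_le_closed_walk[OF B this]
  have "2 * k \<le> gdist B x y + nat (signed_val k (- s * \<sigma>) m)" .
  then have "int (gdist B x y) = signed_val k (s * \<sigma>) m" using le m s(1) \<sigma> by auto
  then show "pos_val k (alg_dist B x y) = signed_val k \<sigma> m"
    using s(1,3) \<sigma> pos m by (auto simp: pos_val_def)
qed

text \<open>In a tree a new vertex has only one prescribed distance. Its image is found by splitting
  a negative closed walk of length \<open>2k\<close> through the image of the neighbour; rotated,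
  this walk starts at the point of division, so the construction can go on from there.\<close>

lemma realizes_tree:
  fixes B :: "'b sgraph"
  assumes B: "signed_graph B" and w0: "wk snd B a0 a0 (2 * k) (-1)"
    and p: "antipodal_metric k V' p" and T: "t_tree 1 V E" "V \<subseteq> V'"
  shows "\<exists>f c. realizes k B V E p f c"
proof -
  define Z where "Z = {a. wk snd B a a (2 * k) (-1)}"
  have ext: "\<exists>b \<sigma>. b \<in> Z \<and> \<sigma> \<in> {-1, 1} \<and> wk snd B a b (nat m) \<sigma> \<and> wk snd B a b (nat (2 * int k - m)) (- \<sigma>)"
    if "a \<in> Z" "0 \<le> m" "m \<le> 2 * int k" for a m
  proof -
    have "nat m + nat (2 * int k - m) = 2 * k" using that by linarith
    then have "wk snd B a a (nat m + nat (2 * int k - m)) (-1)" using that by (simp add: Z_def)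
    from wk_split[OF this] obtain b s1 s2 where b: "wk snd B a b (nat m) s1"
      "wk snd B b a (nat (2 * int k - m)) s2" "-1 = s1 * s2" by blast
    have s: "s1 \<in> {-1, 1}" using wk_snd_sign[OF B b(1)] .
    then have s2: "s2 = - s1" using b(3) by auto
    have "wk snd B b b (2 * k) (-1)"
      using wk_trans[OF b(1,2)] b(3) \<open>nat m + nat (2 * int k - m) = 2 * k\<close> by (simp add: mult.commute add.commute)
    then show ?thesis using b(1) wk_sym[OF b(2)] s s2 by (auto simp: Z_def)
  qed
  have ZV: "a \<in> Z \<Longrightarrow> a \<in> verts B" for a using wk_verts unfolding Z_def by fast
  have "\<exists>f c. f ` V \<subseteq> Z \<and> realizes k B V E p f c"
    using T
  proof (induction rule: t_tree.induct)
    case (base V)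
    then obtain x y where V: "V = {x, y}" "x \<noteq> y" by (metis Suc_1 card_2_iff One_nat_def)
    then have xy: "x \<in> V'" "y \<in> V'" using base by auto
    have "a0 \<in> Z" using w0 by (simp add: Z_def)
    from ext[OF this antipodal_metricD(5,6)[OF p xy]] obtain b \<sigma> where
      b: "b \<in> Z" "\<sigma> \<in> {-1, 1}" "wk snd B a0 b (nat (p x y)) \<sigma>" "wk snd B a0 b (nat (2 * int k - p x y)) (- \<sigma>)" by blast
    have sym: "p y x = p x y" using antipodal_metricD(2)[OF p xy] by simp
    define f where "f = (\<lambda>u. if u = x then a0 else b)"
    define c where "c = (\<lambda>u. if u = x then 1 else \<sigma>)"
    have "wk snd B (f u) (f v) (nat (signed_val k s (p u v))) (s * (c u * c v))"
      if uv: "{u, v} \<in> {e. e \<subseteq> V \<and> card e = 2}" "s \<in> {-1, 1}" for u v s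
    proof -
      have "u = x \<and> v = y \<or> u = y \<and> v = x" using uv V by auto
      then show ?thesis using b wk_sym[OF b(3)] wk_sym[OF b(4)] V uv(2) sym
        by (auto simp: f_def c_def)
    qed
    moreover have "f ` V \<subseteq> Z" using \<open>a0 \<in> Z\<close> b by (auto simp: f_def)
    moreover have "c u \<in> {-1, 1}" for u using b by (auto simp: c_def)
    ultimately have "realizes k B V {e. e \<subseteq> V \<and> card e = 2} p f c"
      unfolding realizes_def using ZV by blast
    then show ?case using \<open>f ` V \<subseteq> Z\<close> by blast
  next
    case (step V E Q z)
    then obtain f c where f: "f ` V \<subseteq> Z" "realizes k B V E p f c" by auto
    obtain u where Q: "Q = {u}" using step.hyps(3) by (auto simp: card_1_singleton_iff)
    then have u: "u \<in> V" "u \<noteq> z" using step.hyps by auto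
    then have uz: "u \<in> V'" "z \<in> V'" using step.prems by auto
    have "f u \<in> Z" using f u by blast
    from ext[OF this antipodal_metricD(5,6)[OF p uz]] obtain b \<sigma> where
      b: "b \<in> Z" "\<sigma> \<in> {-1, 1}" "wk snd B (f u) b (nat (p u z)) \<sigma>"
        "wk snd B (f u) b (nat (2 * int k - p u z)) (- \<sigma>)" by blast
    have cu: "c u \<in> {-1, 1}" using f(2) u unfolding realizes_def by blast
    have sym: "p z u = p u z" using antipodal_metricD(2)[OF p uz] by simp
    define f' where "f' = f(z := b)"
    define c' where "c' = c(z := \<sigma> * c u)"
    have "wk snd B (f' v) (f' w) (nat (signed_val k s (p v w))) (s * (c' v * c' w))"
      if vw: "{v, w} \<in> E \<union> {{u, z} | u. u \<in> Q}" "s \<in> {-1, 1}" for v w s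
    proof (cases "{v, w} \<in> E")
      case True
      then have "v \<noteq> z" "w \<noteq> z" using t_tree_subset[OF step.hyps(1)] step.hyps(5) by auto
      moreover have "wk snd B (f v) (f w) (nat (signed_val k s (p v w))) (s * (c v * c w))"
        using True f(2) vw(2) unfolding realizes_def by blast
      ultimately show ?thesis by (simp add: f'_def c'_def)
    next
      case False
      then have "v = u \<and> w = z \<or> v = z \<and> w = u" using vw(1) Q by (auto simp: doubleton_eq_iff)
      moreover have "c u * (\<sigma> * c u) = \<sigma>" "\<sigma> * c u * c u = \<sigma>" using cu by auto
      ultimately show ?thesis using b wk_sym[OF b(3)] wk_sym[OF b(4)] u vw(2) sym
        by (auto simp: f'_def c'_def)
    qed
    moreover have "f' ` insert z V \<subseteq> Z" using f b by (auto simp: f'_def)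
    moreover have "c' v \<in> {-1, 1}" if "v \<in> insert z V" for v
      using that f(2) b cu unfolding realizes_def by (auto simp: c'_def)
    ultimately have "realizes k B (insert z V) (E \<union> {{u, z} | u. u \<in> Q}) p f' c'"
      unfolding realizes_def using ZV by blast
    then show ?case using \<open>f' ` insert z V \<subseteq> Z\<close> by blast
  qed
  then show ?thesis by blast
qed

section \<open>t-trees with antipodal metrics\<close>

record metric_tree =
  tverts :: "nat set"
  tedges :: "nat set set"
  tdist :: "nat \<Rightarrow> nat \<Rightarrow> int"

definition metric_t_tree :: "nat \<Rightarrow> nat \<Rightarrow> metric_tree \<Rightarrow> bool" where
  "metric_t_tree k t S \<longleftrightarrow> t_tree t (tverts S) (tedges S) \<and> antipodal_metric k (tverts S) (tdist S)"

definition extends :: "metric_tree \<Rightarrow> metric_tree \<Rightarrow> bool" where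
  "extends S S' \<longleftrightarrow> tverts S \<subseteq> tverts S' \<and> tedges S \<subseteq> tedges S' \<and>
     (\<forall>x\<in>tverts S. \<forall>y\<in>tverts S. tdist S' x y = tdist S x y)"

lemma extends_refl: "extends S S" by (simp add: extends_def)

lemma extends_trans: "extends S S' \<Longrightarrow> extends S' S'' \<Longrightarrow> extends S S''"
  by (auto simp: extends_def subset_iff)

lemma metric_t_tree_edge:
  assumes "metric_t_tree k t S" "{u, v} \<in> tedges S"
  shows "u \<in> tverts S" "v \<in> tverts S" "u \<noteq> v"
  using t_tree_subset assms unfolding metric_t_tree_def by fastforce+

lemma metric_t_tree_dist:
  assumes "metric_t_tree k t S" "{u, v} \<in> tedges S"
  shows "tdist S u v = tdist S v u" "1 \<le> tdist S u v" "tdist S u v \<le> 2 * int k - 1"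
proof -
  have "antipodal_metric k (tverts S) (tdist S)" using assms(1) by (simp add: metric_t_tree_def)
  from antipodal_metricD(2-4)[OF this metric_t_tree_edge(1,2)[OF assms]] metric_t_tree_edge(3)[OF assms]
  show "tdist S u v = tdist S v u" "1 \<le> tdist S u v" "tdist S u v \<le> 2 * int k - 1" by auto
qed

lemma clique_mono: "clique E Q \<Longrightarrow> E \<subseteq> E' \<Longrightarrow> clique E' Q"
  by (auto simp: clique_def)

text \<open>The new vertex is joined to all of \<open>Q\<close>, but its distances are prescribed
  only on \<open>Q0\<close>. This serves both uses: two prescribed distances for creating walks, all
  of them for saturation.\<close>

lemma add_vertex:
  assumes k: "k \<ge> 2" and S: "metric_t_tree k t S" and Q: "Q \<subseteq> tverts S" "card Q = t" "clique (tedges S) Q"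
    and Q0: "Q0 \<subseteq> Q" "Q0 \<noteq> {}" and z: "z \<notin> tverts S" and q: "antipodal_metric k (insert z Q0) q"
    and eq: "\<And>x y. x \<in> Q0 \<Longrightarrow> y \<in> Q0 \<Longrightarrow> q x y = tdist S x y"
  shows "\<exists>S'. metric_t_tree k t S' \<and> extends S S' \<and> z \<in> tverts S' \<and> (\<forall>u\<in>Q. {u, z} \<in> tedges S') \<and>
    (\<forall>u\<in>Q0. tdist S' u z = q z u)"
proof -
  have T: "t_tree t (tverts S) (tedges S)" "antipodal_metric k (tverts S) (tdist S)"
    using S by (auto simp: metric_t_tree_def)
  have "finite Q0" using t_tree_finite[OF T(1)] Q Q0 by (meson finite_subset)
  then obtain p' where p': "antipodal_metric k (insert z (tverts S)) p'"
    "\<forall>x\<in>tverts S. \<forall>y\<in>tverts S. p' x y = tdist S x y" "\<forall>u\<in>Q0. p' z u = q z u \<and> p' u z = q z u"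
    using antipodal_metric_extend[OF k T(2) z _ _ Q0(2) q eq] Q Q0 by auto
  have "\<forall>u\<in>Q. \<forall>u'\<in>Q. u \<noteq> u' \<longrightarrow> {u, u'} \<in> tedges S" using Q(3) by (simp add: clique_def)
  from t_tree.step[OF T(1) Q(1,2) this z] have
    "t_tree t (insert z (tverts S)) (tedges S \<union> {{u, z} | u. u \<in> Q})" .
  then show ?thesis using p'
    by (intro exI[of _ "\<lparr>tverts = insert z (tverts S), tedges = tedges S \<union> {{u, z} | u. u \<in> Q}, tdist = p'\<rparr>"])
      (auto simp: metric_t_tree_def extends_def)
qed

section \<open>Signed graphs of unit distances\<close>

text \<open>Edges are the pairs with lifts at distance 1 on the double cover; for a negative edge
  this means distance \<open>2k - 1\<close> in \<open>tdist S\<close>.\<close>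

definition unit_graph :: "nat \<Rightarrow> metric_tree \<Rightarrow> nat sgraph" where
  "unit_graph k S = \<lparr>verts = tverts S, sedges = {({u, v}, s) | u v s.
     {u, v} \<in> tedges S \<and> s \<in> {-1, 1} \<and> tdist S u v = signed_val k s 1}\<rparr>"

lemma unit_graph_edgeI:
  "{u, v} \<in> tedges S \<Longrightarrow> s \<in> {-1, 1} \<Longrightarrow> tdist S u v = signed_val k s 1 \<Longrightarrow>
    ({u, v}, s) \<in> sedges (unit_graph k S)"
  unfolding unit_graph_def by auto

lemma unit_graph_edge:
  assumes S: "metric_t_tree k t S" and e: "({u, v}, s) \<in> sedges (unit_graph k S)"
  shows "{u, v} \<in> tedges S" "s \<in> {-1, 1}" "tdist S u v = signed_val k s 1"
proof -
  obtain u' v' where uv: "{u, v} = {u', v'}" "{u', v'} \<in> tedges S" "s \<in> {-1, 1}" "tdist S u' v' = signed_val k s 1"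
    using e by (auto simp: unit_graph_def)
  then show "{u, v} \<in> tedges S" "s \<in> {-1, 1}" by auto
  have "tdist S u' v' = tdist S v' u'"
    using metric_t_tree_dist(1)[OF S uv(2)] .
  then show "tdist S u v = signed_val k s 1" using uv by (auto simp: doubleton_eq_iff)
qed

lemma signed_graph_unit_graph:
  assumes S: "metric_t_tree k t S"
  shows "signed_graph (unit_graph k S)"
proof -
  have "finite (tverts S)" using S t_tree_finite by (auto simp: metric_t_tree_def)
  moreover have "e \<subseteq> tverts S \<and> card e = 2 \<and> s \<in> {-1, 1}" if "(e, s) \<in> sedges (unit_graph k S)" for e s
  proof -
    have "\<exists>u v. e = {u, v}" using that by (auto simp: unit_graph_def)
    then obtain u v where e: "e = {u, v}" by blast
    note d = unit_graph_edge[OF S that[unfolded e]]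
    show ?thesis using d(2) metric_t_tree_edge[OF S d(1)] e by auto
  qed
  moreover have "verts (unit_graph k S) = tverts S" by (simp add: unit_graph_def)
  ultimately show ?thesis unfolding signed_graph_def by auto
qed

text \<open>The signed triangle inequality adds up along a walk; for \<open>x = y\<close> and sign
  -1 this bounds the girth from below by \<open>2k\<close>.\<close>

lemma unit_graph_wk_ge:
  assumes S: "metric_t_tree k t S" and w: "wk snd (unit_graph k S) x y n s"
  shows "signed_val k s (tdist S x y) \<le> int n"
  using w
proof (induction rule: wk.induct)
  case (refl x)
  then show ?case using S antipodal_metricD(1)[of k "tverts S" "tdist S" x x]
    by (auto simp: unit_graph_def metric_t_tree_def)
next
  case (step x y n s e z)
  have m: "antipodal_metric k (tverts S) (tdist S)" using S by (simp add: metric_t_tree_def)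
  have v: "verts (unit_graph k S) = tverts S" by (simp add: unit_graph_def)
  obtain s' where e: "e = ({y, z}, s')" using step.hyps(3) by (cases e) auto
  have s': "s' \<in> {-1, 1}" "tdist S y z = signed_val k s' 1"
    using unit_graph_edge[OF S] step.hyps(2) e by auto
  have s: "s \<in> {-1, 1}" using wk_snd_sign[OF signed_graph_unit_graph[OF S] step.hyps(1)] .
  have "x \<in> tverts S" "y \<in> tverts S" using wk_verts[OF step.hyps(1)] v by auto
  from antipodal_metric_signed_triangle[OF m this _ s s'(1), of z] step.hyps(4) v
  have "signed_val k (s * s') (tdist S x z) \<le> signed_val k s (tdist S x y) + signed_val k s' (tdist S y z)" by simp
  moreover have "signed_val k s' (tdist S y z) = 1" using s' by (auto simp: signed_val_def)
  ultimately show ?case using step.IH e by simp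
qed

lemma unit_graph_SBPT:
  assumes k: "k \<ge> 2" and S: "metric_t_tree k t S"
  shows "unit_graph k S \<in> SBPT t k"
proof -
  let ?G = "unit_graph k S"
  have T: "t_tree t (tverts S) (tedges S)" "antipodal_metric k (tverts S) (tdist S)"
    using S by (auto simp: metric_t_tree_def)
  have v: "verts ?G = tverts S" by (simp add: unit_graph_def)
  have sg: "signed_graph ?G" by (rule signed_graph_unit_graph[OF S])
  have E: "edges_of ?G \<subseteq> tedges S" by (auto simp: edges_of_def unit_graph_def)
  have "inj_on fst (sedges ?G)"
  proof (rule inj_onI)
    fix e e' assume e: "e \<in> sedges ?G" "e' \<in> sedges ?G" "fst e = fst e'"
    obtain u v s where "e = ({u, v}, s)" using e(1) by (auto simp: unit_graph_def)
    moreover then obtain s' where "e' = ({u, v}, s')" using e(3) by (cases e') auto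
    \<comment> \<open>As \<open>k \<ge> 2\<close>, the distances 1 and \<open>2k - 1\<close> differ,
      so the ends of an edge determine its sign.\<close>
    ultimately show "e = e'"
      using unit_graph_edge(2,3)[OF S, of u v s] unit_graph_edge(2,3)[OF S, of u v s'] e k by auto
  qed
  moreover have "\<forall>e\<in>edges_of ?G. card e = 2" using E t_tree_subset[OF T(1)] by blast
  ultimately have simple: "simple_graph ?G" by (simp add: simple_graph_def)
  have bip: "bipartite ?G"
  proof (cases "tverts S = {}")
    case True
    then have "edges_of ?G = {}" using E t_tree_subset[OF T(1)] by auto
    then show ?thesis using True v by (auto simp: bipartite_def)
  next
    case False
    then obtain u0 where u0: "u0 \<in> tverts S" by blast
    let ?X = "{x \<in> tverts S. even (tdist S u0 x)}" and ?Y = "{x \<in> tverts S. odd (tdist S u0 x)}"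
    have "\<exists>x\<in>?X. \<exists>y\<in>?Y. e = {x, y}" if e: "e \<in> edges_of ?G" for e
    proof -
      obtain s where es: "(e, s) \<in> sedges ?G" using e by (auto simp: edges_of_def)
      then obtain u w where uw: "e = {u, w}" by (auto simp: unit_graph_def)
      note d = unit_graph_edge[OF S es[unfolded uw]]
      note V = metric_t_tree_edge[OF S d(1)]
      have "odd (tdist S u w)" using d by (auto simp: signed_val_def)
      moreover have "even (tdist S u0 u + tdist S u w + tdist S u0 w)"
        using antipodal_metric_triangle(3)[OF T(2) u0 V(1,2)] .
      ultimately have "u \<in> ?X \<and> w \<in> ?Y \<or> u \<in> ?Y \<and> w \<in> ?X" using V by auto
      then show ?thesis using uw by (auto simp: insert_commute)
    qed
    then show ?thesis unfolding bipartite_def v by (intro exI[of _ ?X] exI[of _ ?Y]) auto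
  qed
  have "enat (2 * k) \<le> unbalanced_girth ?G"
  proof (rule girth_geI)
    fix vs es assume c: "cycle ?G vs es" "sign_of es = -1"
    have "wk snd ?G (hd vs) (hd vs) (length es) (-1)"
      using cycle_imp_wk[OF c(1), of snd] c(2) by (simp add: sign_of_def)
    from unit_graph_wk_ge[OF S this] wk_verts[OF this] v
    show "2 * k \<le> length es" using antipodal_metricD(1)[OF T(2), of "hd vs" "hd vs"] by simp
  qed
  moreover have "partial_t_tree t (verts ?G) (edges_of ?G)" unfolding partial_t_tree_def v using T E by blast
  ultimately show ?thesis using sg simple bip by (simp add: SBPT_def)
qed

lemma unit_graph_mono:
  assumes S: "metric_t_tree k t S" and "extends S S'"
  shows "verts (unit_graph k S) \<subseteq> verts (unit_graph k S')" "sedges (unit_graph k S) \<subseteq> sedges (unit_graph k S')"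
proof -
  show "verts (unit_graph k S) \<subseteq> verts (unit_graph k S')" using assms by (simp add: unit_graph_def extends_def)
  show "sedges (unit_graph k S) \<subseteq> sedges (unit_graph k S')"
  proof
    fix e assume "e \<in> sedges (unit_graph k S)"
    then obtain u v s where e: "e = ({u, v}, s)" "{u, v} \<in> tedges S" "s \<in> {-1, 1}" "tdist S u v = signed_val k s 1"
      by (auto simp: unit_graph_def)
    then have "{u, v} \<in> tedges S'" "tdist S' u v = signed_val k s 1"
      using assms metric_t_tree_edge[OF S e(2)] by (auto simp: extends_def)
    then show "e \<in> sedges (unit_graph k S')" using e unit_graph_edgeI by blast
  qed
qed

lemma t_tree_edge_clique:
  assumes "t_tree t V E" "e \<in> E"
  shows "\<exists>C\<subseteq>V. card C = Suc t \<and> clique E C \<and> e \<subseteq> C"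
  using assms
proof (induction rule: t_tree.induct)
  case (base V)
  then show ?case by (intro exI[of _ V]) (auto simp: clique_def)
next
  case (step V E Q z)
  let ?E = "E \<union> {{u, z} | u. u \<in> Q}"
  show ?case
  proof (cases "e \<in> E")
    case True
    then obtain C where "C \<subseteq> V" "card C = Suc t" "clique E C" "e \<subseteq> C" using step.IH by blast
    then show ?thesis using clique_mono[of E C ?E] by (intro exI[of _ C]) auto
  next
    case False
    then have "e \<subseteq> insert z Q" using step.prems by blast
    moreover have "clique ?E (insert z Q)"
      using step.hyps(4) by (auto simp: clique_def insert_commute)
    moreover have "card (insert z Q) = Suc t"
      using step.hyps t_tree_finite[OF step.hyps(1)] finite_subset[of Q V] by (auto simp: card_insert_if)
    ultimately show ?thesis using step.hyps(2) by (intro exI[of _ "insert z Q"]) auto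
  qed
qed

text \<open>A walk of prescribed length and sign between adjacent vertices \<open>u\<close>, \<open>v\<close> is created by attaching a
  vertex at distance \<open>1\<close> from \<open>u\<close> and one step closer to \<open>v\<close>. The clique to which it is attached has to contain
  \<open>u\<close> and \<open>v\<close>, whence \<open>t \<ge> 2\<close>.\<close>

lemma realize_walk:
  assumes k: "k \<ge> 2" and t: "t \<ge> 2" and s: "s \<in> {-1, 1}"
    and "metric_t_tree k t S" "{u, v} \<in> tedges S" "signed_val k s (tdist S u v) = int n"
  shows "\<exists>S'. metric_t_tree k t S' \<and> extends S S' \<and> wk snd (unit_graph k S') u v n s"
  using assms(4-6)
proof (induction n arbitrary: S u)
  case 0
  have "1 \<le> tdist S u v" "tdist S u v \<le> 2 * int k - 1"
    using metric_t_tree_dist(2,3)[OF 0(1,2)] .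
  then show ?case using 0(3) s by auto
next
  case (Suc n)
  note uv = metric_t_tree_edge[OF Suc.prems(1,2)]
  have T: "t_tree t (tverts S) (tedges S)" "antipodal_metric k (tverts S) (tdist S)"
    using Suc.prems(1) by (auto simp: metric_t_tree_def)
  have bd: "1 \<le> tdist S u v" "tdist S u v \<le> 2 * int k - 1" using metric_t_tree_dist(2,3)[OF Suc.prems(1,2)] .
  have d: "tdist S u v = signed_val k s (int (Suc n))" using Suc.prems(3) s by (auto simp: signed_val_def)
  show ?case
  proof (cases "n = 0")
    case True
    have "({u, v}, s) \<in> sedges (unit_graph k S)"
      by (rule unit_graph_edgeI) (use Suc.prems(2) s d True in auto)
    from wk_edge[OF this, of u v snd] have "wk snd (unit_graph k S) u v (Suc n) s"
      using uv True by (simp add: unit_graph_def)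
    then show ?thesis using Suc.prems(1) extends_refl by blast
  next
    case False
    obtain C where C: "C \<subseteq> tverts S" "card C = Suc t" "clique (tedges S) C" "{u, v} \<subseteq> C"
      using t_tree_edge_clique[OF T(1) Suc.prems(2)] by blast
    have "finite C" using C(2) by (metis card.infinite nat.distinct(1))
    then obtain Q where Q: "{u, v} \<subseteq> Q" "Q \<subseteq> C" "card Q = t"
      using exists_subset_between[of "{u, v}" t C] C uv(3) t by auto
    have Qc: "clique (tedges S) Q" "Q \<subseteq> tverts S" using C Q by (auto simp: clique_def)
    obtain z where z: "z \<notin> tverts S" using ex_new_if_finite[OF infinite_UNIV_nat t_tree_finite[OF T(1)]] by blast
    define m where "m = signed_val k s (int n)"
    \<comment> \<open>On the triangle \<open>u\<close>, \<open>v\<close>, \<open>z\<close> one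
      positive step leads from \<open>u\<close> to \<open>z\<close>, and a connection of length
      \<open>n\<close> and sign \<open>s\<close> remains from \<open>z\<close> to
      \<open>v\<close>.\<close>
    define q where "q = (\<lambda>x y. if x = y then 0 else if x \<noteq> z \<and> y \<noteq> z then tdist S u v
      else if x = u \<or> y = u then 1 else m)"
    have zuv: "z \<noteq> u" "z \<noteq> v" using z uv by auto
    have m: "1 \<le> m" "m \<le> 2 * int k - 1" "m \<le> 1 + tdist S u v" "tdist S u v \<le> 1 + m" "1 \<le> tdist S u v + m"
      "m + 1 + tdist S u v \<le> 4 * int k" "even (m + 1 + tdist S u v)"
      using bd d False s unfolding m_def by (auto simp: signed_val_def)
    have q: "antipodal_metric k (insert z {u, v}) q"
    proof (rule antipodal_metricI)
      show "k \<ge> 1" using k by simp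
      show "q x x = 0" for x by (simp add: q_def)
      show "q x y = q y x \<and> 1 \<le> q x y \<and> q x y \<le> 2 * int k - 1"
        if "x \<in> insert z {u, v}" "y \<in> insert z {u, v}" "x \<noteq> y" for x y
        using that bd m k unfolding q_def by auto
      fix x y w assume *: "x \<in> insert z {u, v}" "y \<in> insert z {u, v}" "w \<in> insert z {u, v}" "x \<noteq> y" "y \<noteq> w" "x \<noteq> w"
      have v: "q z u = 1" "q u z = 1" "q z v = m" "q v z = m" "q u v = tdist S u v" "q v u = tdist S u v"
        using zuv uv by (auto simp: q_def)
      have "x = z \<and> y = u \<and> w = v \<or> x = z \<and> y = v \<and> w = u \<or> x = u \<and> y = z \<and> w = v \<or> x = u \<and> y = v \<and> w = z \<or>
        x = v \<and> y = z \<and> w = u \<or> x = v \<and> y = u \<and> w = z" using * by auto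
      then show "q x w \<le> q x y + q y w \<and> q x y + q y w + q x w \<le> 4 * int k \<and> even (q x y + q y w + q x w)"
        using m by (elim disjE conjE) (simp_all add: v add_ac)
    qed
    have eq: "q x y = tdist S x y" if "x \<in> {u, v}" "y \<in> {u, v}" for x y
      using that uv zuv antipodal_metricD(1,2)[OF T(2)] by (auto simp: q_def)
    obtain S1 where S1: "metric_t_tree k t S1" "extends S S1" "z \<in> tverts S1" "\<forall>w\<in>Q. {w, z} \<in> tedges S1"
      "\<forall>w\<in>{u, v}. tdist S1 w z = q z w"
      using add_vertex[OF k Suc.prems(1) Qc(2) Q(3) Qc(1) Q(1) _ z q eq] by auto
    have "{z, v} \<in> tedges S1" using S1(4) Q(1) by (auto simp: insert_commute)
    moreover have zv: "tdist S1 z v = m"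
      using S1(5) zuv uv metric_t_tree_dist(1)[OF S1(1) \<open>{z, v} \<in> tedges S1\<close>] by (simp add: q_def)
    moreover have "signed_val k s (tdist S1 z v) = int n" using zv s by (auto simp: m_def signed_val_def)
    ultimately obtain S2 where S2: "metric_t_tree k t S2" "extends S1 S2" "wk snd (unit_graph k S2) z v n s"
      using Suc.IH[OF S1(1)] by blast
    have "({u, z}, 1) \<in> sedges (unit_graph k S1)"
      by (rule unit_graph_edgeI) (use S1(4,5) Q(1) zuv in \<open>auto simp: q_def\<close>)
    then have e: "({u, z}, 1) \<in> sedges (unit_graph k S2)" using unit_graph_mono[OF S1(1) S2(2)] by blast
    have "fst ({u, z}, 1::int) \<subseteq> verts (unit_graph k S2)"
      by (rule sedge_verts[OF signed_graph_unit_graph[OF S2(1)] e])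
    then have "wk snd (unit_graph k S2) u z 1 1" using wk_edge[OF e, of u z snd] by simp
    from wk_trans[OF S2(3) this] have "wk snd (unit_graph k S2) u v (Suc n) s" by simp
    then show ?thesis using S2 extends_trans[OF S1(2) S2(2)] by blast
  qed
qed

lemma extend_all:
  assumes "finite R" "metric_t_tree k t S"
    and step: "\<And>r S'. r \<in> R \<Longrightarrow> metric_t_tree k t S' \<Longrightarrow> extends S S' \<Longrightarrow>
      \<exists>S''. metric_t_tree k t S'' \<and> extends S' S'' \<and> P r S''"
    and mono: "\<And>r S' S''. metric_t_tree k t S' \<Longrightarrow> extends S' S'' \<Longrightarrow> P r S' \<Longrightarrow> P r S''"
  shows "\<exists>S'. metric_t_tree k t S' \<and> extends S S' \<and> (\<forall>r\<in>R. P r S')"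
  using assms(1) step
proof (induction R rule: finite_induct)
  case empty
  then show ?case using assms(2) extends_refl by blast
next
  case (insert r R)
  then obtain S1 where S1: "metric_t_tree k t S1" "extends S S1" "\<forall>r\<in>R. P r S1" by auto
  obtain S2 where S2: "metric_t_tree k t S2" "extends S1 S2" "P r S2"
    using insert.prems[OF _ S1(1,2), of r] by auto
  have "\<forall>r\<in>R. P r S2" using mono[OF S1(1) S2(2)] S1(3) by blast
  then show ?case using S2 extends_trans[OF S1(2) S2(2)] by blast
qed

text \<open>The unit graph of \<open>S\<close> may have no edges at all. Therefore walks for all
  edges of \<open>S\<close> are created in a larger t-tree \<open>S'\<close>, and the homomorphism
  is taken on the unit graph of \<open>S'\<close>.\<close>

lemma realizes_bounded:
  fixes B :: "'b sgraph"
  assumes k: "k \<ge> 2" and t: "t \<ge> 2" and B: "signed_graph B" "bounds B (SBPT t k)"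
    and S: "metric_t_tree k t S"
  shows "\<exists>f c. realizes k B (tverts S) (tedges S) (tdist S) f c"
proof -
  define R where "R = {(u, v, s). {u, v} \<in> tedges S \<and> s \<in> {-1, 1::int}}"
  define P where "P = (\<lambda>(u, v, s) S'. wk snd (unit_graph k S') u v (nat (signed_val k s (tdist S u v))) s)"
  have T: "t_tree t (tverts S) (tedges S)" "antipodal_metric k (tverts S) (tdist S)"
    using S by (auto simp: metric_t_tree_def)
  have "R \<subseteq> tverts S \<times> tverts S \<times> {-1, 1}" using metric_t_tree_edge[OF S] by (auto simp: R_def)
  then have finR: "finite R" by (rule finite_subset) (use t_tree_finite[OF T(1)] in auto)
  have "\<exists>S'. metric_t_tree k t S' \<and> extends S S' \<and> (\<forall>r\<in>R. P r S')"
  proof (rule extend_all[OF finR S])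
    fix r S' assume r: "r \<in> R" and S': "metric_t_tree k t S'" "extends S S'"
    obtain u v s where uvs: "r = (u, v, s)" "{u, v} \<in> tedges S" "s \<in> {-1, 1}" using r by (auto simp: R_def)
    note uv = metric_t_tree_edge[OF S uvs(2)]
    have "tdist S' u v = tdist S u v" "{u, v} \<in> tedges S'" using S'(2) uvs uv by (auto simp: extends_def)
    moreover have "0 \<le> signed_val k s (tdist S u v)"
      using antipodal_metricD(5,6)[OF T(2) uv(1,2)] by (auto simp: signed_val_def)
    ultimately show "\<exists>S''. metric_t_tree k t S'' \<and> extends S' S'' \<and> P r S''"
      using realize_walk[OF k t uvs(3) S'(1), of u v] uvs(1) by (simp add: P_def)
  next
    fix r S' S'' assume "metric_t_tree k t S'" "extends S' S''" "P r S'"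
    then show "P r S''" using wk_subgraph unit_graph_mono by (fastforce simp: P_def)
  qed
  then obtain S' where S': "metric_t_tree k t S'" "extends S S'" "\<forall>r\<in>R. P r S'" by blast
  obtain f g where hom: "signed_hom (unit_graph k S') B f g"
    using B(2) unit_graph_SBPT[OF k S'(1)] unfolding bounds_def by blast
  obtain c where c: "\<forall>x. c x \<in> {-1, 1::int}"
    "\<forall>x y n s. wk snd (unit_graph k S') x y n s \<longrightarrow> wk snd B (f x) (f y) n (s * (c x * c y))"
    using signed_hom_potential[OF signed_graph_unit_graph[OF S'(1)] B(1) hom] by blast
  have "f u \<in> verts B" if "u \<in> tverts S" for u
  proof -
    have "u \<in> verts (unit_graph k S')" using that S'(2) by (auto simp: unit_graph_def extends_def)
    then show ?thesis using hom unfolding signed_hom_def by blast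
  qed
  moreover have "wk snd B (f u) (f v) (nat (signed_val k s (tdist S u v))) (s * (c u * c v))"
    if "{u, v} \<in> tedges S" "s \<in> {-1, 1}" for u v s
  proof -
    have "P (u, v, s) S'" using S'(3) that by (simp add: R_def)
    then show ?thesis using c(2) by (simp add: P_def)
  qed
  ultimately have "realizes k B (tverts S) (tedges S) (tdist S) f c" using c(1) unfolding realizes_def by blast
  then show ?thesis by blast
qed

section \<open>Saturated extensions\<close>

text \<open>\<open>z0\<close> is a placeholder for the vertex to be added; \<open>z\<close> is the
  vertex of \<open>S'\<close> that has the distances prescribed for it.\<close>

definition saturates :: "nat \<Rightarrow> nat \<Rightarrow> metric_tree \<Rightarrow> metric_tree \<Rightarrow> bool" where
  "saturates k t S S' \<longleftrightarrow> (\<forall>Q q z0. Q \<subseteq> tverts S \<and> card Q = t \<and> clique (tedges S) Q \<and> z0 \<notin> Q \<and>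
     antipodal_metric k (insert z0 Q) q \<and> (\<forall>x\<in>Q. \<forall>y\<in>Q. q x y = tdist S x y) \<longrightarrow>
     (\<exists>z\<in>tverts S'. z \<notin> Q \<and> (\<forall>u\<in>Q. {u, z} \<in> tedges S' \<and> tdist S' u z = q z0 u)))"

lemma saturate:
  assumes k: "k \<ge> 2" and t: "t \<ge> 1" and S: "metric_t_tree k t S"
  shows "\<exists>S'. metric_t_tree k t S' \<and> extends S S' \<and> saturates k t S S'"
proof -
  define ok where "ok = (\<lambda>Q q z0. Q \<subseteq> tverts S \<and> card Q = t \<and> clique (tedges S) Q \<and> z0 \<notin> Q \<and>
     antipodal_metric k (insert z0 Q) q \<and> (\<forall>x\<in>Q. \<forall>y\<in>Q. q x y = tdist S x y))"
  \<comment> \<open>Only the distances from \<open>z0\<close> to \<open>Q\<close> matter. Made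
    extensional by \<open>restrict\<close> and bounded by \<open>2k - 1\<close>, they leave finitely
    many requirements.\<close>
  define R where "R = {(Q, restrict (q z0) Q) | Q q z0. ok Q q (z0::nat)}"
  define P where "P = (\<lambda>(Q, a) (S' :: metric_tree). \<exists>z\<in>tverts S'. z \<notin> Q \<and> (\<forall>u\<in>Q. {u, z} \<in> tedges S' \<and> tdist S' u z = (a u :: int)))"
  have T: "t_tree t (tverts S) (tedges S)" "antipodal_metric k (tverts S) (tdist S)"
    using S by (auto simp: metric_t_tree_def)
  have fin: "finite (tverts S)" using t_tree_finite[OF T(1)] .
  have "R \<subseteq> (SIGMA Q:Pow (tverts S). Q \<rightarrow>\<^sub>E {1..2 * int k - 1})"
  proof
    fix r assume "r \<in> R"
    then obtain Q q z0 where r: "r = (Q, restrict (q z0) Q)" "ok Q q z0" unfolding R_def by blast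
    have "1 \<le> q z0 u \<and> q z0 u \<le> 2 * int k - 1" if "u \<in> Q" for u
      using antipodal_metricD(3,4)[of k "insert z0 Q" q z0 u] r(2) that unfolding ok_def by auto
    then show "r \<in> (SIGMA Q:Pow (tverts S). Q \<rightarrow>\<^sub>E {1..2 * int k - 1})" using r by (auto simp: ok_def)
  qed
  moreover have "finite (SIGMA Q:Pow (tverts S). Q \<rightarrow>\<^sub>E {1..2 * int k - 1})"
    using fin finite_subset[OF _ fin] by (intro finite_SigmaI finite_PiE) auto
  ultimately have finR: "finite R" by (rule finite_subset)
  have "\<exists>S'. metric_t_tree k t S' \<and> extends S S' \<and> (\<forall>r\<in>R. P r S')"
  proof (rule extend_all[OF finR S])
    fix r S' assume "r \<in> R" and S': "metric_t_tree k t S'" "extends S S'"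
    then obtain Q q z0 where r: "r = (Q, restrict (q z0) Q)" "ok Q q z0" unfolding R_def by blast
    have Q: "Q \<subseteq> tverts S" "card Q = t" "clique (tedges S) Q" "z0 \<notin> Q" "antipodal_metric k (insert z0 Q) q"
      "\<forall>x\<in>Q. \<forall>y\<in>Q. q x y = tdist S x y" using r(2) by (auto simp: ok_def)
    have Q': "Q \<subseteq> tverts S'" "clique (tedges S') Q" using Q S'(2) clique_mono by (auto simp: extends_def)
    have ne: "Q \<noteq> {}" using Q(2) t by auto
    obtain z where z: "z \<notin> tverts S'"
      using ex_new_if_finite[OF infinite_UNIV_nat t_tree_finite] S'(1) unfolding metric_t_tree_def by blast
    \<comment> \<open>The new vertex \<open>z\<close> stands in for the placeholder
      \<open>z0\<close>, which may be an old vertex outside \<open>Q\<close>.\<close>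
    define \<beta> where "\<beta> = (\<lambda>x. if x = z then z0 else x)"
    have zQ: "z \<notin> Q" using z Q'(1) by blast
    have "antipodal_metric k (insert z Q) (\<lambda>x y. q (\<beta> x) (\<beta> y))"
      by (rule antipodal_metric_pullback[OF Q(5)]) (use Q(4) in \<open>auto simp: \<beta>_def inj_on_def\<close>)
    moreover have "q (\<beta> x) (\<beta> y) = tdist S' x y" if "x \<in> Q" "y \<in> Q" for x y
      using that zQ Q(1,6) S'(2) by (auto simp: \<beta>_def extends_def subset_iff)
    ultimately obtain S'' where S'': "metric_t_tree k t S''" "extends S' S''" "z \<in> tverts S''"
      "\<forall>u\<in>Q. {u, z} \<in> tedges S''" "\<forall>u\<in>Q. tdist S'' u z = q (\<beta> z) (\<beta> u)"
      using add_vertex[OF k S'(1) Q'(1) Q(2) Q'(2) order_refl ne z] by blast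
    have "tdist S'' u z = q z0 u" if "u \<in> Q" for u using S''(5) that zQ by (auto simp: \<beta>_def)
    then have "P r S''" unfolding P_def r(1) using S''(3,4) zQ by auto
    then show "\<exists>S''. metric_t_tree k t S'' \<and> extends S' S'' \<and> P r S''" using S'' by blast
  next
    fix r S' S'' assume S': "metric_t_tree k t S'" and ext: "extends S' S''" and P: "P r S'"
    obtain Q a where r: "r = (Q, a)" by (cases r)
    then obtain z where z: "z \<in> tverts S'" "z \<notin> Q" "\<forall>u\<in>Q. {u, z} \<in> tedges S' \<and> tdist S' u z = a u"
      using P by (auto simp: P_def)
    have "{u, z} \<in> tedges S'' \<and> tdist S'' u z = a u" if "u \<in> Q" for u
      using z(3) that ext metric_t_tree_edge(1)[OF S', of u z] z(1) by (auto simp: extends_def)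
    then show "P r S''" using r z(1,2) ext by (auto simp: P_def extends_def)
  qed
  then obtain S' where S': "metric_t_tree k t S'" "extends S S'" "\<forall>r\<in>R. P r S'" by blast
  have "saturates k t S S'"
    unfolding saturates_def
  proof (intro allI impI)
    fix Q q z0 assume "Q \<subseteq> tverts S \<and> card Q = t \<and> clique (tedges S) Q \<and> z0 \<notin> Q \<and>
     antipodal_metric k (insert z0 Q) q \<and> (\<forall>x\<in>Q. \<forall>y\<in>Q. q x y = tdist S x y)"
    then have "(Q, restrict (q z0) Q) \<in> R" unfolding R_def ok_def by blast
    then have "P (Q, restrict (q z0) Q) S'" using S'(3) by blast
    then show "\<exists>z\<in>tverts S'. z \<notin> Q \<and> (\<forall>u\<in>Q. {u, z} \<in> tedges S' \<and> tdist S' u z = q z0 u)"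
      by (auto simp: P_def)
  qed
  then show ?thesis using S' by blast
qed

section \<open>Closed sets of cliques from homomorphisms\<close>

lemma Suc_le_card_if_strict:
  assumes "\<And>i. i < N \<Longrightarrow> A i \<subset> A (Suc i)" "finite (A N)"
  shows "N \<le> card (A N)"
  using assms
proof (induction N)
  case (Suc N)
  have "A N \<subset> A (Suc N)" using Suc.prems(1) by blast
  then have "card (A N) < card (A (Suc N))" using Suc.prems(2) by (rule psubset_card_mono[rotated])
  moreover have "N \<le> card (A N)"
    using Suc.IH Suc.prems \<open>A N \<subset> A (Suc N)\<close> finite_subset by (metis less_SucI psubset_imp_subset)
  ultimately show ?case by linarith
qed simp

text \<open>The largest partial distance graph with weights of absolute value at most
  \<open>k\<close>.\<close>

definition short_distance_graph :: "nat \<Rightarrow> 'b sgraph \<Rightarrow> 'b wgraph" where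
  "short_distance_graph k B = \<lparr>wverts = verts B,
     wedges = {{x, y} | x y. x \<in> verts B \<and> y \<in> verts B \<and> x \<noteq> y \<and> joined B x y \<and> \<bar>alg_dist B x y\<bar> \<le> int k},
     wt = alg_dist B\<rparr>"

lemma short_distance_graph:
  assumes "signed_graph B"
  shows "partial_distance_graph B (short_distance_graph k B)" "weights_upto k (short_distance_graph k B)"
proof -
  show "partial_distance_graph B (short_distance_graph k B)"
    by (auto simp: partial_distance_graph_def short_distance_graph_def distance_graph_def)
  show "weights_upto k (short_distance_graph k B)"
    unfolding weights_upto_def
  proof (intro allI impI)
    fix u v assume "{u, v} \<in> wedges (short_distance_graph k B)"
    then obtain x y where xy: "{u, v} = {x, y}" "x \<noteq> y" "joined B x y" "\<bar>alg_dist B x y\<bar> \<le> int k"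
      by (auto simp: short_distance_graph_def)
    have "1 \<le> \<bar>alg_dist B x y\<bar>" using gdist_pos[OF xy(3,2)] by (auto simp: alg_dist_def)
    then show "1 \<le> \<bar>wt (short_distance_graph k B) u v\<bar> \<and> \<bar>wt (short_distance_graph k B) u v\<bar> \<le> int k"
      using xy alg_dist_commute[of B] by (auto simp: short_distance_graph_def doubleton_eq_iff)
  qed
qed

lemma saturated_chain:
  assumes k: "k \<ge> 2" and t: "t \<ge> 1"
  shows "\<exists>\<sigma>. (\<forall>i. metric_t_tree k t (\<sigma> i) \<and> extends (\<sigma> i) (\<sigma> (Suc i)) \<and> saturates k t (\<sigma> i) (\<sigma> (Suc i))) \<and>
    clique (tedges (\<sigma> 0)) (tverts (\<sigma> 0)) \<and> card (tverts (\<sigma> 0)) = Suc t"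
proof -
  \<comment> \<open>Distance 1 throughout would give triangles of odd perimeter; distance 2 is
    admissible because \<open>k \<ge> 2\<close>.\<close>
  define S0 where "S0 = \<lparr>tverts = {..t}, tedges = {e. e \<subseteq> {..t} \<and> card e = 2}, tdist = \<lambda>x y. if x = y then 0 else 2\<rparr>"
  have "t_tree t {..t} {e. e \<subseteq> {..t} \<and> card e = 2}" by (rule t_tree.base) simp
  moreover have "antipodal_metric k {..t} (\<lambda>x y. if x = y then 0 else 2)"
    using k by (intro antipodal_metricI) auto
  ultimately have S0: "metric_t_tree k t S0" by (simp add: metric_t_tree_def S0_def)
  obtain \<sigma> where "\<sigma> 0 = S0" "\<And>i. metric_t_tree k t (\<sigma> i)"
    "\<And>i. extends (\<sigma> i) (\<sigma> (Suc i)) \<and> saturates k t (\<sigma> i) (\<sigma> (Suc i))"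
    using dependent_nat_choice[where P = "\<lambda>i S. (i = 0 \<longrightarrow> S = S0) \<and> metric_t_tree k t S"
        and Q = "\<lambda>_ S S'. extends S S' \<and> saturates k t S S'"] S0 saturate[OF k t] by (metis nat.distinct(1))
  then show ?thesis by (intro exI[of _ \<sigma>]) (auto simp: S0_def clique_def)
qed

lemma clique_distances:
  fixes B :: "'b sgraph"
  assumes B: "signed_graph B" "enat (2 * k) \<le> unbalanced_girth B"
    and S: "metric_t_tree k t S" and E: "extends S S'"
    and f: "realizes k B (tverts S') (tedges S') (tdist S') f c"
    and uv: "{u, v} \<in> tedges S"
  shows "f u \<in> verts B" "f u \<noteq> f v" "joined B (f u) (f v)" "\<bar>alg_dist B (f u) (f v)\<bar> \<le> int k"
    "pos_val k (alg_dist B (f u) (f v)) = signed_val k (c u * c v) (tdist S u v)" "c u \<in> {-1, 1}" "c v \<in> {-1, 1}"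
proof -
  note V = metric_t_tree_edge[OF S uv] and d = metric_t_tree_dist[OF S uv]
  have uv': "{u, v} \<in> tedges S'" "tdist S' u v = tdist S u v" "u \<in> tverts S'" "v \<in> tverts S'"
    using E uv V by (auto simp: extends_def)
  show fu: "f u \<in> verts B" and c: "c u \<in> {-1, 1}" "c v \<in> {-1, 1}" using f uv' unfolding realizes_def by blast+
  have w: "wk snd B (f u) (f v) (nat (signed_val k s (tdist S u v))) (s * (c u * c v))" if "s \<in> {-1, 1}" for s
    using f uv' that unfolding realizes_def by metis
  have "c u * c v \<in> {-1, 1}" using c by auto
  from realized_alg_dist[OF B d(2,3) this w]
  show "f u \<noteq> f v" "joined B (f u) (f v)" "\<bar>alg_dist B (f u) (f v)\<bar> \<le> int k"
    "pos_val k (alg_dist B (f u) (f v)) = signed_val k (c u * c v) (tdist S u v)" by blast+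
qed

definition clique_images :: "nat \<Rightarrow> (nat \<Rightarrow> 'b) \<Rightarrow> metric_tree \<Rightarrow> 'b set set" where
  "clique_images t f S = {f ` C | C. C \<subseteq> tverts S \<and> card C = Suc t \<and> clique (tedges S) C}"

text \<open>An isomorphism from \<open>K - {v}\<close> to \<open>X\<close> without \<open>x\<close>
  turns the metric of \<open>X\<close> into a one-vertex extension of a clique of \<open>S\<close>.
  Saturation finds it in \<open>S1\<close>, and \<open>eq\<close> brings the image of the enlarged
  clique back into the family.\<close>

lemma closed_cliques_clique_images:
  fixes B :: "'b sgraph"
  assumes k: "k \<ge> 2" and t: "t \<ge> 1" and B: "signed_graph B" "enat (2 * k) \<le> unbalanced_girth B"
    and S: "metric_t_tree k t S" "metric_t_tree k t S1" "extends S S1" "saturates k t S S1" "extends S1 S'"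
    and f: "realizes k B (tverts S') (tedges S') (tdist S') f c"
    and eq: "clique_images t f S1 = clique_images t f S"
  shows "clique_images t f S \<subseteq> wcliques (Suc t) (short_distance_graph k B) \<and>
    closed_cliques t k (short_distance_graph k B) (clique_images t f S)"
proof -
  let ?D = "short_distance_graph k B" and ?W = "clique_images t f S"
  have wtD: "wt ?D = alg_dist B" by (simp add: short_distance_graph_def)
  note cd = clique_distances[OF B S(2,5) f]
  have inj: "inj_on f C" if "clique (tedges S1) C" for C
    using cd(2) that unfolding inj_on_def clique_def by blast
  have SE: "tverts S \<subseteq> tverts S1" "tedges S \<subseteq> tedges S1" using S(3) by (auto simp: extends_def)
  have comp: "wcomplete (winduced ?D (f ` C))" if C: "clique (tedges S1) C" for C
  proof -
    have "e \<in> wedges ?D" if e: "e \<subseteq> f ` C" "card e = 2" for e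
    proof -
      obtain x y where xy: "e = {x, y}" "x \<noteq> y" using e(2) by (auto simp: card_2_iff)
      then obtain u v where uv: "u \<in> C" "v \<in> C" "x = f u" "y = f v" using e(1) by auto
      then have "{u, v} \<in> tedges S1" "{v, u} \<in> tedges S1" using C xy(2) unfolding clique_def by auto
      from cd(1,2,3,4)[OF this(1)] cd(1)[OF this(2)] show ?thesis
        using xy uv unfolding short_distance_graph_def by auto
    qed
    moreover have "card e = 2" if "e \<in> wedges ?D" for e
      using that by (auto simp: short_distance_graph_def)
    ultimately show ?thesis unfolding wcomplete_def winduced_def by auto
  qed
  have sub: "?W \<subseteq> wcliques (Suc t) ?D"
  proof
    fix K assume "K \<in> ?W"
    then obtain C where C: "K = f ` C" "C \<subseteq> tverts S" "card C = Suc t" "clique (tedges S) C"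
      unfolding clique_images_def by blast
    then have C1: "clique (tedges S1) C" using clique_mono SE by blast
    have "C \<subseteq> tverts S'" using C(2) SE S(5) by (auto simp: extends_def)
    then have "K \<subseteq> verts B" using f C(1) unfolding realizes_def by blast
    then show "K \<in> wcliques (Suc t) ?D"
      using comp[OF C1] card_image[OF inj[OF C1]] C by (simp add: wcliques_def short_distance_graph_def)
  qed
  have "closed_cliques t k ?D ?W"
    unfolding closed_cliques_def
  proof (intro ballI allI impI)
    fix K v X x c0 \<phi>
    assume K: "K \<in> ?W" "v \<in> K" and X: "X \<in> wide_complete_graphs (Suc t) k" "x \<in> wverts X"
      and iso: "wiso k (winduced ?D (K - {v})) (winduced X (wverts X - {x})) c0 \<phi>"
    obtain C where C: "K = f ` C" "C \<subseteq> tverts S" "card C = Suc t" "clique (tedges S) C"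
      using K(1) unfolding clique_images_def by blast
    obtain v0 where v0: "v0 \<in> C" "v = f v0" using K(2) C(1) by blast
    define Q where "Q = C - {v0}"
    have C1: "clique (tedges S1) C" using clique_mono C(4) SE by blast
    have finC: "finite C" using C(3) by (metis card.infinite nat.distinct(1))
    have Q: "Q \<subseteq> tverts S" "card Q = t" "clique (tedges S) Q" "finite Q"
      using C v0 finC by (auto simp: Q_def clique_def)
    have Q1: "clique (tedges S1) Q" using clique_mono Q(3) SE by blast
    have fQ: "f ` Q = K - {v}" using inj[OF C1] v0 by (auto simp: Q_def C(1) inj_on_def)
    have finj: "inj_on f Q" by (rule inj[OF Q1])
    define mX where "mX = weight_metric k (wt X)"
    have mX: "antipodal_metric k (wverts X) mX"
      using wide_complete_graphs_metric[OF _ X(1)] k by (simp add: mX_def)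
    have Xc: "wcomplete X" "weights_upto k X" using X by (auto simp: wide_complete_graphs_def wide_def)
    have up: "weights_upto k (winduced ?D A)" for A
      using weights_upto_winduced[OF short_distance_graph(2)[OF B(1)]] .
    have i: "\<forall>u\<in>K - {v}. c0 u \<in> {-1, 1}" "bij_betw \<phi> (K - {v}) (wverts X - {x})"
      "\<forall>a\<in>K - {v}. \<forall>b\<in>K - {v}. a \<noteq> b \<longrightarrow>
        pos_val k (wt X (\<phi> a) (\<phi> b)) = signed_val k (c0 a * c0 b) (pos_val k (alg_dist B a b))"
      using iso wiso_complete_iff[OF wcomplete_winduced_subset[OF comp[OF C1]] wcomplete_imp_winduced[OF Xc(1)]
          up weights_upto_winduced[OF Xc(2)]] by (auto simp: C(1) wtD)
    have cQ: "c u \<in> {-1, 1}" if "u \<in> Q" for u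
      using f that Q(1) SE S(5) unfolding realizes_def extends_def by blast
    have c0Q: "c0 (f u) \<in> {-1, 1}" if "u \<in> Q" for u using i(1) that fQ by blast
    obtain z0 where z0: "z0 \<notin> Q" using ex_new_if_finite[OF infinite_UNIV_nat Q(4)] by blast
    define \<beta> where "\<beta> = (\<lambda>u. if u = z0 then x else \<phi> (f u))"
    \<comment> \<open>On \<open>Q\<close> the metrics of \<open>S\<close> and \<open>X\<close>
      differ by the switching \<open>c\<close> of the realizing map and by \<open>c0\<close>; the
      product undoes both. The value 1 at \<open>z0\<close> makes \<open>c z\<close> the switching
      value at the image of the new vertex.\<close>
    define e where "e = (\<lambda>u. if u = z0 then 1 else c0 (f u) * c u)"
    define q where "q = (\<lambda>a b. if a = b then 0 else signed_val k (e a * e b) (mX (\<beta> a) (\<beta> b)))"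
    have \<phi>Q: "\<phi> (f u) \<in> wverts X" "\<phi> (f u) \<noteq> x" if "u \<in> Q" for u
    proof -
      have "f u \<in> K - {v}" using fQ that by blast
      then have "\<phi> (f u) \<in> wverts X - {x}" by (rule bij_betwE[OF i(2), rule_format])
      then show "\<phi> (f u) \<in> wverts X" "\<phi> (f u) \<noteq> x" by auto
    qed
    have \<phi>inj: "\<phi> (f u) \<noteq> \<phi> (f w)" if "u \<in> Q" "w \<in> Q" "u \<noteq> w" for u w
    proof -
      have "f u \<in> K - {v}" "f w \<in> K - {v}" "f u \<noteq> f w" using fQ that finj by (auto simp: inj_on_def)
      then show ?thesis using i(2) by (auto simp: bij_betw_def inj_on_def)
    qed
    have eQ: "e u \<in> {-1, 1}" if "u \<in> insert z0 Q" for u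
      using that c0Q[of u] cQ[of u] by (auto simp: e_def)
    have q: "antipodal_metric k (insert z0 Q) q"
      unfolding q_def
    proof (rule antipodal_metric_switch)
      show "k \<ge> 1" using k by simp
      show "antipodal_metric k (insert z0 Q) (\<lambda>a b. mX (\<beta> a) (\<beta> b))"
        by (rule antipodal_metric_pullback[OF mX])
          (use \<phi>Q \<phi>inj X(2) z0 in \<open>auto simp: \<beta>_def inj_on_def\<close>)
    qed (rule eQ)
    have qS: "q u w = tdist S u w" if uw: "u \<in> Q" "w \<in> Q" for u w
    proof (cases "u = w")
      case True
      then show ?thesis using antipodal_metricD(1)[of k "tverts S" "tdist S" u u] S(1) Q(1) uw
        by (auto simp: q_def metric_t_tree_def)
    next
      case False
      then have uw': "{u, w} \<in> tedges S" "{u, w} \<in> tedges S1" using Q(3) Q1 uw by (auto simp: clique_def)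
      have "tdist S1 u w = tdist S u w" using S(3) Q(1) uw unfolding extends_def by blast
      then have "pos_val k (alg_dist B (f u) (f w)) = signed_val k (c u * c w) (tdist S u w)"
        using cd(5)[OF uw'(2)] by simp
      moreover have "f u \<in> K - {v}" "f w \<in> K - {v}" "f u \<noteq> f w" using fQ uw False finj by (auto simp: inj_on_def)
      ultimately have "mX (\<phi> (f u)) (\<phi> (f w)) = signed_val k (c0 (f u) * c0 (f w)) (signed_val k (c u * c w) (tdist S u w))"
        using i(3) \<phi>inj[OF uw False] by (simp add: mX_def weight_metric_def)
      moreover have "u \<noteq> z0" "w \<noteq> z0" using uw z0 by auto
      ultimately show ?thesis using False cQ[OF uw(1)] cQ[OF uw(2)] c0Q[OF uw(1)] c0Q[OF uw(2)]
        by (auto simp: q_def e_def \<beta>_def)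
    qed
    obtain z where z: "z \<in> tverts S1" "z \<notin> Q" "\<forall>u\<in>Q. {u, z} \<in> tedges S1 \<and> tdist S1 u z = q z0 u"
      using S(4)[unfolded saturates_def, rule_format, of Q z0 q] Q z0 q qS by blast
    define C' where "C' = insert z Q"
    have C': "clique (tedges S1) C'" "C' \<subseteq> tverts S1" "card C' = Suc t"
      using z Q1 Q SE by (auto simp: C'_def clique_def insert_commute)
    have "f ` C' \<in> clique_images t f S1"
      unfolding clique_images_def using C' by (intro CollectI exI[of _ C']) simp
    then have K'W: "f ` C' \<in> ?W" by (simp only: eq)
    have injC': "inj_on f C'" by (rule inj[OF C'(1)])
    have fz: "f z \<notin> f ` Q" using injC' z(2) by (auto simp: C'_def)
    have "z \<in> tverts S'" using z(1) S(5) unfolding extends_def by blast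
    then have cz: "c z \<in> {-1, 1}" using f unfolding realizes_def by blast
    define c' where "c' = (\<lambda>y. if y = f z then c z else c0 y)"
    define \<phi>' where "\<phi>' = (\<lambda>y. if y = f z then x else \<phi> y)"
    have old: "c' u = c0 u \<and> \<phi>' u = \<phi> u" if "u \<in> K - {v}" for u
      using that fz fQ by (auto simp: c'_def \<phi>'_def)
    have fC': "f ` C' = insert (f z) (K - {v})" using fQ by (simp add: C'_def)
    have new: "pos_val k (wt X (\<phi> (f u)) x) = signed_val k (c0 (f u) * c z) (pos_val k (alg_dist B (f u) (f z)))"
      if u: "u \<in> Q" for u
    proof -
      have uz: "{u, z} \<in> tedges S1" "tdist S1 u z = q z0 u" using z(3) u by auto
      have "u \<noteq> z0" using u z0 by auto
      then have "q z0 u = signed_val k (c0 (f u) * c u) (mX x (\<phi> (f u)))" by (simp add: q_def e_def \<beta>_def)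
      moreover have "mX x (\<phi> (f u)) = mX (\<phi> (f u)) x" using antipodal_metricD(2)[OF mX X(2) \<phi>Q(1)[OF u]] .
      moreover have "mX (\<phi> (f u)) x = pos_val k (wt X (\<phi> (f u)) x)" using \<phi>Q(2)[OF u] by (simp add: mX_def weight_metric_def)
      ultimately have "pos_val k (alg_dist B (f u) (f z)) =
        signed_val k (c u * c z) (signed_val k (c0 (f u) * c u) (pos_val k (wt X (\<phi> (f u)) x)))"
        using cd(5)[OF uz(1)] uz(2) by simp
      then show ?thesis using cQ[OF u] c0Q[OF u] cz by auto
    qed
    have "wiso k (winduced ?D (f ` C')) X c' \<phi>'"
    proof (subst wiso_complete_iff[OF comp[OF C'(1)] Xc(1) up Xc(2)], intro conjI ballI impI)
      fix a assume "a \<in> wverts (winduced ?D (f ` C'))"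
      then show "c' a \<in> {-1, 1}" using i(1) cz by (auto simp: fC' c'_def)
    next
      have "bij_betw \<phi>' (K - {v}) (wverts X - {x})"
        using i(2) old by (subst bij_betw_cong[of _ _ \<phi>]) auto
      moreover have "\<phi>' (f z) = x" by (simp add: \<phi>'_def)
      moreover have "f z \<notin> K - {v}" using fz fQ by simp
      ultimately have "bij_betw \<phi>' (insert (f z) (K - {v})) (insert x (wverts X - {x}))"
        using notIn_Un_bij_betw[of "f z" "K - {v}" \<phi>' "wverts X - {x}"] by simp
      then show "bij_betw \<phi>' (wverts (winduced ?D (f ` C'))) (wverts X)" using X(2) by (simp add: fC' insert_absorb)
    next
      fix a b assume ab: "a \<in> wverts (winduced ?D (f ` C'))" "b \<in> wverts (winduced ?D (f ` C'))" "a \<noteq> b"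
      have symX: "wt X y x = wt X x y" if "y \<in> wverts X" "y \<noteq> x" for y
      proof -
        have "{y, x} \<in> wedges X" using wcomplete_edge[OF Xc(1)] that X(2) by blast
        then show ?thesis using X(1) unfolding wide_complete_graphs_def weighted_graph_def by blast
      qed
      have "a \<in> K - {v} \<and> b \<in> K - {v} \<or> a \<in> K - {v} \<and> b = f z \<or> a = f z \<and> b \<in> K - {v}"
        using ab by (auto simp: fC')
      then have "pos_val k (wt X (\<phi>' a) (\<phi>' b)) = signed_val k (c' a * c' b) (pos_val k (alg_dist B a b))"
      proof (elim disjE conjE)
        assume "a \<in> K - {v}" "b \<in> K - {v}"
        then show ?thesis using i(3) old ab(3) by metis
      next
        assume a: "a \<in> K - {v}" and b: "b = f z"
        then obtain u where "u \<in> Q" "a = f u" using fQ by blast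
        then show ?thesis using new[of u] old[OF a] b by (simp add: c'_def \<phi>'_def)
      next
        assume a: "a = f z" and b: "b \<in> K - {v}"
        then obtain u where u: "u \<in> Q" "b = f u" using fQ by blast
        then show ?thesis using new[of u] old[OF b] a symX[OF \<phi>Q[OF u(1)]] alg_dist_commute[of B "f u" "f z"]
          by (simp add: c'_def \<phi>'_def mult.commute)
      qed
      then show "pos_val k (wt X (\<phi>' a) (\<phi>' b)) = signed_val k (c' a * c' b) (pos_val k (wt (winduced ?D (f ` C')) a b))"
        by (simp add: wtD)
    qed
    moreover have "K - {v} \<subseteq> f ` C'" using fC' by blast
    ultimately show "\<exists>K'\<in>?W. K - {v} \<subseteq> K' \<and> (\<exists>c' \<phi>'. (\<forall>u\<in>K - {v}. c' u = c0 u \<and> \<phi>' u = \<phi> u) \<and>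
        wiso k (winduced ?D K') X c' \<phi>')"
      using K'W old by blast
  qed
  then show ?thesis using sub by blast
qed

lemma closed_cliques_if_bounds:
  fixes B :: "'b sgraph"
  assumes k: "k \<ge> 2" and t: "t \<ge> 1" and B: "signed_graph B" "unbalanced_girth B = enat (2 * k)"
    and bounds: "bounds B (SBPT t k)"
  shows "\<exists>D W. partial_distance_graph B D \<and> weights_upto k D \<and>
       W \<noteq> {} \<and> W \<subseteq> wcliques (Suc t) D \<and> closed_cliques t k D W"
proof -
  obtain \<sigma> where \<sigma>: "\<And>i. metric_t_tree k t (\<sigma> i)" "\<And>i. extends (\<sigma> i) (\<sigma> (Suc i))"
    "\<And>i. saturates k t (\<sigma> i) (\<sigma> (Suc i))" "clique (tedges (\<sigma> 0)) (tverts (\<sigma> 0))" "card (tverts (\<sigma> 0)) = Suc t"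
    using saturated_chain[OF k t] by blast
  have ext: "extends (\<sigma> i) (\<sigma> j)" if "i \<le> j" for i j
    using that by (induction rule: dec_induct) (use extends_refl extends_trans \<sigma>(2) in blast)+
  \<comment> \<open>The families \<open>W i\<close> with \<open>i \<le> N\<close> consist of subsets
    of \<open>verts B\<close>, so they cannot increase strictly \<open>N\<close> times.\<close>
  define N where "N = Suc (card (Pow (verts B)))"
  have girth: "enat (2 * k) \<le> unbalanced_girth B" using B(2) by simp
  have "\<exists>f c. realizes k B (tverts (\<sigma> N)) (tedges (\<sigma> N)) (tdist (\<sigma> N)) f c"
  proof (cases "t = 1")
    case True
    obtain vs es where "cycle B vs es" "length es = 2 * k" "sign_of es = -1" using girth_attained[OF B(2)] .
    then have "wk snd B (hd vs) (hd vs) (2 * k) (-1)" using cycle_imp_wk[of B vs es snd] by (simp add: sign_of_def)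
    moreover have "t_tree 1 (tverts (\<sigma> N)) (tedges (\<sigma> N))"
      "antipodal_metric k (tverts (\<sigma> N)) (tdist (\<sigma> N))"
      using \<sigma>(1)[of N] True by (simp_all add: metric_t_tree_def)
    ultimately show ?thesis using realizes_tree[OF B(1) _ _ _ order_refl] by blast
  next
    case False
    then show ?thesis using realizes_bounded[OF k _ B(1) bounds \<sigma>(1)] t by simp
  qed
  then obtain f c where f: "realizes k B (tverts (\<sigma> N)) (tedges (\<sigma> N)) (tdist (\<sigma> N)) f c" by blast
  define W where "W = (\<lambda>i. clique_images t f (\<sigma> i))"
  have mono: "W i \<subseteq> W j" if "i \<le> j" for i j
  proof
    fix K assume "K \<in> W i"
    then obtain C where C: "K = f ` C" "C \<subseteq> tverts (\<sigma> i)" "card C = Suc t" "clique (tedges (\<sigma> i)) C"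
      unfolding W_def clique_images_def by auto
    have "tverts (\<sigma> i) \<subseteq> tverts (\<sigma> j)" "tedges (\<sigma> i) \<subseteq> tedges (\<sigma> j)"
      using ext[OF that] by (auto simp: extends_def)
    then have "C \<subseteq> tverts (\<sigma> j)" "clique (tedges (\<sigma> j)) C" using C(2) clique_mono[OF C(4)] by auto
    then show "K \<in> W j" unfolding W_def clique_images_def using C(1,3) by (intro CollectI exI[of _ C]) simp
  qed
  have "f ` tverts (\<sigma> N) \<subseteq> verts B" using f unfolding realizes_def by blast
  then have "W N \<subseteq> Pow (verts B)" unfolding W_def clique_images_def by auto
  moreover have finB: "finite (verts B)" using B(1) by (simp add: signed_graph_def)
  ultimately have WN: "finite (W N)" "card (W N) < N"
    using finite_subset card_mono[of "Pow (verts B)" "W N"] by (auto simp: N_def)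
  have "\<exists>i<N. W (Suc i) = W i"
  proof (rule ccontr)
    assume ne: "\<not> ?thesis"
    have "W i \<subset> W (Suc i)" if "i < N" for i
    proof
      show "W i \<subseteq> W (Suc i)" by (rule mono) simp
      show "W i \<noteq> W (Suc i)" using ne that by metis
    qed
    from Suc_le_card_if_strict[of N W, OF this WN(1)] show False using WN(2) by simp
  qed
  then obtain i where i: "i < N" "W (Suc i) = W i" by blast
  have "W i \<subseteq> wcliques (Suc t) (short_distance_graph k B) \<and> closed_cliques t k (short_distance_graph k B) (W i)"
    unfolding W_def
    by (rule closed_cliques_clique_images[OF k t B(1) girth \<sigma>(1) \<sigma>(1) \<sigma>(2,3) ext f])
      (use i in \<open>auto simp: W_def\<close>)
  moreover have "W i \<noteq> {}"
  proof -
    have "f ` tverts (\<sigma> 0) \<in> W 0"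
      using \<sigma>(4,5) unfolding W_def clique_images_def by (intro CollectI exI[of _ "tverts (\<sigma> 0)"]) simp
    then show ?thesis using mono[of 0 i] by blast
  qed
  ultimately show ?thesis using short_distance_graph[OF B(1)] by blast
qed

text \<open>A cycle of length 2 consists of two different edges with the same ends. So a positive
  \<open>k\<close> is at least 2, as the rounding and the unit graphs require.\<close>

lemma simple_graph_girth_neq:
  assumes "simple_graph B" "unbalanced_girth B = enat (2 * k)"
  shows "k \<noteq> 1"
proof
  assume "k = 1"
  then have "unbalanced_girth B = enat 2" using assms(2) by simp
  then obtain vs es where c: "cycle B vs es" "length es = 2" by (rule girth_attained)
  then have w: "walk B vs es" "hd vs = last vs" "distinct es" "length vs = 3" by (auto simp: cycle_def walk_def)
  obtain x y z where vs: "vs = [x, y, z]" using w(4) by (auto simp: numeral_3_eq_3 length_Suc_conv)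
  obtain e e' where es: "es = [e, e']" using c(2) by (auto simp: numeral_2_eq_2 length_Suc_conv)
  have "e \<in> sedges B" "e' \<in> sedges B" "fst e = {x, y}" "fst e' = {y, z}"
    using w(1) unfolding walk_def vs es by (auto simp: less_Suc_eq)
  moreover have "x = z" using w(2) vs by simp
  ultimately have "e = e'" using assms(1) unfolding simple_graph_def inj_on_def by (auto simp: insert_commute)
  then show False using w(3) es by simp
qed

theorem theorem3:
  fixes B :: "'b sgraph" and k t :: nat
  assumes "k \<ge> 1" and "t \<ge> 1"
    and "signed_graph B" and "simple_graph B" and "bipartite B"
    and "unbalanced_girth B = enat (2 * k)"
  shows "bounds B (SBPT t k) \<longleftrightarrow>
    (\<exists>D W. partial_distance_graph B D \<and> weights_upto k D \<and>
       W \<noteq> {} \<and> W \<subseteq> wcliques (Suc t) D \<and> closed_cliques t k D W)"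
proof -
  have k: "k \<ge> 2" using assms(1) simple_graph_girth_neq[OF assms(4,6)] by simp
  have girth: "enat (2 * k) \<le> unbalanced_girth B" using assms(6) by simp
  show ?thesis
  proof
    assume "bounds B (SBPT t k)"
    then show "\<exists>D W. partial_distance_graph B D \<and> weights_upto k D \<and>
       W \<noteq> {} \<and> W \<subseteq> wcliques (Suc t) D \<and> closed_cliques t k D W"
      using closed_cliques_if_bounds[OF k assms(2,3,6)] by blast
  next
    assume "\<exists>D W. partial_distance_graph B D \<and> weights_upto k D \<and>
       W \<noteq> {} \<and> W \<subseteq> wcliques (Suc t) D \<and> closed_cliques t k D W"
    then show "bounds B (SBPT t k)"
      using bounds_if_closed_cliques[OF k assms(2,3,5) girth] by blast
  qed
qed

end
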